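(* Let $N\ge 2$, $R\in(0,\infty)$, $\delta\in[0,R)$ and $\alpha>R$. Let $f:[\delta,R]\times[0,\alpha)\to[0,\infty)$ be continuous with $f(r,s)>0$ for all $(r,s)\in[\delta,R]\times(0,\alpha)$. Suppose that $\lim_{s\to0^+}\frac{f(r,s)}{s}=0$ uniformly in $r\in[\delta,R]$. Then there exists a connected component $\zeta$ of $\Sigma_\delta$ (the closure of the set of nontrivial solutions, defined in the context) such that: (a) $\zeta\subset(0,\infty)\times\operatorname{int}P_\delta$; (b) $\zeta$ joins $(\infty,\theta)$ with $(\infty,R-\delta)$ in $\mathbb R\times X_\delta$; (c) there exist two constants $\Lambda>0$ and $\rho_0\in(0,R-\delta)$ such that $$\zeta\cap\{(\mu,v)\in\Sigma_\delta:\ \mu\ge\Lambda,\ \|v\|_{C[\delta,R]}=\rho_0\}=\emptyset;$$ (d) $\operatorname{Proj}_{\mathbb R}\zeta=[\lambda_*,\infty)\subset(0,\infty)$ for some $\lambda_*$; (e) for every $n\in\mathbb N$, for $(\lambda,u)\in\zeta$ with $\|u\|_{C[\delta,R]}\ge\rho_0$, $$\lim_{\lambda\to\infty}\operatorname{meas}\Big\{r\in[\delta,R]:|u'(r)-(-1)|>\tfrac1n\Big\}=0;$$ (f) for $(\lambda,u)\in\zeta$ with $\|u\|_{C[\delta,R]}\ge\rho_0$, $$\lim_{\lambda\to\infty}\|u\|_{C[\delta,R]}=R-\delta.$$ Here $\rho_0$ in (e) and (f) is the constant of (c), and the limits in (e) and (f) are taken as $\lambda\to\infty$ along pairs $(\lambda,u)\in\zeta$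 with $\|u\|_{C[\delta,R]}\ge\rho_0$.
   Context: Let $\phi_1(s)=\frac{s}{\sqrt{1-s^2}}$ for $|s|<1$. For $\lambda\ge0$ consider the boundary value problem $$(r^{N-1}\phi_1(u'))'+\lambda r^{N-1}f(r,u)=0\ \text{ on }(\delta,R),\qquad u'(\delta)=u(R)=0. \tag{P}$$ A solution of (P) is a function $u\in C^1[\delta,R]$ with values in $[0,\alpha)$ (where $f$ is defined), with $|u'|<1$ on $[\delta,R]$, with $r^{N-1}\phi_1(u')$ continuously differentiable, satisfying (P). $X_\delta=C[\delta,R]$ with norm $\|u\|_{C[\delta,R]}=\sup_{[\delta,R]}|u|$; $E_\delta=\{u\in C^1[\delta,R]:u'(\delta)=u(R)=0\}$ with norm $\|u\|_{C^1[\delta,R]}=\sup|u|+\sup|u'|$; $\theta$ is the zero element of $E_\delta$. $P_\delta=\{u\in E_\delta:u(t)\ge0,\ t\in[\delta,R]\}$, and $\operatorname{int}P_\delta$ is its interior in $E_\delta$. $\Sigma_\delta$ is the closure in $\mathbb R\times E_\delta$ of $\{(\lambda,u)\in[0,\infty)\times C^1[\delta,R]: u\text{ satisfies (P)},\ u\not\equiv0\}$. A component of a set is a maximal connected subset. $\operatorname{Proj}_{\mathbb R}\zeta$ is the set of $\lambda$ such that $(\lambda,u)\in\zeta$ for some $u$. "$\zeta$ joins $(\infty,\theta)$ with $(\infty,R-\delta)$ in $\mathbb R\times X_\delta$" means that $\zeta$ contains a sequence $(\lambda_k,u_k)$ with $\lambda_k\to\infty$ and $\|u_k\|_{C[\delta,R]}\to0$,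 and a sequence $(\mu_k,v_k)$ with $\mu_k\to\infty$ and $\|v_k\|_{C[\delta,R]}\to R-\delta$. $\operatorname{meas}$ is Lebesgue measure. *)

theory Defs
  imports "HOL-Analysis.Analysis"
begin

definition phi1 :: "real \<Rightarrow> real" where
  "phi1 s = s / sqrt (1 - s\<^sup>2)"

text \<open>The derivative on a compact interval is one-sided at the endpoints.\<close>

definition deriv_on :: "real \<Rightarrow> real \<Rightarrow> (real \<Rightarrow> real) \<Rightarrow> real \<Rightarrow> real" where
  "deriv_on \<delta> R u t = vector_derivative u (at t within {\<delta>..R})"

definition C1_on :: "real \<Rightarrow> real \<Rightarrow> (real \<Rightarrow> real) \<Rightarrow> bool" where
  "C1_on \<delta> R u \<longleftrightarrow> u differentiable_on {\<delta>..R} \<and> continuous_on {\<delta>..R} (deriv_on \<delta> R u)"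

definition norm_C :: "real \<Rightarrow> real \<Rightarrow> (real \<Rightarrow> real) \<Rightarrow> real" where
  "norm_C \<delta> R u = (SUP t\<in>{\<delta>..R}. \<bar>u t\<bar>)"

definition norm_C1 :: "real \<Rightarrow> real \<Rightarrow> (real \<Rightarrow> real) \<Rightarrow> real" where
  "norm_C1 \<delta> R u = norm_C \<delta> R u + norm_C \<delta> R (deriv_on \<delta> R u)"

text \<open>Functions on \<open>[\<delta>, R]\<close> are represented by total functions that are extensional on
  \<open>{\<delta>..R}\<close>, so that equality of representatives is equality on the interval.\<close>

definition C1_space :: "real \<Rightarrow> real \<Rightarrow> (real \<Rightarrow> real) set" where
  "C1_space \<delta> R = {u \<in> extensional {\<delta>..R}. C1_on \<delta> R u}"

definition E_space :: "real \<Rightarrow> real \<Rightarrow> (real \<Rightarrow> real) set" where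
  "E_space \<delta> R = {u \<in> C1_space \<delta> R. deriv_on \<delta> R u \<delta> = 0 \<and> u R = 0}"

text \<open>\<open>Metric_space\<close> requires a distance that is symmetric and nonnegative off its carrier
  as well, hence the default value there.\<close>

definition E_dist :: "real \<Rightarrow> real \<Rightarrow> (real \<Rightarrow> real) \<Rightarrow> (real \<Rightarrow> real) \<Rightarrow> real" where
  "E_dist \<delta> R u v =
     (if u \<in> E_space \<delta> R \<and> v \<in> E_space \<delta> R then norm_C1 \<delta> R (\<lambda>t. u t - v t) else 0)"

definition E_topology :: "real \<Rightarrow> real \<Rightarrow> (real \<Rightarrow> real) topology" where
  "E_topology \<delta> R = Metric_space.mtopology (E_space \<delta> R) (E_dist \<delta> R)"

definition P_cone :: "real \<Rightarrow> real \<Rightarrow> (real \<Rightarrow> real) set" where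
  "P_cone \<delta> R = {u \<in> E_space \<delta> R. \<forall>t\<in>{\<delta>..R}. 0 \<le> u t}"

definition solution ::
  "nat \<Rightarrow> real \<Rightarrow> real \<Rightarrow> real \<Rightarrow> (real \<Rightarrow> real \<Rightarrow> real) \<Rightarrow> real \<Rightarrow> (real \<Rightarrow> real) \<Rightarrow> bool" where
  "solution N \<delta> R \<alpha> f \<mu> u \<longleftrightarrow>
     u \<in> C1_space \<delta> R \<and>
     (\<forall>r\<in>{\<delta>..R}. u r \<in> {0..<\<alpha>}) \<and>
     (\<forall>r\<in>{\<delta>..R}. \<bar>deriv_on \<delta> R u r\<bar> < 1) \<and>
     C1_on \<delta> R (\<lambda>r. r ^ (N - 1) * phi1 (deriv_on \<delta> R u r)) \<and>
     (\<forall>r\<in>{\<delta><..<R}.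
        deriv_on \<delta> R (\<lambda>r. r ^ (N - 1) * phi1 (deriv_on \<delta> R u r)) r
          + \<mu> * r ^ (N - 1) * f r (u r) = 0) \<and>
     deriv_on \<delta> R u \<delta> = 0 \<and> u R = 0"

definition Sigma_set ::
  "nat \<Rightarrow> real \<Rightarrow> real \<Rightarrow> real \<Rightarrow> (real \<Rightarrow> real \<Rightarrow> real) \<Rightarrow> (real \<times> (real \<Rightarrow> real)) set" where
  "Sigma_set N \<delta> R \<alpha> f =
     prod_topology euclideanreal (E_topology \<delta> R) closure_of
       {(\<mu>, u). 0 \<le> \<mu> \<and> solution N \<delta> R \<alpha> f \<mu> u \<and> (\<exists>t\<in>{\<delta>..R}. u t \<noteq> 0)}"

definition reaches_infinity_at ::
  "real \<Rightarrow> real \<Rightarrow> (real \<times> (real \<Rightarrow> real)) set \<Rightarrow> real \<Rightarrow> bool" where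
  "reaches_infinity_at \<delta> R \<zeta> c \<longleftrightarrow>
     (\<exists>\<mu> u. (\<forall>k::nat. (\<mu> k, u k) \<in> \<zeta>) \<and>
            filterlim \<mu> at_top sequentially \<and>
            (\<lambda>k. norm_C \<delta> R (u k)) \<longlonglongrightarrow> c)"

text \<open>\<open>\<lambda> \<rightarrow> \<infinity>\<close> along the pairs \<open>(\<lambda>, u) \<in> \<zeta>\<close> whose sup norm is at least \<open>\<rho>\<close>.\<close>

definition branch_at_infinity ::
  "real \<Rightarrow> real \<Rightarrow> (real \<times> (real \<Rightarrow> real)) set \<Rightarrow> real \<Rightarrow> (real \<times> (real \<Rightarrow> real)) filter" where
  "branch_at_infinity \<delta> R \<zeta> \<rho> =
     inf (filtercomap fst at_top) (principal {(\<mu>, u) \<in> \<zeta>. \<rho> \<le> norm_C \<delta> R u})"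

lemma continuous_bdd:
  fixes u :: "real \<Rightarrow> real"
  assumes "continuous_on {\<delta>..R} u"
  shows "bdd_above ((\<lambda>t. \<bar>u t\<bar>) ` {\<delta>..R})"
proof -
  have "compact ((\<lambda>t. \<bar>u t\<bar>) ` {\<delta>..R})"
    using assms by (intro compact_continuous_image continuous_intros) auto
  then show ?thesis
    by (simp add: bounded_imp_bdd_above compact_imp_bounded)
qed

lemma abs_le_norm_C:
  assumes "continuous_on {\<delta>..R} u" "t \<in> {\<delta>..R}"
  shows "\<bar>u t\<bar> \<le> norm_C \<delta> R u"
  unfolding norm_C_def using continuous_bdd[OF assms(1)] assms(2) by (rule cSUP_upper2) simp

lemma norm_C_nonneg:
  assumes "\<delta> < R" "continuous_on {\<delta>..R} u"
  shows "0 \<le> norm_C \<delta> R u"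
  using abs_le_norm_C[OF assms(2), of \<delta>] assms(1) by auto

lemma norm_C_triangle:
  assumes "\<delta> < R" "continuous_on {\<delta>..R} u" "continuous_on {\<delta>..R} v"
    and "\<And>t. t \<in> {\<delta>..R} \<Longrightarrow> w t = u t + v t"
  shows "norm_C \<delta> R w \<le> norm_C \<delta> R u + norm_C \<delta> R v"
proof -
  have "\<bar>w t\<bar> \<le> norm_C \<delta> R u + norm_C \<delta> R v" if "t \<in> {\<delta>..R}" for t
    using abs_le_norm_C[OF assms(2) that] abs_le_norm_C[OF assms(3) that] assms(4)[OF that]
    by linarith
  then show ?thesis
    unfolding norm_C_def[of _ _ w] using assms(1) by (intro cSUP_least) auto
qed

lemma has_deriv_on:
  assumes "C1_on \<delta> R u" "t \<in> {\<delta>..R}"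
  shows "(u has_vector_derivative deriv_on \<delta> R u t) (at t within {\<delta>..R})"
  using assms unfolding C1_on_def deriv_on_def differentiable_on_def
  by (simp add: vector_derivative_works)

lemma deriv_on_eqI:
  assumes "\<delta> < R" "t \<in> {\<delta>..R}" "(u has_vector_derivative d) (at t within {\<delta>..R})"
  shows "deriv_on \<delta> R u t = d"
  unfolding deriv_on_def using vector_derivative_within_cbox[of \<delta> R] assms
  by (metis box_real(2))

lemma deriv_on_diff:
  assumes "\<delta> < R" "C1_on \<delta> R u" "C1_on \<delta> R v" "t \<in> {\<delta>..R}"
  shows "deriv_on \<delta> R (\<lambda>t. u t - v t) t = deriv_on \<delta> R u t - deriv_on \<delta> R v t"
  using assms by (intro deriv_on_eqI has_vector_derivative_diff has_deriv_on) auto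

lemma C1_on_diff:
  assumes "\<delta> < R" "C1_on \<delta> R u" "C1_on \<delta> R v"
  shows "C1_on \<delta> R (\<lambda>t. u t - v t)"
proof -
  have "continuous_on {\<delta>..R} (\<lambda>t. deriv_on \<delta> R u t - deriv_on \<delta> R v t)"
    using assms unfolding C1_on_def by (intro continuous_on_diff) auto
  then have "continuous_on {\<delta>..R} (deriv_on \<delta> R (\<lambda>t. u t - v t))"
    by (rule continuous_on_eq) (simp add: deriv_on_diff[OF assms])
  then show ?thesis
    using assms(2,3) unfolding C1_on_def by (auto intro: differentiable_on_diff)
qed

lemma Metric_space_E:
  assumes "\<delta> < R"
  shows "Metric_space (E_space \<delta> R) (E_dist \<delta> R)"
proof
  have C1: "C1_on \<delta> R u" "u \<in> extensional {\<delta>..R}" if "u \<in> E_space \<delta> R" for u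
    using that by (auto simp: E_space_def C1_space_def)
  have cont: "continuous_on {\<delta>..R} u" "continuous_on {\<delta>..R} (deriv_on \<delta> R u)"
    if "C1_on \<delta> R u" for u
    using that by (auto simp: C1_on_def differentiable_imp_continuous_on)
  have nonneg: "0 \<le> norm_C1 \<delta> R u" if "C1_on \<delta> R u" for u
    using cont[OF that] by (simp add: norm_C1_def norm_C_nonneg assms)
  have commute: "norm_C \<delta> R u = norm_C \<delta> R v"
    if "\<And>t. t \<in> {\<delta>..R} \<Longrightarrow> u t = - v t" for u v
    unfolding norm_C_def using that by (intro SUP_cong) auto
  have zero: "norm_C \<delta> R u = 0" if "\<And>t. t \<in> {\<delta>..R} \<Longrightarrow> u t = 0" for u
    using that assms by (simp add: norm_C_def)
  have deriv0: "deriv_on \<delta> R (\<lambda>t. 0) t = 0" if "t \<in> {\<delta>..R}" for t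
    using assms that by (intro deriv_on_eqI) auto
  show "0 \<le> E_dist \<delta> R u v" for u v
    using C1 by (auto simp: E_dist_def intro!: nonneg C1_on_diff[OF assms])
  show "E_dist \<delta> R u v = E_dist \<delta> R v u" for u v
  proof (cases "u \<in> E_space \<delta> R \<and> v \<in> E_space \<delta> R")
    case True
    have "norm_C \<delta> R (\<lambda>t. u t - v t) = norm_C \<delta> R (\<lambda>t. v t - u t)"
      by (rule commute) simp
    moreover have "norm_C \<delta> R (deriv_on \<delta> R (\<lambda>t. u t - v t))
        = norm_C \<delta> R (deriv_on \<delta> R (\<lambda>t. v t - u t))"
      using C1 True by (intro commute) (simp add: deriv_on_diff[OF assms])
    ultimately show ?thesis by (simp add: E_dist_def norm_C1_def)
  qed (auto simp: E_dist_def)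
  show "E_dist \<delta> R u v = 0 \<longleftrightarrow> u = v" if uv: "u \<in> E_space \<delta> R" "v \<in> E_space \<delta> R" for u v
  proof
    assume "u = v"
    then show "E_dist \<delta> R u v = 0"
      using zero[of "deriv_on \<delta> R (\<lambda>t. 0)", OF deriv0] zero[of "\<lambda>t. 0", OF refl]
      by (simp add: E_dist_def norm_C1_def)
  next
    assume 0: "E_dist \<delta> R u v = 0"
    have d: "C1_on \<delta> R (\<lambda>t. u t - v t)"
      using C1 uv by (intro C1_on_diff assms)
    have "norm_C \<delta> R (\<lambda>t. u t - v t) \<le> 0"
      using 0 uv norm_C_nonneg[OF assms cont(2)[OF d]] by (simp add: E_dist_def norm_C1_def)
    then have "u t = v t" if "t \<in> {\<delta>..R}" for t
      using abs_le_norm_C[OF cont(1)[OF d] that] by simp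
    then show "u = v"
      using C1(2) uv by (intro extensionalityI)
  qed
  show "E_dist \<delta> R u w \<le> E_dist \<delta> R u v + E_dist \<delta> R v w"
    if uvw: "u \<in> E_space \<delta> R" "v \<in> E_space \<delta> R" "w \<in> E_space \<delta> R" for u v w
  proof -
    have d: "C1_on \<delta> R (\<lambda>t. u t - v t)" "C1_on \<delta> R (\<lambda>t. v t - w t)"
      using C1 uvw by (auto intro!: C1_on_diff assms)
    have "norm_C \<delta> R (\<lambda>t. u t - w t) \<le> norm_C \<delta> R (\<lambda>t. u t - v t) + norm_C \<delta> R (\<lambda>t. v t - w t)"
      using d by (intro norm_C_triangle assms cont) auto
    moreover have "norm_C \<delta> R (deriv_on \<delta> R (\<lambda>t. u t - w t))
        \<le> norm_C \<delta> R (deriv_on \<delta> R (\<lambda>t. u t - v t)) + norm_C \<delta> R (deriv_on \<delta> R (\<lambda>t. v t - w t))"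
      using d C1 uvw by (intro norm_C_triangle assms cont) (auto simp: deriv_on_diff[OF assms])
    ultimately show ?thesis using uvw by (simp add: E_dist_def norm_C1_def)
  qed
qed

end

theory Submission
  imports Defs "HOL-Complex_Analysis.Great_Picard"
begin

text \<open>
  Integrating the equation twice turns the problem into
  \<open>u(r) = u(\<delta>) - \<integral>\<^sub>\<delta>\<^sup>r \<psi>(\<lambda> s\<^sup>1\<^sup>-\<^sup>N \<integral>\<^sub>\<delta>\<^sup>s t\<^sup>N\<^sup>-\<^sup>1 f(t, u(t)) dt) ds\<close> with \<open>u(R) = 0\<close>, where
  \<open>\<psi>(y) = y / \<surd>(1 + y\<^sup>2)\<close> is the inverse of \<open>\<phi>\<^sub>1\<close>.  Since \<open>0 \<le> \<psi> < 1\<close> on the nonnegative reals, a nontrivial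
  solution decreases with slope less than 1, and its norm is the value
  \<open>u(\<delta>)\<close>, which lies in \<open>(0, R - \<delta>)\<close>.

  Three bounds govern where solutions can escape.  If \<open>u(\<delta>)\<close> stays in a compact part of
  \<open>(0, R - \<delta>)\<close>, then \<open>\<lambda>\<close> is bounded: a large \<open>\<lambda>\<close> makes the slope almost 1 on almost all of the
  interval, and the solution drops by more than \<open>u(\<delta>)\<close> (\<open>fall_large\<close>).  If \<open>u(\<delta>)\<close> tends to 0,
  then \<open>\<lambda>\<close> tends to infinity because \<open>f(r, s) = o(s)\<close> at 0 (\<open>branch_small_norm\<close>).  And for bounded
  \<open>\<lambda>\<close> the solutions form a compact set (\<open>compact_branch_bounded\<close>), so \<open>u(\<delta>)\<close> can approach
  \<open>R - \<delta>\<close> only if \<open>\<lambda>\<close> tends to infinity as well.  Hence nontrivial solutions have no trivial limits,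
  \<open>\<Sigma>\<^sub>\<delta>\<close> is just the set of nontrivial solutions, and in the coordinates \<open>(1 / (1 + \<lambda>), u)\<close> this set
  becomes compact after adding the two points \<open>p = (0, 0)\<close> and \<open>q = (0, R - r)\<close>
  (\<open>compact_compactified\<close>).

  The points \<open>p\<close> and \<open>q\<close> lie in one component of this compact set.  Otherwise it splits into disjoint closed
  sets \<open>A\<close> around \<open>p\<close> and \<open>B\<close> around \<open>q\<close>.  One shoots from \<open>u(\<delta>) = d\<close> with parameter \<open>\<lambda>\<close>.  As \<open>f\<close> is merely
  continuous, the initial value problem may have many solutions; replacing \<open>f(t, u(t))\<close> by the delayed
  \<open>f(t, u(t - \<epsilon>))\<close> (Tonelli) restores uniqueness and continuous dependence on \<open>(d, \<lambda>)\<close>.  On a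
  rectangle of parameters, the Poincare-Miranda theorem is applied to \<open>u(R)\<close> and to the distance from \<open>B\<close> minus
  the distance from \<open>A\<close>; letting the delay tend to 0 gives a solution of large norm in \<open>A\<close> or one of
  small norm in \<open>B\<close>, which is absurd (\<open>shooting_separation\<close>).

  A minimal continuum containing \<open>p\<close> and \<open>q\<close> stays connected when both points are removed
  (\<open>continuum_with_connected_interior\<close>), which gives a connected set of solutions with all norms in
  \<open>(0, R - \<delta>)\<close>.  The component \<open>\<zeta>\<close> of \<open>\<Sigma>\<^sub>\<delta>\<close> that contains it has all the required properties.
  Both ends of the norm interval force \<open>\<lambda>\<close> to infinity, the first bound
  shows that the norm cannot stay away from both 0 and \<open>R - \<delta>\<close> for large \<open>\<lambda>\<close>, and
  \<open>\<integral> (1 + u') = R - \<delta> - u(\<delta>)\<close> controls the set where \<open>u'\<close> is not near \<open>-1\<close>.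
\<close>

section \<open>Continua joining two points\<close>

text \<open>If the intersection split into two closed pieces, then by compactness some member of the
  chain would already be covered by disjoint neighbourhoods of the pieces.\<close>

lemma connected_Inter_chain:
  fixes \<F> :: "'a::metric_space set set"
  assumes chain: "subset.chain UNIV \<F>" and "\<F> \<noteq> {}"
    and cc: "\<And>C. C \<in> \<F> \<Longrightarrow> compact C \<and> connected C"
  shows "connected (\<Inter>\<F>)"
proof -
  have clo: "closed (\<Inter>\<F>)"
    using cc by (auto intro: compact_imp_closed)
  have False if AB: "closed A" "closed B" "A \<inter> B = {}" "A \<union> B = \<Inter>\<F>" "A \<noteq> {}" "B \<noteq> {}" for A B
  proof -
    obtain U V where UV: "open U" "open V" "A \<subseteq> U" "B \<subseteq> V" "U \<inter> V = {}"
      using t4_space[OF AB(1-3)] by metis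
    obtain K where K: "K \<in> \<F>"
      using \<open>\<F> \<noteq> {}\<close> by blast
    have "\<exists>J\<in>\<F>. J \<subseteq> U \<union> V"
    proof (rule ccontr)
      assume no: "\<not> ?thesis"
      have "K \<inter> \<Inter>(insert (- (U \<union> V)) \<F>) \<noteq> {}"
      proof (rule compact_imp_fip)
        show "compact K" using cc K by blast
        show "closed T" if "T \<in> insert (- (U \<union> V)) \<F>" for T
          using that cc UV by (auto intro: compact_imp_closed)
        fix \<G> assume \<G>: "finite \<G>" "\<G> \<subseteq> insert (- (U \<union> V)) \<F>"
        define \<H> where "\<H> = insert K (\<G> - {- (U \<union> V)})"
        have \<H>: "\<H> \<subseteq> \<F>" "finite \<H>" "\<H> \<noteq> {}"
          using \<G> K by (auto simp: \<H>_def)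
        then have "subset.chain UNIV \<H>"
          using chain by (meson subset.chain_def subset_eq)
        then have "\<Inter>\<H> \<in> \<H>"
          using \<H> by (intro Inter_in_chain)
        then have "\<not> \<Inter>\<H> \<subseteq> U \<union> V"
          using no \<H> by blast
        then show "K \<inter> \<Inter>\<G> \<noteq> {}"
          unfolding \<H>_def by auto
      qed
      then show False
        using AB(4) UV by auto
    qed
    then obtain J where J: "J \<in> \<F>" "J \<subseteq> U \<union> V" by blast
    have "U \<inter> J \<noteq> {}" "V \<inter> J \<noteq> {}"
      using AB J(1) UV by blast+
    then show False
      using connectedD[of J U V] cc[OF J(1)] UV J(2) by auto
  qed
  then show ?thesis
    using clo by (auto simp: connected_closed_set)
qed

lemma irreducible_continuum:
  fixes K :: "'a::metric_space set"
  assumes "compact K" "connected K" "p \<in> K" "q \<in> K"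
  obtains C where "C \<subseteq> K" "compact C" "connected C" "p \<in> C" "q \<in> C"
    "\<And>D. D \<subseteq> C \<Longrightarrow> closed D \<Longrightarrow> connected D \<Longrightarrow> p \<in> D \<Longrightarrow> q \<in> D \<Longrightarrow> D = C"
proof -
  \<comment> \<open>Zorn's lemma yields maximal elements, hence the passage to complements.\<close>
  define \<A> where "\<A> = uminus ` {C. C \<subseteq> K \<and> compact C \<and> connected C \<and> p \<in> C \<and> q \<in> C}"
  have "\<exists>M\<in>\<A>. \<forall>X\<in>\<A>. M \<subseteq> X \<longrightarrow> X = M"
  proof (rule subset_Zorn_nonempty)
    show "\<A> \<noteq> {}" using assms by (auto simp: \<A>_def)
    fix \<C> assume \<C>: "\<C> \<noteq> {}" "subset.chain \<A> \<C>"
    define \<F> where "\<F> = uminus ` \<C>"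
    have \<F>: "C \<subseteq> K \<and> compact C \<and> connected C \<and> p \<in> C \<and> q \<in> C" if "C \<in> \<F>" for C
      using \<C>(2) that by (auto simp: \<F>_def \<A>_def subset.chain_def)
    have "connected (\<Inter>\<F>)"
    proof (rule connected_Inter_chain)
      show "subset.chain UNIV \<F>"
        using \<C>(2) unfolding \<F>_def subset.chain_def by blast
    qed (use \<C>(1) \<F> in \<open>auto simp: \<F>_def\<close>)
    moreover have "compact (\<Inter>\<F>)"
    proof -
      obtain C where C: "C \<in> \<F>" using \<C>(1) by (auto simp: \<F>_def)
      have "closed (\<Inter>\<F>)" using \<F> by (auto intro: compact_imp_closed)
      then show ?thesis
        using C \<F> by (metis Inf_lower compact_Int_closed inf.absorb2)
    qed
    ultimately have "- \<Inter>\<F> \<in> \<A>"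
      using \<F> \<C>(1) unfolding \<A>_def by (intro imageI) (auto simp: \<F>_def)
    moreover have "- \<Inter>\<F> = \<Union>\<C>"
      by (auto simp: \<F>_def)
    ultimately show "\<Union>\<C> \<in> \<A>" by simp
  qed
  then obtain C where C: "C \<subseteq> K" "compact C" "connected C" "p \<in> C" "q \<in> C"
    and max: "\<forall>X\<in>\<A>. - C \<subseteq> X \<longrightarrow> X = - C"
    by (auto simp: \<A>_def)
  show ?thesis
  proof (rule that[OF C])
    fix D assume D: "D \<subseteq> C" "closed D" "connected D" "p \<in> D" "q \<in> D"
    then have "compact D"
      using C(2) by (metis closed_Int_compact inf.absorb1)
    then have "- D \<in> \<A>"
      using D C(1) unfolding \<A>_def by blast
    then show "D = C" using max D(1) by auto
  qed
qed

text \<open>A clopen part of the complement of \<open>p\<close> becomes a continuum when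
  \<open>p\<close> is added; by irreducibility the part that contains \<open>q\<close> is
  everything.\<close>

lemma connected_irreducible_continuum_minus_endpoint:
  fixes C :: "'a::metric_space set"
  assumes "closed C" "connected C" "p \<in> C" "q \<in> C" "p \<noteq> q"
    and irr: "\<And>D. D \<subseteq> C \<Longrightarrow> closed D \<Longrightarrow> connected D \<Longrightarrow> p \<in> D \<Longrightarrow> q \<in> D \<Longrightarrow> D = C"
  shows "connected (C - {p})"
proof -
  have *: "T = C - {p}"
    if T: "openin (top_of_set (C - {p})) T" "closedin (top_of_set (C - {p})) T" "q \<in> T" for T
  proof -
    obtain L where L: "closed L" "T = (C - {p}) \<inter> L"
      using T(2) by (auto simp: closedin_closed)
    have eq: "{p} \<union> T = {p} \<union> (C \<inter> L)"
      using L by auto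
    have "{p} \<union> T = C"
    proof (rule irr)
      show "connected ({p} \<union> T)"
        using assms T by (intro connected_Un_clopen_in_complement[of "{p}" C]) auto
      show "closed ({p} \<union> T)"
        unfolding eq using L assms(1) by (intro closed_Un closed_Int) auto
    qed (use L assms T in auto)
    then show ?thesis using L by auto
  qed
  show ?thesis
    unfolding connected_clopen
  proof (intro allI impI)
    fix T assume T: "openin (top_of_set (C - {p})) T \<and> closedin (top_of_set (C - {p})) T"
    have sub: "T \<subseteq> C - {p}"
      using T openin_imp_subset by blast
    have T': "openin (top_of_set (C - {p})) (C - {p} - T)" "closedin (top_of_set (C - {p})) (C - {p} - T)"
      using T by (auto intro: openin_diff closedin_diff)
    show "T = {} \<or> T = C - {p}"
    proof (cases "q \<in> T")
      case True
      then show ?thesis using * T by blast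
    next
      case False
      then have "C - {p} - T = C - {p}"
        using * T' assms by blast
      then show ?thesis using sub by blast
    qed
  qed
qed

text \<open>In an irreducible continuum from \<open>p\<close> to \<open>q\<close>, a nonempty clopen
  part \<open>T\<close> of the complement of \<open>{p, q}\<close> can be joined to
  \<open>p\<close> inside the connected complement of \<open>q\<close>, and to
  \<open>q\<close> inside that of \<open>p\<close>. So \<open>T \<union> {p, q}\<close> is a
  continuum from \<open>p\<close> to \<open>q\<close>, and by irreducibility it is the whole
  one.\<close>

lemma continuum_with_connected_interior:
  fixes K :: "'a::metric_space set"
  assumes "compact K" "connected K" "p \<in> K" "q \<in> K" "p \<noteq> q"
  obtains C where "C \<subseteq> K" "connected C" "p \<in> C" "q \<in> C" "connected (C - {p, q})"
proof -
  obtain C where C: "C \<subseteq> K" "compact C" "connected C" "p \<in> C" "q \<in> C"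
    and irr: "\<And>D. D \<subseteq> C \<Longrightarrow> closed D \<Longrightarrow> connected D \<Longrightarrow> p \<in> D \<Longrightarrow> q \<in> D \<Longrightarrow> D = C"
    using irreducible_continuum[OF assms(1-4)] by metis
  have clo: "closed C" using C compact_imp_closed by blast
  have p: "connected (C - {p})" and q: "connected (C - {q})"
    using connected_irreducible_continuum_minus_endpoint[of C p q]
      connected_irreducible_continuum_minus_endpoint[of C q p] clo C irr assms(5) by auto
  have "connected (C - {p, q})"
    unfolding connected_clopen
  proof (intro allI impI)
    fix T assume T: "openin (top_of_set (C - {p, q})) T \<and> closedin (top_of_set (C - {p, q})) T"
    have e: "C - {q} - {p} = C - {p, q}" "C - {p} - {q} = C - {p, q}"
      by auto
    obtain L where L: "closed L" "T = (C - {p, q}) \<inter> L"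
      using T by (auto simp: closedin_closed)
    have eq: "{p, q} \<union> T = {p, q} \<union> (C \<inter> L)"
      using L by auto
    show "T = {} \<or> T = C - {p, q}"
    proof (cases "T = {}")
      case False
      have cp: "connected ({p} \<union> T)"
        using T C assms e q by (intro connected_Un_clopen_in_complement[of "{p}" "C - {q}"]) auto
      have cq: "connected ({q} \<union> T)"
        using T C assms e p by (intro connected_Un_clopen_in_complement[of "{q}" "C - {p}"]) auto
      have "connected (({p} \<union> T) \<union> ({q} \<union> T))"
        using False by (intro connected_Un[OF cp cq]) blast
      moreover have "({p} \<union> T) \<union> ({q} \<union> T) = {p, q} \<union> T" by auto
      ultimately have "connected ({p, q} \<union> T)" by simp
      moreover have "closed ({p, q} \<union> T)"
        unfolding eq using L clo by (intro closed_Un closed_Int) auto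
      ultimately have "{p, q} \<union> T = C"
        using L C by (intro irr) auto
      then show ?thesis using L by auto
    qed simp
  qed
  then show ?thesis using that C by blast
qed

text \<open>Components and quasi-components coincide in a compact Hausdorff space.\<close>

lemma compact_connected_or_separated:
  fixes K :: "'a::metric_space set"
  assumes "compact K" "p \<in> K" "q \<in> K"
  obtains (joined) D where "D \<subseteq> K" "compact D" "connected D" "p \<in> D" "q \<in> D"
  | (separated) A B where "closed A" "closed B" "A \<inter> B = {}" "A \<union> B = K" "p \<in> A" "q \<in> B"
proof (cases "quasi_component_of (top_of_set K) p q")
  case True
  have "quasi_components_of (top_of_set K) = connected_components_of (top_of_set K)"
    using assms(1) by (intro quasi_eq_connected_components_of disjI2 conjI disjI1)
      (auto simp: compact_space_subtopology intro!: Hausdorff_space_subtopology)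
  then have "connected_component_of (top_of_set K) p q"
    using True by (simp add: quasi_eq_connected_components_of_pointwise_alt)
  then have q: "q \<in> connected_component_set K p"
    by (simp add: connected_component_of_def connectedin_subtopology connected_component_def)
  moreover have "compact (connected_component_set K p)"
    using assms(1) by (metis closed_connected_component compact_Int_closed compact_imp_closed connected_component_subset inf.absorb2)
  ultimately show ?thesis
    using joined[of "connected_component_set K p"] assms connected_component_subset by auto
next
  case False
  then obtain T where T: "p \<in> T" "q \<notin> T" "closedin (top_of_set K) T" "openin (top_of_set K) T"
    using assms by (auto simp: quasi_component_of)
  have "closedin (top_of_set K) (K - T)"
    using T(4) by (simp add: openin_closedin_eq)
  then have "closed (K - T)" "closed T"
    using T(3) assms(1) compact_imp_closed closedin_closed_trans by blast+
  then show ?thesis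
    using separated[of T "K - T"] T assms closedin_imp_subset[OF T(3)] by auto
qed

text \<open>The Poincare-Miranda theorem without sign conditions: a coordinate function can fail to
  vanish only if it pushes out of the rectangle. This is Brouwer's theorem for the
  displacement by \<open>(h, g)\<close> followed by clipping to the rectangle.\<close>

lemma Poincare_Miranda_alternative:
  fixes h g :: "real \<times> real \<Rightarrow> real"
  assumes "a \<le> b" "c \<le> d"
    and "continuous_on ({a..b} \<times> {c..d}) h" "continuous_on ({a..b} \<times> {c..d}) g"
  obtains x y where "x \<in> {a..b}" "y \<in> {c..d}"
    "h (x, y) = 0 \<or> h (x, y) < 0 \<and> x = a \<or> h (x, y) > 0 \<and> x = b"
    "g (x, y) = 0 \<or> g (x, y) < 0 \<and> y = c \<or> g (x, y) > 0 \<and> y = d"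
proof -
  define S where "S = {a..b} \<times> {c..d}"
  define G where "G = (\<lambda>z. (max a (min b (fst z + h z)), max c (min d (snd z + g z))))"
  have "continuous_on S G"
    unfolding G_def S_def using assms by (intro continuous_intros) auto
  moreover have "G \<in> S \<rightarrow> S"
    using assms unfolding G_def S_def by auto
  moreover have "compact S" "convex S" "S \<noteq> {}"
    using assms(1,2) by (auto simp: S_def intro!: compact_Times convex_Times)
  ultimately obtain z where z: "z \<in> S" "G z = z"
    using brouwer by metis
  show ?thesis
  proof (rule that[of "fst z" "snd z"])
    have *: "max a (min b (fst z + h z)) = fst z" "max c (min d (snd z + g z)) = snd z"
      using z(2) unfolding G_def by (metis fst_conv, metis snd_conv)
    show "fst z \<in> {a..b}" "snd z \<in> {c..d}"
      using z(1) by (auto simp: S_def)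
    then show "h (fst z, snd z) = 0 \<or> h (fst z, snd z) < 0 \<and> fst z = a \<or> h (fst z, snd z) > 0 \<and> fst z = b"
      "g (fst z, snd z) = 0 \<or> g (fst z, snd z) < 0 \<and> snd z = c \<or> g (fst z, snd z) > 0 \<and> snd z = d"
      using * by (auto simp: max_def min_def split: if_splits)
  qed
qed

section \<open>The inverse of phi1 and the radial integral operator\<close>

definition psi :: "real \<Rightarrow> real" where
  "psi y = y / sqrt (1 + y\<^sup>2)"

text \<open>In this form monotonicity and the bound 1 for the derivative are immediate.\<close>

lemma psi_eq_sin_arctan: "psi y = sin (arctan y)"
  by (simp add: psi_def sin_arctan)

lemma psi_0 [simp]: "psi 0 = 0"
  by (simp add: psi_def)

lemma psi_strict_mono: "x < y \<Longrightarrow> psi x < psi y"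
  unfolding psi_eq_sin_arctan using arctan_lbound[of x] arctan_ubound[of y]
  by (intro sin_monotone_2pi arctan_monotone) (auto simp: less_imp_le)

lemma psi_mono: "x \<le> y \<Longrightarrow> psi x \<le> psi y"
  using psi_strict_mono by (metis less_eq_real_def)

lemma psi_nonneg: "0 \<le> y \<Longrightarrow> 0 \<le> psi y"
  by (simp add: psi_def)

lemma abs_psi_less_1: "\<bar>psi y\<bar> < 1"
proof -
  have "\<bar>y\<bar> < sqrt (1 + y\<^sup>2)"
    by (metis less_add_one add.commute real_sqrt_abs real_sqrt_less_iff)
  moreover have "0 < 1 + y\<^sup>2"
    by (metis add_pos_nonneg zero_less_one zero_le_power2)
  ultimately show ?thesis
    by (simp add: psi_def)
qed

lemma psi_lipschitz: "\<bar>psi x - psi y\<bar> \<le> \<bar>x - y\<bar>"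
proof -
  have "norm (psi x - psi y) \<le> 1 * norm (x - y)"
  proof (rule field_differentiable_bound[of UNIV])
    show "(psi has_field_derivative cos (arctan z) * inverse (1 + z\<^sup>2)) (at z within UNIV)" for z
      unfolding psi_eq_sin_arctan[abs_def] by (auto intro!: derivative_eq_intros)
    show "norm (cos (arctan z) * inverse (1 + z\<^sup>2)) \<le> 1" for z
    proof -
      have "\<bar>cos (arctan z)\<bar> * inverse (1 + z\<^sup>2) \<le> 1 * 1"
        by (intro mult_mono) (auto simp: field_simps add_pos_nonneg)
      then show ?thesis
        by (simp add: abs_mult add_nonneg_nonneg)
    qed
  qed auto
  then show ?thesis by simp
qed

lemma psi_le_self: "0 \<le> y \<Longrightarrow> psi y \<le> y"
  using psi_lipschitz[of y 0] by simp

lemma continuous_on_psi [continuous_intros]: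
  fixes g :: "real \<Rightarrow> real"
  shows "continuous_on A g \<Longrightarrow> continuous_on A (\<lambda>x. psi (g x))"
  unfolding psi_eq_sin_arctan by (auto intro!: continuous_on_sin continuous_on_arctan)

lemma psi_phi1: "\<bar>s\<bar> < 1 \<Longrightarrow> psi (phi1 s) = s"
proof -
  assume "\<bar>s\<bar> < 1"
  then have p: "0 < 1 - s\<^sup>2"
    by (simp add: abs_square_less_1)
  then have "1 + (phi1 s)\<^sup>2 = 1 / (1 - s\<^sup>2)"
    by (simp add: phi1_def field_simps)
  then have "sqrt (1 + (phi1 s)\<^sup>2) = 1 / sqrt (1 - s\<^sup>2)"
    by (simp add: real_sqrt_divide)
  then show ?thesis
    using p by (simp add: psi_def phi1_def)
qed

lemma phi1_psi: "phi1 (psi y) = y"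
proof -
  have p: "0 < 1 + y\<^sup>2"
    by (metis add_pos_nonneg zero_less_one zero_le_power2)
  then have "1 - (psi y)\<^sup>2 = 1 / (1 + y\<^sup>2)"
    by (simp add: psi_def field_simps)
  then have "sqrt (1 - (psi y)\<^sup>2) = 1 / sqrt (1 + y\<^sup>2)"
    by (simp add: real_sqrt_divide)
  then show ?thesis
    using p by (simp add: psi_def phi1_def)
qed

lemma phi1_minus: "phi1 (- s) = - phi1 s"
  by (simp add: phi1_def)

lemma uniform_limit_of_tendsto:
  "(l \<longlongrightarrow> c) F \<Longrightarrow> uniform_limit A (\<lambda>i x. l i) (\<lambda>x. c) F"
  by (rule uniform_limitI) (auto dest: tendstoD)

locale annulus =
  fixes N :: nat and \<delta> R :: real
  assumes two_le_N: "2 \<le> N" and delta_nonneg: "0 \<le> \<delta>" and delta_less_R: "\<delta> < R"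
begin

text \<open>The weighted integral \<open>s\<^sup>1\<^sup>-\<^sup>N \<integral>\<^sub>\<delta>\<^sup>s
  t\<^sup>N\<^sup>-\<^sup>1 g(t) dt\<close>. For \<open>\<delta> = s = 0\<close> the
  convention \<open>x / 0 = 0\<close> gives its limit 0, so the formula is right at the
  singular point as well.\<close>

definition avg :: "(real \<Rightarrow> real) \<Rightarrow> real \<Rightarrow> real" where
  "avg g s = integral {\<delta>..s} (\<lambda>t. t ^ (N - 1) * g t) / s ^ (N - 1)"

text \<open>If \<open>u\<close> solves the equation with parameter \<open>l\<close> and \<open>g(t) =
  f(t, u(t))\<close>, then \<open>slope l g\<close> is \<open>-u'\<close>, and \<open>fall l
  g r\<close> below is \<open>u(\<delta>) - u(r)\<close>.\<close>

definition slope :: "real \<Rightarrow> (real \<Rightarrow> real) \<Rightarrow> real \<Rightarrow> real" where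
  "slope l g s = psi (l * avg g s)"

definition fall :: "real \<Rightarrow> (real \<Rightarrow> real) \<Rightarrow> real \<Rightarrow> real" where
  "fall l g r = integral {\<delta>..r} (slope l g)"

lemma cont_weighted:
  "continuous_on {\<delta>..R} g \<Longrightarrow> A \<subseteq> {\<delta>..R} \<Longrightarrow> continuous_on A (\<lambda>t. t ^ (N - 1) * g t)"
  by (intro continuous_intros) (rule continuous_on_subset)

lemma avg_bound:
  assumes g: "continuous_on {\<delta>..R} g" and s: "s \<in> {\<delta>..R}" and M: "\<And>t. t \<in> {\<delta>..s} \<Longrightarrow> \<bar>g t\<bar> \<le> M"
  shows "\<bar>avg g s\<bar> \<le> M * (s - \<delta>)"
proof (cases "s = 0")
  case True
  then have "avg g s = 0" "s - \<delta> = 0" using s delta_nonneg two_le_N avg_def[of g s] by simp_all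
  then show ?thesis by simp
next
  case False
  then have s0: "0 < s" using s delta_nonneg by auto
  have "norm (integral {\<delta>..s} (\<lambda>t. t ^ (N - 1) * g t)) \<le> (s ^ (N - 1) * M) * (s - \<delta>)"
  proof (rule integral_bound)
    show "\<delta> \<le> s" using s by auto
    show "continuous_on {\<delta>..s} (\<lambda>t. t ^ (N - 1) * g t)"
      using g s by (intro cont_weighted) auto
    fix t assume t: "t \<in> {\<delta>..s}"
    have "\<bar>t\<bar> ^ (N - 1) * \<bar>g t\<bar> \<le> s ^ (N - 1) * M"
      using t delta_nonneg M[OF t] by (intro mult_mono power_mono) auto
    then show "norm (t ^ (N - 1) * g t) \<le> s ^ (N - 1) * M"
      by (simp add: abs_mult power_abs)
  qed
  then show ?thesis
    using s0 by (simp add: avg_def abs_mult field_simps)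
qed

lemma avg_diff:
  assumes "continuous_on {\<delta>..R} g" "continuous_on {\<delta>..R} h" "s \<in> {\<delta>..R}"
  shows "avg g s - avg h s = avg (\<lambda>t. g t - h t) s"
proof -
  have "integral {\<delta>..s} (\<lambda>t. t ^ (N - 1) * g t) - integral {\<delta>..s} (\<lambda>t. t ^ (N - 1) * h t)
      = integral {\<delta>..s} (\<lambda>t. t ^ (N - 1) * g t - t ^ (N - 1) * h t)"
    using assms by (intro integral_diff[symmetric] integrable_continuous_real cont_weighted) auto
  then show ?thesis
    by (simp add: avg_def diff_divide_distrib[symmetric] right_diff_distrib)
qed

lemma cont_bounded:
  fixes g :: "real \<Rightarrow> real"
  assumes "continuous_on {\<delta>..R} g"
  obtains M where "0 < M" "\<And>t. t \<in> {\<delta>..R} \<Longrightarrow> \<bar>g t\<bar> \<le> M"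
proof -
  have "compact (g ` {\<delta>..R})"
    using assms by (intro compact_continuous_image) auto
  then obtain M where "M > 0" "\<forall>x\<in>g ` {\<delta>..R}. norm x \<le> M"
    by (meson bounded_pos compact_imp_bounded)
  then show ?thesis using that[of M] by auto
qed

text \<open>Only the point 0 is delicate, where the quotient is singular; there the bound \<open>M (s -
  \<delta>)\<close> for the average forces the limit 0.\<close>

lemma cont_avg:
  assumes g: "continuous_on {\<delta>..R} g"
  shows "continuous_on {\<delta>..R} (avg g)"
  unfolding continuous_on_eq_continuous_within
proof
  fix s assume s: "s \<in> {\<delta>..R}"
  show "continuous (at s within {\<delta>..R}) (avg g)"
  proof (cases "s = 0")
    case False
    have "continuous_on {\<delta>..R} (\<lambda>s. integral {\<delta>..s} (\<lambda>t. t ^ (N - 1) * g t))"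
      using g by (intro indefinite_integral_continuous_1 integrable_continuous_real cont_weighted) auto
    then have "continuous (at s within {\<delta>..R}) (\<lambda>s. integral {\<delta>..s} (\<lambda>t. t ^ (N - 1) * g t))"
      using s by (simp add: continuous_on_eq_continuous_within)
    then show ?thesis
      unfolding avg_def[abs_def] using False by (intro continuous_intros) auto
  next
    case True
    obtain M where M: "\<And>t. t \<in> {\<delta>..R} \<Longrightarrow> \<bar>g t\<bar> \<le> M"
      using cont_bounded[OF g] by blast
    have "((\<lambda>t. avg g t) \<longlongrightarrow> 0) (at s within {\<delta>..R})"
    proof (rule Lim_null_comparison)
      show "\<forall>\<^sub>F t in at s within {\<delta>..R}. norm (avg g t) \<le> M * (t - \<delta>)"
        unfolding eventually_at_filter
        by (rule always_eventually) (auto intro!: avg_bound g M)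
      have "((\<lambda>t. M * (t - \<delta>)) \<longlongrightarrow> M * (s - \<delta>)) (at s within {\<delta>..R})"
        by (intro tendsto_intros)
      then show "((\<lambda>t. M * (t - \<delta>)) \<longlongrightarrow> 0) (at s within {\<delta>..R})"
        using s True delta_nonneg by auto
    qed
    moreover have "avg g s = 0"
      using True two_le_N avg_def[of g s] by simp
    ultimately show ?thesis
      by (simp add: continuous_within)
  qed
qed

lemma avg_nonneg:
  assumes "continuous_on {\<delta>..R} g" "s \<in> {\<delta>..R}" "\<And>t. t \<in> {\<delta>..R} \<Longrightarrow> 0 \<le> g t"
  shows "0 \<le> avg g s"
  unfolding avg_def using assms delta_nonneg
  by (intro divide_nonneg_nonneg integral_nonneg integrable_continuous_real cont_weighted) auto

text \<open>Only the part of the integral over \<open>[\<delta> + \<sigma>/2, \<delta> +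
  \<sigma>]\<close> is kept; there the weight is at least
  \<open>(\<sigma>/2)\<^sup>N\<^sup>-\<^sup>1\<close>, also if \<open>\<delta> = 0\<close>.\<close>

lemma avg_lower:
  assumes g: "continuous_on {\<delta>..R} g" "\<And>t. t \<in> {\<delta>..R} \<Longrightarrow> 0 \<le> g t"
    and m: "0 \<le> m" "\<And>t. t \<in> {\<delta>..\<delta> + \<sigma>} \<Longrightarrow> m \<le> g t" and \<sigma>: "0 < \<sigma>" and s: "s \<in> {\<delta> + \<sigma>..R}"
  shows "m * (\<sigma> / 2) ^ N / R ^ (N - 1) \<le> avg g s"
proof -
  have s0: "0 < s" using s \<sigma> delta_nonneg by auto
  have "(\<sigma> / 2) ^ (N - 1) * m * (\<sigma> / 2) = integral {\<delta> + \<sigma> / 2..\<delta> + \<sigma>} (\<lambda>t. (\<sigma> / 2) ^ (N - 1) * m)"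
    using \<sigma> by simp
  also have "\<dots> \<le> integral {\<delta> + \<sigma> / 2..\<delta> + \<sigma>} (\<lambda>t. t ^ (N - 1) * g t)"
  proof (rule integral_le)
    show "(\<lambda>t. t ^ (N - 1) * g t) integrable_on {\<delta> + \<sigma> / 2..\<delta> + \<sigma>}"
      using g s \<sigma> by (intro integrable_continuous_real cont_weighted) auto
    show "(\<sigma> / 2) ^ (N - 1) * m \<le> t ^ (N - 1) * g t" if "t \<in> {\<delta> + \<sigma> / 2..\<delta> + \<sigma>}" for t
      using that delta_nonneg \<sigma> m by (intro mult_mono power_mono) auto
  qed auto
  also have "\<dots> \<le> integral {\<delta>..s} (\<lambda>t. t ^ (N - 1) * g t)"
    using g s \<sigma> delta_nonneg by (intro integral_subset_le integrable_continuous_real cont_weighted) auto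
  finally have *: "(\<sigma> / 2) ^ (N - 1) * m * (\<sigma> / 2) \<le> integral {\<delta>..s} (\<lambda>t. t ^ (N - 1) * g t)" .
  have "(\<sigma> / 2) ^ (N - 1) * (\<sigma> / 2) = (\<sigma> / 2) ^ N"
    using two_le_N by (metis power_minus_mult pos2 less_le_trans)
  then have "m * (\<sigma> / 2) ^ N / R ^ (N - 1) = ((\<sigma> / 2) ^ (N - 1) * m * (\<sigma> / 2)) / R ^ (N - 1)"
    by (metis mult.commute mult.left_commute)
  also have "\<dots> \<le> integral {\<delta>..s} (\<lambda>t. t ^ (N - 1) * g t) / s ^ (N - 1)"
    using * s0 s m \<sigma> by (intro frac_le power_mono) (auto intro!: order_trans[OF _ *, simplified])
  finally show ?thesis by (simp add: avg_def)
qed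

lemma uniform_limit_avg:
  assumes ul: "uniform_limit {\<delta>..R} g h F"
    and g: "\<forall>\<^sub>F i in F. continuous_on {\<delta>..R} (g i)" and h: "continuous_on {\<delta>..R} h"
  shows "uniform_limit {\<delta>..R} (\<lambda>i. avg (g i)) (avg h) F"
proof (rule uniform_limitI)
  fix e :: real assume "0 < e"
  define e' where "e' = e / (2 * (R - \<delta>))"
  have e': "0 < e'" using \<open>0 < e\<close> delta_less_R by (simp add: e'_def)
  show "\<forall>\<^sub>F i in F. \<forall>s\<in>{\<delta>..R}. dist (avg (g i) s) (avg h s) < e"
    using uniform_limitD[OF ul e'] g
  proof eventually_elim
    case (elim i)
    show ?case
    proof
      fix s assume s: "s \<in> {\<delta>..R}"
      have "\<bar>avg (\<lambda>t. g i t - h t) s\<bar> \<le> e' * (s - \<delta>)"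
      proof (rule avg_bound[OF _ s])
        show "continuous_on {\<delta>..R} (\<lambda>t. g i t - h t)"
          using elim h by (intro continuous_intros) auto
        show "\<bar>g i t - h t\<bar> \<le> e'" if "t \<in> {\<delta>..s}" for t
          using elim(1) that s by (auto simp: dist_real_def intro!: less_imp_le)
      qed
      also have "\<dots> \<le> e' * (R - \<delta>)"
        using s e' by (intro mult_left_mono) auto
      also have "\<dots> < e"
        using \<open>0 < e\<close> delta_less_R by (simp add: e'_def field_simps)
      finally show "dist (avg (g i) s) (avg h s) < e"
        using elim h s by (simp add: dist_real_def avg_diff)
    qed
  qed
qed

lemma uniform_limit_slope:
  assumes l: "(l \<longlongrightarrow> c) F" and ul: "uniform_limit {\<delta>..R} g h F"
    and g: "\<forall>\<^sub>F i in F. continuous_on {\<delta>..R} (g i)" and h: "continuous_on {\<delta>..R} h"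
  shows "uniform_limit {\<delta>..R} (\<lambda>i. slope (l i) (g i)) (slope c h) F"
proof -
  have "uniform_limit {\<delta>..R} (\<lambda>i s. l i * avg (g i) s) (\<lambda>s. c * avg h s) F"
  proof (rule uniform_lim_mult)
    show "bounded (avg h ` {\<delta>..R})"
      using cont_avg[OF h] by (intro compact_imp_bounded compact_continuous_image) auto
  qed (use assms in \<open>auto intro: uniform_limit_avg uniform_limit_of_tendsto simp: image_constant_conv\<close>)
  then show ?thesis
    by (rule metric_uniform_limit_imp_uniform_limit)
      (auto simp: slope_def dist_real_def intro!: psi_lipschitz always_eventually)
qed

lemma cont_slope: "continuous_on {\<delta>..R} g \<Longrightarrow> continuous_on {\<delta>..R} (slope l g)"
  unfolding slope_def[abs_def] by (intro continuous_intros cont_avg)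

lemma slope_integrable:
  "continuous_on {\<delta>..R} g \<Longrightarrow> A = {a..b} \<Longrightarrow> {a..b} \<subseteq> {\<delta>..R} \<Longrightarrow> slope l g integrable_on A"
  using cont_slope[of g l] continuous_on_subset integrable_continuous_real by blast

lemma abs_slope_less_1: "\<bar>slope l g s\<bar> < 1"
  by (simp add: slope_def abs_psi_less_1)

lemma slope_nonneg:
  "0 \<le> l \<Longrightarrow> continuous_on {\<delta>..R} g \<Longrightarrow> (\<And>t. t \<in> {\<delta>..R} \<Longrightarrow> 0 \<le> g t) \<Longrightarrow> s \<in> {\<delta>..R} \<Longrightarrow> 0 \<le> slope l g s"
  unfolding slope_def by (intro psi_nonneg mult_nonneg_nonneg avg_nonneg)

lemma avg_cong:
  assumes "s \<in> {\<delta>..R}" "\<And>t. t \<in> {\<delta>..s} \<Longrightarrow> g t = h t"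
  shows "avg g s = avg h s"
proof -
  have "integral {\<delta>..s} (\<lambda>t. t ^ (N - 1) * g t) = integral {\<delta>..s} (\<lambda>t. t ^ (N - 1) * h t)"
    using assms by (intro Henstock_Kurzweil_Integration.integral_cong) auto
  then show ?thesis by (simp add: avg_def)
qed

lemma slope_cong:
  assumes "s \<in> {\<delta>..R}" "\<And>t. t \<in> {\<delta>..s} \<Longrightarrow> g t = h t"
  shows "slope l g s = slope l h s"
  unfolding slope_def using avg_cong[OF assms] by simp

lemma fall_cong:
  assumes "r \<in> {\<delta>..R}" "\<And>t. t \<in> {\<delta>..r} \<Longrightarrow> g t = h t"
  shows "fall l g r = fall l h r"
  unfolding fall_def using assms
  by (intro Henstock_Kurzweil_Integration.integral_cong slope_cong) auto

lemma power_times_avg: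
  assumes "s \<in> {\<delta>..R}"
  shows "s ^ (N - 1) * avg g s = integral {\<delta>..s} (\<lambda>t. t ^ (N - 1) * g t)"
proof (cases "s = 0")
  case True
  then have "integral {\<delta>..s} (\<lambda>t. t ^ (N - 1) * g t) = 0" "s ^ (N - 1) = 0"
    using assms delta_nonneg two_le_N by auto
  then show ?thesis by simp
qed (simp add: avg_def)

lemma fall_at_left [simp]: "fall l g \<delta> = 0"
  by (simp add: fall_def)

lemma slope_at_left [simp]: "slope l g \<delta> = 0"
  by (simp add: slope_def avg_def)

lemma fall_0 [simp]: "fall 0 g r = 0"
  by (simp add: fall_def slope_def[abs_def])

lemma fall_has_derivative:
  "continuous_on {\<delta>..R} g \<Longrightarrow> r \<in> {\<delta>..R} \<Longrightarrow>
    (fall l g has_vector_derivative slope l g r) (at r within {\<delta>..R})"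
  unfolding fall_def[abs_def] by (intro integral_has_vector_derivative cont_slope)

lemma fall_diff:
  assumes "continuous_on {\<delta>..R} g" "\<delta> \<le> r" "r \<le> s" "s \<le> R"
  shows "fall l g s - fall l g r = integral {r..s} (slope l g)"
  using Henstock_Kurzweil_Integration.integral_combine[of \<delta> r s "slope l g"] assms slope_integrable
  by (auto simp: fall_def)

lemma fall_mono:
  assumes "0 \<le> l" "continuous_on {\<delta>..R} g" "\<And>t. t \<in> {\<delta>..R} \<Longrightarrow> 0 \<le> g t" "\<delta> \<le> r" "r \<le> s" "s \<le> R"
  shows "fall l g r \<le> fall l g s"
proof -
  have "0 \<le> integral {r..s} (slope l g)"
    using assms by (intro integral_nonneg slope_integrable slope_nonneg) auto
  then show ?thesis using fall_diff[of g r s l] assms by simp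
qed

lemma fall_lipschitz:
  assumes "continuous_on {\<delta>..R} g" "r \<in> {\<delta>..R}" "s \<in> {\<delta>..R}"
  shows "\<bar>fall l g s - fall l g r\<bar> \<le> \<bar>s - r\<bar>"
proof -
  have *: "\<bar>fall l g s - fall l g r\<bar> \<le> s - r" if "\<delta> \<le> r" "r \<le> s" "s \<le> R" for r s
  proof -
    have "norm (integral {r..s} (slope l g)) \<le> 1 * (s - r)"
      using that by (intro integral_bound continuous_on_subset[OF cont_slope[OF assms(1)]])
        (auto intro!: less_imp_le abs_slope_less_1)
    then show ?thesis using fall_diff[OF assms(1) that, of l] by simp
  qed
  then show ?thesis
    using assms(2,3) *[of r s] *[of s r] by (cases "r \<le> s") (auto simp: abs_minus_commute)
qed

lemma fall_less:
  assumes "continuous_on {\<delta>..R} g"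
  shows "fall l g R < R - \<delta>"
proof -
  obtain x where x: "x \<in> {\<delta>..R}" "\<forall>y\<in>{\<delta>..R}. slope l g y \<le> slope l g x"
    using continuous_attains_sup[OF _ _ cont_slope[OF assms], of l] delta_less_R by auto
  have "integral {\<delta>..R} (slope l g) \<le> integral {\<delta>..R} (\<lambda>_. slope l g x)"
    using x(2) assms by (intro integral_le slope_integrable) auto
  also have "\<dots> = (R - \<delta>) * slope l g x"
    using delta_less_R by simp
  also have "\<dots> < (R - \<delta>) * 1"
    using delta_less_R abs_slope_less_1[of l g x] by (intro mult_strict_left_mono) auto
  finally show ?thesis by (simp add: fall_def)
qed

lemma cont_fall: "continuous_on {\<delta>..R} g \<Longrightarrow> continuous_on {\<delta>..R} (fall l g)"
  by (meson fall_has_derivative has_vector_derivative_continuous continuous_on_eq_continuous_within)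

lemma uniform_limit_fall:
  assumes l: "(l \<longlongrightarrow> c) F" and ul: "uniform_limit {\<delta>..R} g h F"
    and g: "\<forall>\<^sub>F i in F. continuous_on {\<delta>..R} (g i)" and h: "continuous_on {\<delta>..R} h"
  shows "uniform_limit {\<delta>..R} (\<lambda>i. fall (l i) (g i)) (fall c h) F"
proof (rule uniform_limitI)
  fix e :: real assume "0 < e"
  define e' where "e' = e / (2 * (R - \<delta>))"
  have e': "0 < e'" using \<open>0 < e\<close> delta_less_R by (simp add: e'_def)
  show "\<forall>\<^sub>F i in F. \<forall>r\<in>{\<delta>..R}. dist (fall (l i) (g i) r) (fall c h r) < e"
    using uniform_limitD[OF uniform_limit_slope[OF assms] e'] g
  proof eventually_elim
    case (elim i)
    show ?case
    proof
      fix r assume r: "r \<in> {\<delta>..R}"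
      have "fall (l i) (g i) r - fall c h r = integral {\<delta>..r} (\<lambda>s. slope (l i) (g i) s - slope c h s)"
        unfolding fall_def using elim h r by (intro integral_diff[symmetric] slope_integrable) auto
      moreover have "norm (integral {\<delta>..r} (\<lambda>s. slope (l i) (g i) s - slope c h s)) \<le> e' * (r - \<delta>)"
      proof (rule integral_bound)
        show "continuous_on {\<delta>..r} (\<lambda>s. slope (l i) (g i) s - slope c h s)"
          using r elim(2) h
          by (intro continuous_on_diff continuous_on_subset[OF cont_slope]) auto
        show "norm (slope (l i) (g i) s - slope c h s) \<le> e'" if "s \<in> {\<delta>..r}" for s
          using elim(1) that r by (auto simp: dist_real_def intro!: less_imp_le)
      qed (use r in auto)
      moreover have "e' * (r - \<delta>) \<le> e' * (R - \<delta>)"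
        using r e' by (intro mult_left_mono) auto
      moreover have "e' * (R - \<delta>) < e"
        using \<open>0 < e\<close> delta_less_R by (simp add: e'_def field_simps)
      ultimately show "dist (fall (l i) (g i) r) (fall c h r) < e"
        by (simp add: dist_real_def)
    qed
  qed
qed

text \<open>If the source \<open>g\<close> is at least \<open>m\<close> on a short initial interval,
  then for large \<open>l\<close> the argument of \<open>psi\<close> is large from
  \<open>\<delta> + \<sigma>\<close> on, and the slope is nearly 1 there; so the total fall
  comes close to \<open>R - \<delta>\<close>, uniformly in \<open>g\<close>.\<close>

lemma fall_large:
  assumes "0 < m" "0 < a" "0 \<le> b" "b < R - \<delta>"
  obtains L where "0 < L"
    "\<And>l g. L \<le> l \<Longrightarrow> continuous_on {\<delta>..R} g \<Longrightarrow> (\<And>t. t \<in> {\<delta>..R} \<Longrightarrow> 0 \<le> g t) \<Longrightarrow>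
       (\<And>t. t \<in> {\<delta>..R} \<Longrightarrow> t \<le> \<delta> + a \<Longrightarrow> m \<le> g t) \<Longrightarrow> b < fall l g R"
proof -
  \<comment> \<open>The slope \<open>c\<close>, halfway between \<open>b / T\<close> and 1, held over length \<open>T\<close>, gives a fall exceeding \<open>b\<close>.\<close>
  define \<sigma> where "\<sigma> = min a ((R - \<delta> - b) / 2)"
  define T where "T = R - \<delta> - \<sigma>"
  define \<kappa> where "\<kappa> = m * (\<sigma> / 2) ^ N / R ^ (N - 1)"
  define c where "c = (b / T + 1) / 2"
  define y where "y = phi1 c"
  have \<sigma>: "0 < \<sigma>" "\<sigma> \<le> a" "\<delta> + \<sigma> \<le> R" and T: "b < T" "0 < T"
    using assms by (auto simp: \<sigma>_def T_def min_def field_simps)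
  have \<kappa>: "0 < \<kappa>"
    using assms(1) \<sigma>(1) delta_less_R delta_nonneg by (auto simp: \<kappa>_def)
  have c: "b / T < c" "0 < c" "c < 1"
    using T assms by (auto simp: c_def field_simps add_pos_nonneg)
  have y: "0 < y" "psi y = c"
    using c psi_phi1[of c] by (auto simp: y_def phi1_def abs_square_less_1 power_less_one_iff)
  show ?thesis
  proof (rule that[of "y / \<kappa>"])
    show "0 < y / \<kappa>" using y \<kappa> by simp
    fix l g
    assume l: "y / \<kappa> \<le> l" and g: "continuous_on {\<delta>..R} g" "\<And>t. t \<in> {\<delta>..R} \<Longrightarrow> 0 \<le> g t"
      "\<And>t. t \<in> {\<delta>..R} \<Longrightarrow> t \<le> \<delta> + a \<Longrightarrow> m \<le> g t"
    have l0: "0 \<le> l" using l y \<kappa> by (meson divide_nonneg_nonneg less_imp_le order_trans)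
    have slope: "c \<le> slope l g s" if s: "s \<in> {\<delta> + \<sigma>..R}" for s
    proof -
      have "\<kappa> \<le> avg g s"
        unfolding \<kappa>_def using g s \<sigma> assms(1) by (intro avg_lower) auto
      then have "y \<le> l * avg g s"
        using l \<kappa> l0 by (smt (verit) mult_left_mono pos_divide_le_eq)
      then show ?thesis
        using y(2) psi_mono by (simp add: slope_def) metis
    qed
    have "b < c * T"
      using c(1) T by (simp add: pos_divide_less_eq)
    also have "c * T = integral {\<delta> + \<sigma>..R} (\<lambda>s. c)"
      using \<sigma> by (simp add: T_def)
    also have "\<dots> \<le> integral {\<delta> + \<sigma>..R} (slope l g)"
      using g \<sigma> slope by (intro integral_le slope_integrable) auto
    also have "\<dots> = fall l g R - fall l g (\<delta> + \<sigma>)"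
      using g \<sigma> by (intro fall_diff[symmetric]) auto
    also have "\<dots> \<le> fall l g R"
      using fall_mono[of l g \<delta> "\<delta> + \<sigma>"] l0 g \<sigma> by simp
    finally show "b < fall l g R" .
  qed
qed

end

section \<open>The boundary value problem as an integral equation\<close>

lemma psi_minus: "psi (- y) = - psi y"
  by (simp add: psi_def)

lemma clip_lipschitz:
  fixes a b x y :: real
  shows "a \<le> b \<Longrightarrow> \<bar>max a (min x b) - max a (min y b)\<bar> \<le> \<bar>x - y\<bar>"
  by (auto simp: max_def min_def)

lemma C1_onI:
  assumes "\<delta> < R" "\<And>t. t \<in> {\<delta>..R} \<Longrightarrow> (u has_vector_derivative d t) (at t within {\<delta>..R})"
    and "continuous_on {\<delta>..R} d"
  shows "C1_on \<delta> R u" "\<And>t. t \<in> {\<delta>..R} \<Longrightarrow> deriv_on \<delta> R u t = d t"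
proof -
  show *: "deriv_on \<delta> R u t = d t" if "t \<in> {\<delta>..R}" for t
    using assms that by (intro deriv_on_eqI) auto
  have "continuous_on {\<delta>..R} (deriv_on \<delta> R u)"
    by (rule continuous_on_eq[OF assms(3)]) (simp add: *)
  moreover have "u differentiable_on {\<delta>..R}"
    using assms(2) unfolding differentiable_on_def
    by (meson differentiableI_vector)
  ultimately show "C1_on \<delta> R u"
    by (simp add: C1_on_def)
qed

locale minkowski_bvp = annulus N \<delta> R for N :: nat and \<delta> R :: real +
  fixes \<alpha> :: real and f :: "real \<Rightarrow> real \<Rightarrow> real"
  assumes R_less_alpha: "R < \<alpha>"
    and f_cont: "continuous_on ({\<delta>..R} \<times> {0..<\<alpha>}) (\<lambda>(r, s). f r s)"
    and f_nonneg: "\<And>r s. r \<in> {\<delta>..R} \<Longrightarrow> s \<in> {0..<\<alpha>} \<Longrightarrow> 0 \<le> f r s"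
    and f_pos: "\<And>r s. r \<in> {\<delta>..R} \<Longrightarrow> s \<in> {0<..<\<alpha>} \<Longrightarrow> 0 < f r s"
    and f_little_o: "uniform_limit {\<delta>..R} (\<lambda>s r. f r s / s) (\<lambda>r. 0) (at_right 0)"
begin

definition nearest :: "real \<Rightarrow> real" where
  "nearest t = max \<delta> (min t R)"

text \<open>The function \<open>f\<close> extended to the plane by clipping both arguments. Solutions
  take values in \<open>[0, R - \<delta>]\<close> and do not notice the change, while the
  trajectories used for shooting may leave this range.\<close>

definition F :: "real \<Rightarrow> real \<Rightarrow> real" where
  "F t s = f (nearest t) (max 0 (min s (R - \<delta>)))"

lemma nearest_in [simp]: "nearest t \<in> {\<delta>..R}"
  using delta_less_R by (auto simp: nearest_def)

lemma nearest_bounds [simp]: "\<delta> \<le> nearest t" "nearest t \<le> R"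
  using nearest_in[of t] by auto

lemma nearest_id [simp]: "t \<in> {\<delta>..R} \<Longrightarrow> nearest t = t"
  by (auto simp: nearest_def)

lemma nearest_lipschitz: "\<bar>nearest s - nearest t\<bar> \<le> \<bar>s - t\<bar>"
  unfolding nearest_def using delta_less_R by (intro clip_lipschitz) auto

lemma cont_nearest [continuous_intros]: "continuous_on A nearest"
  unfolding nearest_def[abs_def] by (intro continuous_intros)

lemma F_nonneg: "0 \<le> F t s"
  unfolding F_def using R_less_alpha delta_nonneg delta_less_R by (intro f_nonneg) auto

lemma F_eq: "t \<in> {\<delta>..R} \<Longrightarrow> 0 \<le> s \<Longrightarrow> s \<le> R - \<delta> \<Longrightarrow> F t s = f t s"
  by (simp add: F_def)

lemma F_uniformly_continuous: "uniformly_continuous_on UNIV (\<lambda>z. F (fst z) (snd z))"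
proof -
  define q where "q = (\<lambda>z::real \<times> real. (nearest (fst z), max 0 (min (snd z) (R - \<delta>))))"
  have "continuous_on ({\<delta>..R} \<times> {0..R - \<delta>}) (\<lambda>(r, s). f r s)"
    using R_less_alpha delta_nonneg delta_less_R by (intro continuous_on_subset[OF f_cont]) auto
  then have uf: "uniformly_continuous_on ({\<delta>..R} \<times> {0..R - \<delta>}) (\<lambda>(r, s). f r s)"
    by (intro compact_uniformly_continuous compact_Times) auto
  have q: "q z \<in> {\<delta>..R} \<times> {0..R - \<delta>}" for z
    using delta_less_R by (auto simp: q_def)
  have qd: "dist (q z) (q w) \<le> dist z w" for z w
  proof -
    have "dist (fst (q z)) (fst (q w)) \<le> dist (fst z) (fst w)"
      by (simp add: q_def dist_real_def nearest_lipschitz)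
    moreover have "dist (snd (q z)) (snd (q w)) \<le> dist (snd z) (snd w)"
      using delta_less_R by (simp add: q_def dist_real_def clip_lipschitz)
    ultimately show ?thesis
      unfolding dist_prod_def by (intro real_sqrt_le_mono add_mono power_mono zero_le_dist)
  qed
  have eq: "F (fst z) (snd z) = (\<lambda>(r, s). f r s) (q z)" for z
    by (simp add: F_def q_def)
  show ?thesis
    unfolding uniformly_continuous_on_def
  proof (intro allI impI)
    fix e :: real assume "0 < e"
    then obtain d where "0 < d" and d: "\<And>x y. x \<in> {\<delta>..R} \<times> {0..R - \<delta>} \<Longrightarrow> y \<in> {\<delta>..R} \<times> {0..R - \<delta>} \<Longrightarrow>
        dist y x < d \<Longrightarrow> dist ((\<lambda>(r, s). f r s) y) ((\<lambda>(r, s). f r s) x) < e"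
      using uf unfolding uniformly_continuous_on_def by metis
    show "\<exists>d>0. \<forall>x\<in>UNIV. \<forall>y\<in>UNIV. dist y x < d \<longrightarrow> dist (F (fst y) (snd y)) (F (fst x) (snd x)) < e"
      unfolding eq using \<open>0 < d\<close> d q qd by (meson le_less_trans)
  qed
qed

lemma cont_F:
  assumes "continuous_on A v"
  shows "continuous_on A (\<lambda>t. F t (v t))"
proof -
  have "continuous_on UNIV (\<lambda>z. F (fst z) (snd z))"
    using F_uniformly_continuous by (rule uniformly_continuous_imp_continuous)
  then have "continuous_on A (\<lambda>t. (\<lambda>z. F (fst z) (snd z)) (t, v t))"
    by (rule continuous_on_compose2) (use assms in \<open>auto intro!: continuous_on_Pair\<close>)
  then show ?thesis by simp
qed

lemma uniform_limit_F:
  assumes "uniform_limit A V v G"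
  shows "uniform_limit A (\<lambda>i t. F t (V i t)) (\<lambda>t. F t (v t)) G"
proof -
  have "uniform_limit A (\<lambda>i t. (t, V i t)) (\<lambda>t. (t, v t)) G"
    by (rule metric_uniform_limit_imp_uniform_limit[OF assms]) (simp add: dist_prod_def)
  from uniform_limit_compose_uniformly_continuous_on[OF this F_uniformly_continuous]
  show ?thesis by simp
qed

lemma F_lower:
  assumes "0 < a" "a \<le> R - \<delta>"
  obtains m where "0 < m" "\<And>t s. t \<in> {\<delta>..R} \<Longrightarrow> a \<le> s \<Longrightarrow> m \<le> F t s"
proof -
  have "continuous_on ({\<delta>..R} \<times> {a..R - \<delta>}) (\<lambda>(r, s). f r s)"
    using R_less_alpha delta_nonneg delta_less_R assms by (intro continuous_on_subset[OF f_cont]) auto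
  then obtain z where z: "z \<in> {\<delta>..R} \<times> {a..R - \<delta>}"
    "\<forall>y\<in>{\<delta>..R} \<times> {a..R - \<delta>}. (\<lambda>(r, s). f r s) z \<le> (\<lambda>(r, s). f r s) y"
    using continuous_attains_inf[of "{\<delta>..R} \<times> {a..R - \<delta>}" "\<lambda>(r, s). f r s"] assms delta_less_R
    by (auto intro: compact_Times)
  show ?thesis
  proof (rule that[of "f (fst z) (snd z)"])
    show "0 < f (fst z) (snd z)"
      using z(1) assms R_less_alpha delta_nonneg by (intro f_pos) auto
    fix t s assume "t \<in> {\<delta>..R}" "a \<le> s"
    then show "f (fst z) (snd z) \<le> F t s"
      using z(2)[rule_format, of "(t, min s (R - \<delta>))"] assms by (auto simp: F_def case_prod_unfold)
  qed
qed

text \<open>The bound is in terms of an upper bound \<open>d\<close> of \<open>s\<close>, which covers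
  \<open>s = 0\<close>: there it follows from the continuity of \<open>f\<close>.\<close>

lemma F_little_o:
  assumes "0 < \<eta>"
  obtains s\<^sub>0 where "0 < s\<^sub>0"
    "\<And>t s d. t \<in> {\<delta>..R} \<Longrightarrow> 0 \<le> s \<Longrightarrow> s \<le> d \<Longrightarrow> 0 < d \<Longrightarrow> d < s\<^sub>0 \<Longrightarrow> F t s \<le> \<eta> * d"
proof -
  have "\<forall>\<^sub>F s in at_right 0. \<forall>r\<in>{\<delta>..R}. dist (f r s / s) 0 < \<eta>"
    using uniform_limitD[OF f_little_o assms] .
  then obtain b where b: "0 < b" "\<And>s r. 0 < s \<Longrightarrow> s < b \<Longrightarrow> r \<in> {\<delta>..R} \<Longrightarrow> \<bar>f r s / s\<bar> < \<eta>"
    by (auto simp: eventually_at_right_field dist_real_def)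
  define s\<^sub>0 where "s\<^sub>0 = min b (R - \<delta>)"
  have s0: "0 < s\<^sub>0" using b delta_less_R by (simp add: s\<^sub>0_def)
  have pos: "F t s \<le> \<eta> * d" if "t \<in> {\<delta>..R}" "0 < s" "s \<le> d" "d < s\<^sub>0" for t s d
  proof -
    have "\<bar>f t s / s\<bar> < \<eta>"
      by (rule b(2)) (use that in \<open>auto simp: s\<^sub>0_def\<close>)
    then have "f t s / s < \<eta>"
      by linarith
    then have "f t s \<le> \<eta> * s"
      using that by (simp add: pos_divide_less_eq)
    also have "\<dots> \<le> \<eta> * d" using that assms by simp
    finally show ?thesis using that by (simp add: F_eq s\<^sub>0_def)
  qed
  show ?thesis
  proof (rule that[OF s0])
    fix t s d assume *: "t \<in> {\<delta>..R}" "0 \<le> s" "s \<le> d" "0 < d" "d < s\<^sub>0"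
    show "F t s \<le> \<eta> * d"
    proof (cases "s = 0")
      case True
      have "continuous_on {0..R - \<delta>} (F t)"
        using continuous_on_compose2[OF uniformly_continuous_imp_continuous[OF F_uniformly_continuous],
            of "{0..R - \<delta>}" "\<lambda>s. (t, s)", OF continuous_on_Pair[OF continuous_on_const continuous_on_id]]
        by simp
      then have "(F t \<longlongrightarrow> F t 0) (at_right 0)"
        using delta_less_R by (simp add: continuous_on_Icc_at_rightD)
      moreover have "\<forall>\<^sub>F x in at_right 0. F t x \<le> \<eta> * d"
        using * pos by (auto simp: eventually_at_right_field intro!: exI[of _ d])
      ultimately show ?thesis
        using True by (intro tendsto_upperbound[of "F t" _ "at_right 0"]) auto
    qed (use * pos in auto)
  qed
qed


text \<open>The space \<open>C[\<delta>, R]\<close> is represented by the bounded continuous functions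
  on the line that are constant to the left of \<open>\<delta>\<close> and to the right of
  \<open>R\<close>. Uniform convergence is then convergence in a metric space, and a
  function of a delayed argument makes sense.\<close>

definition ext :: "(real \<Rightarrow> real) \<Rightarrow> real \<Rightarrow>\<^sub>C real" where
  "ext w = Bcontfun (\<lambda>t. w (nearest t))"

lemma ext_apply [simp]:
  assumes "continuous_on {\<delta>..R} w"
  shows "ext w t = w (nearest t)"
proof -
  have "continuous_on UNIV (\<lambda>t. w (nearest t))"
    by (rule continuous_on_compose2[OF assms cont_nearest]) auto
  moreover have "bounded (range (\<lambda>t. w (nearest t)))"
  proof (rule bounded_subset)
    show "bounded (w ` {\<delta>..R})"
      using assms by (intro compact_imp_bounded compact_continuous_image) auto
  qed auto
  ultimately have "(\<lambda>t. w (nearest t)) \<in> bcontfun"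
    by (simp add: bcontfun_def)
  then show ?thesis by (simp add: ext_def Bcontfun_inverse)
qed

lemma tendsto_ext:
  assumes "uniform_limit {\<delta>..R} w v G" "\<forall>\<^sub>F i in G. continuous_on {\<delta>..R} (w i)" "continuous_on {\<delta>..R} v"
  shows "((\<lambda>i. ext (w i)) \<longlongrightarrow> ext v) G"
proof (rule uniform_limit_tendsto_bcontfun, rule uniform_limitI)
  fix e :: real assume "0 < e"
  show "\<forall>\<^sub>F i in G. \<forall>t\<in>UNIV. dist (ext (w i) t) (ext v t) < e"
    using uniform_limitD[OF assms(1) \<open>0 < e\<close>] assms(2) by eventually_elim (use assms(3) in auto)
qed


text \<open>The nontrivial solutions, in the form of the integral equation.\<close>

definition branch :: "(real \<times> (real \<Rightarrow>\<^sub>C real)) set" where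
  "branch = {(l, v :: real \<Rightarrow>\<^sub>C real). 0 \<le> l \<and> (\<forall>t. v t = v \<delta> - fall l (\<lambda>s. F s (v s)) (nearest t)) \<and> v R = 0 \<and> 0 < v \<delta>}"

lemma branchD:
  fixes v :: "real \<Rightarrow>\<^sub>C real"
  assumes "(l, v) \<in> branch"
  shows "0 \<le> l" "\<And>t. v t = v \<delta> - fall l (\<lambda>s. F s (v s)) (nearest t)" "v R = 0" "0 < v \<delta>"
    "\<And>t. v (nearest t) = v t"
    "fall l (\<lambda>s. F s (v s)) R = v \<delta>" "v \<delta> < R - \<delta>"
proof -
  show *: "0 \<le> l" "\<And>t. v t = v \<delta> - fall l (\<lambda>s. F s (v s)) (nearest t)" "v R = 0" "0 < v \<delta>"
    using assms unfolding branch_def by blast+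
  show "v (nearest t) = v t" for t
    using *(2)[of t] *(2)[of "nearest t"] by simp
  show "fall l (\<lambda>s. F s (v s)) R = v \<delta>"
    using *(2)[of R] *(3) delta_less_R by simp
  then show "v \<delta> < R - \<delta>"
    using fall_less[of "\<lambda>s. F s (v s)" l] by (simp add: cont_F)
qed

lemma branch_antimono:
  fixes v :: "real \<Rightarrow>\<^sub>C real"
  assumes "(l, v) \<in> branch" "\<delta> \<le> r" "r \<le> s" "s \<le> R"
  shows "v s \<le> v r"
proof -
  have "fall l (\<lambda>s. F s (v s)) r \<le> fall l (\<lambda>s. F s (v s)) s"
    using branchD(1)[OF assms(1)] assms(2-) by (intro fall_mono cont_F F_nonneg) auto
  then show ?thesis
    using branchD(2)[OF assms(1), of r] branchD(2)[OF assms(1), of s] assms(2-) by simp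
qed

lemma branch_range:
  fixes v :: "real \<Rightarrow>\<^sub>C real"
  assumes "(l, v) \<in> branch"
  shows "0 \<le> v t" "v t \<le> v \<delta>"
  using branch_antimono[OF assms, of "nearest t" R] branch_antimono[OF assms, of \<delta> "nearest t"]
    branchD(3,5)[OF assms] by auto

lemma branch_lipschitz:
  fixes v :: "real \<Rightarrow>\<^sub>C real"
  assumes "(l, v) \<in> branch"
  shows "\<bar>v s - v t\<bar> \<le> \<bar>s - t\<bar>"
proof -
  have "\<bar>v s - v t\<bar> = \<bar>fall l (\<lambda>s. F s (v s)) (nearest s) - fall l (\<lambda>s. F s (v s)) (nearest t)\<bar>"
    using branchD(2)[OF assms, of s] branchD(2)[OF assms, of t] by linarith
  also have "\<dots> \<le> \<bar>nearest s - nearest t\<bar>"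
    by (intro fall_lipschitz cont_F) auto
  finally show ?thesis using nearest_lipschitz[of s t] by linarith
qed

lemma branch_F_eq:
  fixes v :: "real \<Rightarrow>\<^sub>C real"
  shows "(l, v) \<in> branch \<Longrightarrow> t \<in> {\<delta>..R} \<Longrightarrow> F t (v t) = f t (v t)"
  using branch_range[of l v t] branchD(7)[of l v] by (intro F_eq) auto

lemma norm_C_branch:
  fixes v :: "real \<Rightarrow>\<^sub>C real"
  assumes "(l, v) \<in> branch" "\<And>t. t \<in> {\<delta>..R} \<Longrightarrow> u t = v t"
  shows "norm_C \<delta> R u = v \<delta>"
proof (rule antisym)
  have c: "continuous_on {\<delta>..R} u"
    using assms(2) by (auto intro: continuous_on_eq[of _ v])
  show "norm_C \<delta> R u \<le> v \<delta>"
    unfolding norm_C_def using assms branch_range[OF assms(1)] delta_less_R by (intro cSUP_least) auto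
  show "v \<delta> \<le> norm_C \<delta> R u"
    using abs_le_norm_C[OF c, of \<delta>] assms delta_less_R by auto
qed

text \<open>Integrate \<open>(r\<^sup>N\<^sup>-\<^sup>1 \<phi>\<^sub>1(u'))' = - l
  r\<^sup>N\<^sup>-\<^sup>1 f(r, u)\<close>, solve for \<open>u'\<close>, and integrate
  again. The resulting monotonicity puts the values of \<open>u\<close> into \<open>[0, R -
  \<delta>]\<close>, where \<open>F\<close> agrees with \<open>f\<close>.\<close>

lemma solution_imp_branch:
  assumes "0 \<le> l" and sol: "solution N \<delta> R \<alpha> f l u" and nz: "\<exists>t\<in>{\<delta>..R}. u t \<noteq> 0"
  shows "(l, ext u) \<in> branch"
proof -
  define d where "d = deriv_on \<delta> R u"
  define g where "g = (\<lambda>t. f t (u t))"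
  define W where "W = (\<lambda>r. r ^ (N - 1) * phi1 (d r))"
  have u: "C1_on \<delta> R u" "\<And>r. r \<in> {\<delta>..R} \<Longrightarrow> u r \<in> {0..<\<alpha>}" "\<And>r. r \<in> {\<delta>..R} \<Longrightarrow> \<bar>d r\<bar> < 1"
    "C1_on \<delta> R W" "\<And>r. r \<in> {\<delta><..<R} \<Longrightarrow> deriv_on \<delta> R W r + l * r ^ (N - 1) * g r = 0"
    "d \<delta> = 0" "u R = 0"
    using sol unfolding solution_def W_def d_def g_def C1_space_def by blast+
  have cu: "continuous_on {\<delta>..R} u" and cW: "continuous_on {\<delta>..R} W"
    using u(1,4) by (auto simp: C1_on_def differentiable_imp_continuous_on)
  have "(\<lambda>t. (t, u t)) ` {\<delta>..R} \<subseteq> {\<delta>..R} \<times> {0..<\<alpha>}"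
    using u(2) by auto
  then have cg: "continuous_on {\<delta>..R} g"
    unfolding g_def
    using continuous_on_compose2[OF f_cont, of "{\<delta>..R}" "\<lambda>t. (t, u t)",
        OF continuous_on_Pair[OF continuous_on_id cu]] by simp
  have d: "d s = - slope l g s" if s: "s \<in> {\<delta>..R}" for s
  proof (cases "s = 0")
    case True
    then have "s = \<delta>" using s delta_nonneg by auto
    then show ?thesis using u(6) by simp
  next
    case False
    have "((\<lambda>r. - l * (r ^ (N - 1) * g r)) has_integral W s - W \<delta>) {\<delta>..s}"
    proof (rule fundamental_theorem_of_calculus_interior)
      show "continuous_on {\<delta>..s} W"
        using s by (intro continuous_on_subset[OF cW]) auto
      fix x assume x: "x \<in> {\<delta><..<s}"
      then have "deriv_on \<delta> R W x = - l * (x ^ (N - 1) * g x)"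
        using u(5)[of x] s by simp
      moreover have "(W has_vector_derivative deriv_on \<delta> R W x) (at x within {\<delta>..R})"
        using x s by (intro has_deriv_on u(4)) auto
      moreover have "at x within {\<delta>..R} = at x"
        using x s by (intro at_within_Icc_at) auto
      ultimately show "(W has_vector_derivative - l * (x ^ (N - 1) * g x)) (at x)"
        by simp
    qed (use s in auto)
    then have "W s - W \<delta> = - l * integral {\<delta>..s} (\<lambda>r. r ^ (N - 1) * g r)"
      by (metis integral_mult_right integral_unique)
    moreover have "W \<delta> = 0"
      by (simp add: W_def u(6) phi1_def)
    ultimately have "W s = s ^ (N - 1) * (- (l * avg g s))"
      using power_times_avg[OF s, of g] by simp
    then have "s ^ (N - 1) * phi1 (d s) = s ^ (N - 1) * (- (l * avg g s))"
      unfolding W_def .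
    then have "phi1 (d s) = - (l * avg g s)"
      using False by (simp only: mult_cancel_left power_eq_0_iff) simp
    then show ?thesis
      using psi_phi1[OF u(3)[OF s]] by (simp add: slope_def psi_minus)
  qed
  have uf: "u r = u \<delta> - fall l g r" if r: "r \<in> {\<delta>..R}" for r
  proof -
    have "(d has_integral u r - u \<delta>) {\<delta>..r}"
    proof (rule fundamental_theorem_of_calculus)
      fix x assume "x \<in> {\<delta>..r}"
      then show "(u has_vector_derivative d x) (at x within {\<delta>..r})"
        using has_deriv_on[OF u(1), of x] r unfolding d_def
        by (auto intro: has_vector_derivative_within_subset)
    qed (use r in auto)
    then have "u r - u \<delta> = integral {\<delta>..r} d"
      by (simp add: integral_unique)
    also have "\<dots> = integral {\<delta>..r} (\<lambda>s. - slope l g s)"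
      using d r by (intro Henstock_Kurzweil_Integration.integral_cong) auto
    finally show ?thesis by (simp add: fall_def)
  qed
  have gn: "0 \<le> g t" if "t \<in> {\<delta>..R}" for t
    unfolding g_def using that u(2) by (intro f_nonneg) auto
  have mono: "u s \<le> u r" if "\<delta> \<le> r" "r \<le> s" "s \<le> R" for r s
    using fall_mono[OF \<open>0 \<le> l\<close> cg gn that] uf[of r] uf[of s] that by simp
  have ur: "u t \<le> R - \<delta>" if "t \<in> {\<delta>..R}" for t
    using mono[of \<delta> t] that uf[of R] u(7) fall_less[OF cg, of l] delta_less_R by simp
  have gF: "F t (ext u t) = g t" if "t \<in> {\<delta>..R}" for t
    using that u(2) ur cu by (simp add: F_eq g_def)
  have eq: "ext u t = ext u \<delta> - fall l (\<lambda>s. F s (ext u s)) (nearest t)" for t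
  proof -
    have "fall l (\<lambda>s. F s (ext u s)) (nearest t) = fall l g (nearest t)"
      using nearest_bounds(2)[of t] by (intro fall_cong[OF nearest_in] gF) (auto elim: order_trans)
    then show ?thesis
      using uf[of "nearest t"] cu delta_less_R by simp
  qed
  have "0 < u \<delta>"
  proof -
    obtain t where t: "t \<in> {\<delta>..R}" "u t \<noteq> 0" using nz by blast
    then show ?thesis using u(2)[of t] mono[of \<delta> t] by auto
  qed
  then have "ext u R = 0" "0 < ext u \<delta>"
    using cu u(7) delta_less_R by simp_all
  then show ?thesis
    unfolding branch_def using eq \<open>0 \<le> l\<close> by blast
qed

lemma branch_has_derivative:
  fixes v :: "real \<Rightarrow>\<^sub>C real"
  assumes "(l, v) \<in> branch" and u: "\<And>t. t \<in> {\<delta>..R} \<Longrightarrow> u t = v t" and r: "r \<in> {\<delta>..R}"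
  shows "(u has_vector_derivative - slope l (\<lambda>s. F s (v s)) r) (at r within {\<delta>..R})"
proof (rule has_vector_derivative_transform[OF r])
  show "u t = v \<delta> - fall l (\<lambda>s. F s (v s)) t" if "t \<in> {\<delta>..R}" for t
    using branchD(2)[OF assms(1), of t] u that by simp
  show "((\<lambda>t. v \<delta> - fall l (\<lambda>s. F s (v s)) t) has_vector_derivative - slope l (\<lambda>s. F s (v s)) r) (at r within {\<delta>..R})"
    using has_vector_derivative_diff[OF has_vector_derivative_const fall_has_derivative[OF cont_F r]]
    by simp
qed

lemma branch_C1:
  fixes v :: "real \<Rightarrow>\<^sub>C real"
  assumes "(l, v) \<in> branch" and u: "\<And>t. t \<in> {\<delta>..R} \<Longrightarrow> u t = v t"
  shows "C1_on \<delta> R u" "\<And>r. r \<in> {\<delta>..R} \<Longrightarrow> deriv_on \<delta> R u r = - slope l (\<lambda>s. F s (v s)) r"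
  using C1_onI[OF delta_less_R branch_has_derivative[OF assms]]
  by (auto intro!: continuous_on_minus cont_slope cont_F)

lemma branch_imp_solution:
  fixes v :: "real \<Rightarrow>\<^sub>C real"
  assumes b: "(l, v) \<in> branch"
  shows "solution N \<delta> R \<alpha> f l (restrict v {\<delta>..R})"
proof -
  define u where "u = restrict v {\<delta>..R}"
  define g where "g = (\<lambda>s. F s (v s))"
  have u: "u t = v t" if "t \<in> {\<delta>..R}" for t
    using that by (simp add: u_def)
  have cg: "continuous_on {\<delta>..R} g"
    unfolding g_def by (intro cont_F) auto
  have C1: "C1_on \<delta> R u" "\<And>r. r \<in> {\<delta>..R} \<Longrightarrow> deriv_on \<delta> R u r = - slope l g r"
    using branch_C1[where u = u, OF b] u unfolding g_def by blast+
  define W where "W = (\<lambda>r. r ^ (N - 1) * phi1 (deriv_on \<delta> R u r))"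
  have W: "W r = - (l * integral {\<delta>..r} (\<lambda>t. t ^ (N - 1) * g t))" if "r \<in> {\<delta>..R}" for r
  proof -
    have "W r = r ^ (N - 1) * (- (l * avg g r))"
      using that C1(2) by (simp add: W_def slope_def phi1_minus phi1_psi)
    also have "\<dots> = - (l * (r ^ (N - 1) * avg g r))" by simp
    finally show ?thesis using power_times_avg[OF that] by simp
  qed
  have dW: "(W has_vector_derivative - (l * (r ^ (N - 1) * g r))) (at r within {\<delta>..R})"
    if r: "r \<in> {\<delta>..R}" for r
  proof (rule has_vector_derivative_transform[OF r W])
    show "((\<lambda>r. - (l * integral {\<delta>..r} (\<lambda>t. t ^ (N - 1) * g t))) has_vector_derivative
        - (l * (r ^ (N - 1) * g r))) (at r within {\<delta>..R})"
      using r cg by (intro has_vector_derivative_minus has_vector_derivative_mult_right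
          integral_has_vector_derivative cont_weighted) auto
  qed
  have W1: "C1_on \<delta> R W" "\<And>r. r \<in> {\<delta>..R} \<Longrightarrow> deriv_on \<delta> R W r = - (l * (r ^ (N - 1) * g r))"
    using C1_onI[OF delta_less_R dW continuous_on_minus[OF continuous_on_mult[OF continuous_on_const
          cont_weighted[OF cg order_refl]]]] by auto
  have "u \<in> C1_space \<delta> R"
    using C1(1) by (simp only: C1_space_def mem_Collect_eq u_def restrict_extensional simp_thms)
  moreover have "u r \<in> {0..<\<alpha>}" if "r \<in> {\<delta>..R}" for r
    using u[OF that] branch_range[OF b, of r] branchD(7)[OF b] R_less_alpha delta_nonneg by auto
  moreover have "\<bar>deriv_on \<delta> R u r\<bar> < 1" if "r \<in> {\<delta>..R}" for r
    using C1(2)[OF that] abs_slope_less_1 by simp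
  moreover have "deriv_on \<delta> R W r + l * r ^ (N - 1) * f r (u r) = 0" if "r \<in> {\<delta><..<R}" for r
    using W1(2)[of r] that branch_F_eq[OF b, of r] u by (simp add: g_def)
  moreover have "deriv_on \<delta> R u \<delta> = 0"
    using C1(2)[of \<delta>] delta_less_R by simp
  moreover have "u R = 0"
    using branchD(3)[OF b] u delta_less_R by simp
  ultimately have "solution N \<delta> R \<alpha> f l u"
    using W1(1) unfolding solution_def W_def by blast
  then show ?thesis by (simp add: u_def)
qed

section \<open>A priori bounds and compactness of the solution set\<close>

text \<open>Since \<open>u\<close> has Lipschitz constant 1, it stays above \<open>a / 2\<close> on an
  interval of length \<open>a / 2\<close>, and there the source is bounded below. A large
  \<open>l\<close> would make \<open>u\<close> fall by more than \<open>b\<close>.\<close>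

lemma branch_bounded_parameter:
  assumes "0 < a" "a \<le> b" "b < R - \<delta>"
  obtains L where "0 < L" "\<And>l v. (l, v) \<in> branch \<Longrightarrow> a \<le> apply_bcontfun v \<delta> \<Longrightarrow> apply_bcontfun v \<delta> \<le> b \<Longrightarrow> l < L"
proof -
  obtain m where m: "0 < m" "\<And>t s. t \<in> {\<delta>..R} \<Longrightarrow> a / 2 \<le> s \<Longrightarrow> m \<le> F t s"
    using F_lower[of "a / 2"] assms by auto
  obtain L where L: "0 < L"
    "\<And>l g. L \<le> l \<Longrightarrow> continuous_on {\<delta>..R} g \<Longrightarrow> (\<And>t. t \<in> {\<delta>..R} \<Longrightarrow> 0 \<le> g t) \<Longrightarrow>
       (\<And>t. t \<in> {\<delta>..R} \<Longrightarrow> t \<le> \<delta> + a / 2 \<Longrightarrow> m \<le> g t) \<Longrightarrow> b < fall l g R"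
    using fall_large[of m "a / 2" b] m assms by auto
  show ?thesis
  proof (rule that[OF L(1)], rule ccontr)
    fix l :: real and v :: "real \<Rightarrow>\<^sub>C real"
    assume v: "(l, v) \<in> branch" "a \<le> v \<delta>" "v \<delta> \<le> b" and l: "\<not> l < L"
    have "b < fall l (\<lambda>s. F s (v s)) R"
    proof (rule L(2))
      fix t assume "t \<in> {\<delta>..R}" "t \<le> \<delta> + a / 2"
      then show "m \<le> F t (v t)"
        using branch_lipschitz[OF v(1), of t \<delta>] v(2) by (intro m(2)) auto
    qed (use l in \<open>auto intro!: cont_F F_nonneg\<close>)
    then show False using branchD(6)[OF v(1)] v(3) by simp
  qed
qed

text \<open>A solution of norm \<open>d\<close> falls by \<open>d\<close>, while its fall is at most
  \<open>l (R - \<delta>)\<^sup>2\<close> times the maximum of the source, which is at most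
  \<open>\<eta> d\<close> with \<open>\<eta>\<close> as small as desired for small
  \<open>d\<close>.\<close>

lemma branch_small_norm:
  obtains s\<^sub>0 where "0 < s\<^sub>0" "\<And>l v. (l, v) \<in> branch \<Longrightarrow> apply_bcontfun v \<delta> < s\<^sub>0 \<Longrightarrow> K < l"
proof -
  define \<eta> where "\<eta> = 1 / ((\<bar>K\<bar> + 1) * (R - \<delta>)\<^sup>2)"
  have \<eta>: "0 < \<eta>" using delta_less_R by (auto simp: \<eta>_def intro!: divide_pos_pos mult_pos_pos)
  obtain s\<^sub>0 where s0: "0 < s\<^sub>0"
    "\<And>t s d. t \<in> {\<delta>..R} \<Longrightarrow> 0 \<le> s \<Longrightarrow> s \<le> d \<Longrightarrow> 0 < d \<Longrightarrow> d < s\<^sub>0 \<Longrightarrow> F t s \<le> \<eta> * d"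
    using F_little_o[OF \<eta>] by blast
  show ?thesis
  proof (rule that[OF s0(1)])
    fix l :: real and v :: "real \<Rightarrow>\<^sub>C real"
    assume v: "(l, v) \<in> branch" "v \<delta> < s\<^sub>0"
    note vD = branchD(1,4,6)[OF v(1)]
    define g where "g = (\<lambda>s. F s (v s))"
    have cg: "continuous_on {\<delta>..R} g" unfolding g_def by (intro cont_F) auto
    have "slope l g s \<le> l * (\<eta> * v \<delta> * (R - \<delta>))" if s: "s \<in> {\<delta>..R}" for s
    proof -
      have "\<bar>g t\<bar> \<le> \<eta> * v \<delta>" if "t \<in> {\<delta>..s}" for t
        using s0(2)[of t "v t" "v \<delta>"] branch_range[OF v(1), of t] vD v(2) that s F_nonneg[of t "v t"]
        by (simp add: g_def)
      then have "\<bar>avg g s\<bar> \<le> \<eta> * v \<delta> * (s - \<delta>)"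
        by (intro avg_bound cg s)
      also have "\<dots> \<le> \<eta> * v \<delta> * (R - \<delta>)"
        using s \<eta> vD by (intro mult_left_mono) auto
      finally have "l * avg g s \<le> l * (\<eta> * v \<delta> * (R - \<delta>))"
        using vD by (intro mult_left_mono) auto
      moreover have "0 \<le> l * avg g s"
        using vD cg s by (intro mult_nonneg_nonneg avg_nonneg) (auto simp: g_def F_nonneg)
      ultimately show ?thesis
        using psi_le_self unfolding slope_def by fastforce
    qed
    then have "integral {\<delta>..R} (slope l g) \<le> integral {\<delta>..R} (\<lambda>s. l * (\<eta> * v \<delta> * (R - \<delta>)))"
      using cg by (intro integral_le slope_integrable) auto
    then have "v \<delta> \<le> v \<delta> * (l * \<eta> * (R - \<delta>)\<^sup>2)"
      using vD(3) delta_less_R by (simp add: fall_def g_def power2_eq_square mult_ac)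
    then have "1 \<le> l * \<eta> * (R - \<delta>)\<^sup>2"
      using vD(2) by simp
    also have "\<dots> = l / (\<bar>K\<bar> + 1)"
      using delta_less_R by (simp add: \<eta>_def)
    finally show "K < l" by (simp add: pos_le_divide_eq)
  qed
qed

lemma uniform_limit_fall_F:
  fixes v :: "real \<Rightarrow>\<^sub>C real"
  assumes "(l \<longlongrightarrow> c) G" and "uniform_limit {\<delta>..R} w v G"
    and "\<forall>\<^sub>F i in G. continuous_on {\<delta>..R} (w i)"
  shows "uniform_limit {\<delta>..R} (\<lambda>i. fall (l i) (\<lambda>s. F s (w i s))) (fall c (\<lambda>s. F s (v s))) G"
    and "uniform_limit {\<delta>..R} (\<lambda>i. slope (l i) (\<lambda>s. F s (w i s))) (slope c (\<lambda>s. F s (v s))) G"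
  using assms(3)
  by (auto intro!: uniform_limit_fall uniform_limit_slope assms uniform_limit_F cont_F elim!: eventually_mono)

text \<open>The functions \<open>w\<close> inside the nonlinearity may differ from the \<open>u\<close>
  outside, so that the statement covers limits of solutions (\<open>w = u\<close>) as well
  as vanishing delays.\<close>

lemma integral_equation_limit:
  fixes v :: "real \<Rightarrow>\<^sub>C real"
  assumes "G \<noteq> bot" "(l \<longlongrightarrow> c) G" "uniform_limit {\<delta>..R} w v G"
    and "\<forall>\<^sub>F i in G. continuous_on {\<delta>..R} (w i)"
    and u: "(u \<longlongrightarrow> v) G" "\<And>i t. i \<in> I \<Longrightarrow> apply_bcontfun (u i) t = apply_bcontfun (u i) \<delta> - fall (l i) (\<lambda>s. F s (w i s)) (nearest t)"
    and I: "\<forall>\<^sub>F i in G. i \<in> I"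
  shows "v t = v \<delta> - fall c (\<lambda>s. F s (v s)) (nearest t)"
proof -
  have u_lim: "((\<lambda>i. apply_bcontfun (u i) x) \<longlongrightarrow> v x) G" for x
    using tendsto_bcontfun_uniform_limit[OF u(1)] by (rule tendsto_uniform_limitI) simp
  have "((\<lambda>i. apply_bcontfun (u i) \<delta> - fall (l i) (\<lambda>s. F s (w i s)) (nearest t)) \<longlongrightarrow> v \<delta> - fall c (\<lambda>s. F s (v s)) (nearest t)) G"
    by (intro tendsto_diff u_lim tendsto_uniform_limitI[OF uniform_limit_fall_F(1)[OF assms(2-4)]] nearest_in)
  moreover have "\<forall>\<^sub>F i in G. apply_bcontfun (u i) \<delta> - fall (l i) (\<lambda>s. F s (w i s)) (nearest t) = apply_bcontfun (u i) t"
    using I by eventually_elim (simp add: u(2)[of _ t])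
  ultimately have "((\<lambda>i. apply_bcontfun (u i) t) \<longlongrightarrow> v \<delta> - fall c (\<lambda>s. F s (v s)) (nearest t)) G"
    by (rule Lim_transform_eventually)
  then show ?thesis
    using tendsto_unique[OF assms(1) u_lim] by blast
qed

text \<open>A limit can fail to be a nontrivial solution only by being 0, which would force the
  parameters to infinity.\<close>

lemma branch_limit:
  fixes v :: "real \<Rightarrow>\<^sub>C real"
  assumes "G \<noteq> bot" "(l \<longlongrightarrow> c) G" "(u \<longlongrightarrow> v) G" "\<forall>\<^sub>F i in G. (l i, u i) \<in> branch"
  shows "(c, v) \<in> branch"
proof -
  have u_lim: "((\<lambda>i. apply_bcontfun (u i) x) \<longlongrightarrow> v x) G" for x
    using tendsto_bcontfun_uniform_limit[OF assms(3)] by (rule tendsto_uniform_limitI) simp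
  have "v t = v \<delta> - fall c (\<lambda>s. F s (v s)) (nearest t)" for t
  proof (rule integral_equation_limit[OF assms(1,2) _ _ assms(3), where I = "{i. (l i, u i) \<in> branch}"])
    show "uniform_limit {\<delta>..R} (\<lambda>i. apply_bcontfun (u i)) v G"
      using tendsto_bcontfun_uniform_limit[OF assms(3)] by (rule uniform_limit_on_subset) auto
    show "apply_bcontfun (u i) t = apply_bcontfun (u i) \<delta> - fall (l i) (\<lambda>s. F s (apply_bcontfun (u i) s)) (nearest t)"
      if "i \<in> {i. (l i, u i) \<in> branch}" for i t
      using that branchD(2)[of "l i" "u i" t] by simp
  qed (use assms(4) in auto)
  moreover have "0 \<le> c"
    using assms(4) by (intro tendsto_lowerbound[OF assms(2) _ assms(1)]) (auto elim!: eventually_mono dest: branchD(1))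
  moreover have "v R = 0"
  proof (rule tendsto_unique[OF assms(1) u_lim])
    show "((\<lambda>i. apply_bcontfun (u i) R) \<longlongrightarrow> 0) G"
      using assms(4) by (intro tendsto_eventually) (auto elim!: eventually_mono dest: branchD(3))
  qed
  moreover have "0 < v \<delta>"
  proof (rule ccontr)
    assume "\<not> 0 < v \<delta>"
    obtain s\<^sub>0 where s0: "0 < s\<^sub>0" "\<And>l v. (l, v) \<in> branch \<Longrightarrow> apply_bcontfun v \<delta> < s\<^sub>0 \<Longrightarrow> c + 1 < l"
      using branch_small_norm by blast
    have "\<forall>\<^sub>F i in G. apply_bcontfun (u i) \<delta> < s\<^sub>0"
      using order_tendstoD(2)[OF u_lim] \<open>\<not> 0 < v \<delta>\<close> s0(1) by simp
    moreover have "\<forall>\<^sub>F i in G. l i < c + 1"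
      using order_tendstoD(2)[OF assms(2)] by simp
    ultimately have "\<forall>\<^sub>F i in G. False"
      using assms(4) by eventually_elim (use s0(2) in fastforce)
    then show False using assms(1) by simp
  qed
  ultimately show ?thesis unfolding branch_def by blast
qed

text \<open>The theorem of Arzela and Ascoli, for functions determined by their values on
  \<open>[\<delta>, R]\<close>.\<close>

lemma lipschitz_subsequence:
  fixes u :: "nat \<Rightarrow> real \<Rightarrow>\<^sub>C real"
  assumes nearest: "\<And>n t. apply_bcontfun (u n) (nearest t) = apply_bcontfun (u n) t"
    and lip: "\<And>n s t. \<bar>apply_bcontfun (u n) s - apply_bcontfun (u n) t\<bar> \<le> \<bar>s - t\<bar>"
    and bd: "\<And>n t. \<bar>apply_bcontfun (u n) t\<bar> \<le> M"
  obtains r v where "strict_mono r" "(\<lambda>n. u (r n)) \<longlonglongrightarrow> v"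
proof -
  obtain g r where g: "continuous_on {\<delta>..R} g" "strict_mono (r :: nat \<Rightarrow> nat)"
    and lim: "\<And>e. 0 < e \<Longrightarrow> \<exists>N. \<forall>n x. n \<ge> N \<and> x \<in> {\<delta>..R} \<longrightarrow> norm (apply_bcontfun (u (r n)) x - g x) < e"
  proof (rule Arzela_Ascoli[of "{\<delta>..R}" "\<lambda>n. apply_bcontfun (u n)" M])
    show "\<exists>d>0. \<forall>n y. y \<in> {\<delta>..R} \<and> norm (x - y) < d \<longrightarrow> norm (apply_bcontfun (u n) x - apply_bcontfun (u n) y) < e"
      if "0 < e" for x e :: real
      using that lip by (intro exI[of _ e]) (auto intro: le_less_trans)
  qed (use bd in auto)
  have "uniform_limit {\<delta>..R} (\<lambda>n. apply_bcontfun (u (r n))) g sequentially"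
  proof (rule uniform_limitI)
    fix e :: real assume "0 < e"
    then show "\<forall>\<^sub>F n in sequentially. \<forall>x\<in>{\<delta>..R}. dist (apply_bcontfun (u (r n)) x) (g x) < e"
      using lim[of e] unfolding eventually_sequentially dist_norm by blast
  qed
  then have "(\<lambda>n. ext (apply_bcontfun (u (r n)))) \<longlonglongrightarrow> ext g"
    by (rule tendsto_ext) (use g in auto)
  moreover have "ext (apply_bcontfun (u n)) = u n" for n
    by (rule bcontfun_eqI) (simp add: nearest)
  ultimately show ?thesis using that g(2) by simp
qed

lemma closed_branch: "closed branch"
  unfolding closed_sequential_limits
proof (intro allI impI)
  fix x :: "nat \<Rightarrow> real \<times> (real \<Rightarrow>\<^sub>C real)" and y
  assume x: "(\<forall>n. x n \<in> branch) \<and> x \<longlonglongrightarrow> y"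
  have "(fst y, snd y) \<in> branch"
    using x by (intro branch_limit[of sequentially "\<lambda>n. fst (x n)" _ "\<lambda>n. snd (x n)"])
      (auto intro: tendsto_fst tendsto_snd)
  then show "y \<in> branch" by simp
qed

lemma compact_branch_bounded: "compact (branch \<inter> {..L} \<times> UNIV)"
  unfolding compact_eq_seq_compact_metric seq_compact_def
proof (intro allI impI)
  fix x :: "nat \<Rightarrow> real \<times> (real \<Rightarrow>\<^sub>C real)"
  assume "\<forall>n. x n \<in> branch \<inter> {..L} \<times> UNIV"
  then have x: "(fst (x n), snd (x n)) \<in> branch" "fst (x n) \<le> L" for n
    by (auto simp: mem_Times_iff)
  obtain r v where r: "strict_mono r" "(\<lambda>n. snd (x (r n))) \<longlonglongrightarrow> v"
  proof (rule lipschitz_subsequence[of "\<lambda>n. snd (x n)" "R - \<delta>"])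
    show "\<bar>apply_bcontfun (snd (x n)) t\<bar> \<le> R - \<delta>" for n t
      using branch_range[OF x(1), of n t] branchD(7)[OF x(1), of n] by auto
  qed (use branchD(5)[OF x(1)] branch_lipschitz[OF x(1)] in auto)
  have "\<forall>n. fst (x (r n)) \<in> {0..L}"
    using x(2) branchD(1)[OF x(1)] by auto
  then obtain c k where k: "strict_mono k" "((\<lambda>n. fst (x (r n))) \<circ> k) \<longlonglongrightarrow> c"
    using compact_Icc[of 0 L] unfolding compact_eq_seq_compact_metric seq_compact_def by metis
  have "(\<lambda>n. (fst (x (r (k n))), snd (x (r (k n))))) \<longlonglongrightarrow> (c, v)"
    using k(2) LIMSEQ_subseq_LIMSEQ[OF r(2) k(1)] by (intro tendsto_Pair) (auto simp: o_def)
  then have lim: "(x \<circ> (r \<circ> k)) \<longlonglongrightarrow> (c, v)"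
    by (simp add: o_def)
  have "closed (branch \<inter> {..L} \<times> (UNIV :: (real \<Rightarrow>\<^sub>C real) set))"
    by (intro closed_Int closed_branch closed_Times) auto
  then have "(c, v) \<in> branch \<inter> {..L} \<times> UNIV"
    by (rule closed_sequentially[OF _ _ lim]) (use x in \<open>auto simp: mem_Times_iff\<close>)
  then show "\<exists>l\<in>branch \<inter> {..L} \<times> UNIV. \<exists>r. strict_mono r \<and> (x \<circ> r) \<longlonglongrightarrow> l"
    using lim strict_mono_o[OF r(1) k(1)] by blast
qed


text \<open>The coordinate \<open>1 / (1 + l)\<close> moves \<open>l = \<infinity>\<close> to 0. The two
  ends of the solution set then become the points \<open>low_end\<close> and
  \<open>high_end\<close>.\<close>

definition squeeze :: "real \<times> (real \<Rightarrow>\<^sub>C real) \<Rightarrow> real \<times> (real \<Rightarrow>\<^sub>C real)" where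
  "squeeze x = (1 / (1 + fst x), snd x)"

definition low_end :: "real \<times> (real \<Rightarrow>\<^sub>C real)" where
  "low_end = (0, ext (\<lambda>r. 0))"

definition high_end :: "real \<times> (real \<Rightarrow>\<^sub>C real)" where
  "high_end = (0, ext (\<lambda>r. R - r))"

definition compactified :: "(real \<times> (real \<Rightarrow>\<^sub>C real)) set" where
  "compactified = insert low_end (insert high_end (squeeze ` branch))"

text \<open>Properties which the solutions share with the two functions added at the ends, and which
  pass to limits. Together with the value at \<open>\<delta>\<close> they characterize these
  two functions: a profile of height 0 is 0, and one of the maximal height \<open>R -
  \<delta>\<close> must be \<open>R - r\<close>.\<close>

definition profile :: "(real \<Rightarrow>\<^sub>C real) \<Rightarrow> bool" where
  "profile v \<longleftrightarrow> (\<forall>t. apply_bcontfun v (nearest t) = apply_bcontfun v t \<and> 0 \<le> apply_bcontfun v t \<and> apply_bcontfun v t \<le> apply_bcontfun v \<delta>) \<and>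
     (\<forall>s t. \<bar>apply_bcontfun v s - apply_bcontfun v t\<bar> \<le> \<bar>s - t\<bar>) \<and> apply_bcontfun v R = 0"

lemma compactified_profile: "x \<in> compactified \<Longrightarrow> profile (snd x)"
proof -
  have "profile v" if "(l, v) \<in> branch" for l v
    unfolding profile_def
    using branchD(3,5)[OF that] branch_range[OF that] branch_lipschitz[OF that] by auto
  moreover have "profile (snd high_end)"
  proof -
    have "\<bar>nearest t - nearest s\<bar> \<le> \<bar>s - t\<bar>" for s t
      using nearest_lipschitz[of t s] by (simp add: abs_minus_commute)
    then show ?thesis
      using delta_less_R by (simp add: profile_def high_end_def continuous_intros)
  qed
  moreover have "profile (snd low_end)"
    by (simp add: profile_def low_end_def)
  ultimately show "x \<in> compactified \<Longrightarrow> profile (snd x)"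
    by (auto simp: compactified_def squeeze_def)
qed

lemma compactified_fst: "x \<in> compactified \<Longrightarrow> 0 \<le> fst x \<and> fst x \<le> 1"
  by (auto simp: compactified_def squeeze_def low_end_def high_end_def dest: branchD(1))

lemma profile_le: "profile v \<Longrightarrow> apply_bcontfun v \<delta> \<le> R - \<delta>"
proof -
  assume "profile v"
  then have "\<bar>apply_bcontfun v \<delta> - apply_bcontfun v R\<bar> \<le> \<bar>\<delta> - R\<bar>" "apply_bcontfun v R = 0"
    unfolding profile_def by blast+
  then show ?thesis using delta_less_R by linarith
qed

lemma profile_low_end:
  assumes "profile v" "apply_bcontfun v \<delta> = 0" shows "v = ext (\<lambda>r. 0)"
  using assms by (intro bcontfun_eqI) (auto simp: profile_def intro: antisym)

lemma profile_high_end: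
  assumes "profile v" "apply_bcontfun v \<delta> = R - \<delta>" shows "v = ext (\<lambda>r. R - r)"
proof (rule bcontfun_eqI)
  fix t
  have "\<bar>v (nearest t) - v \<delta>\<bar> \<le> \<bar>nearest t - \<delta>\<bar>" "\<bar>v (nearest t) - v R\<bar> \<le> \<bar>nearest t - R\<bar>" "v R = 0" "v (nearest t) = v t"
    using assms(1) unfolding profile_def by blast+
  then show "v t = ext (\<lambda>r. R - r) t"
    using assms(2) nearest_bounds[of t] by (simp add: continuous_intros)
qed

lemma compactified_cases:
  assumes "x \<in> compactified" shows "x = low_end \<or> x = high_end \<or> (0 < fst x \<and> (1 / fst x - 1, snd x) \<in> branch)"
proof -
  have "0 < 1 / (1 + l) \<and> (1 / (1 / (1 + l)) - 1, v) \<in> branch" if "(l, v) \<in> branch" for l v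
    using branchD(1)[OF that] that by simp
  then show ?thesis using assms by (auto simp: compactified_def squeeze_def)
qed

text \<open>Let a sequence of solutions converge. If the limit parameter is finite, then the limit is a
  solution. Otherwise the height \<open>v \<delta>\<close> of the limit cannot lie strictly
  between 0 and \<open>R - \<delta>\<close>, where the parameter is bounded, so the limit is
  one of the two ends.\<close>

lemma compact_compactified: "compact compactified"
  unfolding compact_eq_seq_compact_metric seq_compact_def
proof (intro allI impI)
  fix x :: "nat \<Rightarrow> real \<times> (real \<Rightarrow>\<^sub>C real)"
  assume x: "\<forall>n. x n \<in> compactified"
  obtain r v where r: "strict_mono r" "(\<lambda>n. snd (x (r n))) \<longlonglongrightarrow> v"
  proof (rule lipschitz_subsequence[of "\<lambda>n. snd (x n)" "R - \<delta>"])
    show "\<bar>apply_bcontfun (snd (x n)) t\<bar> \<le> R - \<delta>" for n t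
      using compactified_profile[of "x n"] profile_le[of "snd (x n)"] x unfolding profile_def
      by (metis abs_of_nonneg order_trans)
  qed (use compactified_profile x in \<open>auto simp: profile_def\<close>)
  have "\<forall>n. fst (x (r n)) \<in> {0..1}"
    using compactified_fst x by auto
  then obtain c k where k: "strict_mono k" "((\<lambda>n. fst (x (r n))) \<circ> k) \<longlonglongrightarrow> c"
    using compact_Icc[of 0 "1::real"] unfolding compact_eq_seq_compact_metric seq_compact_def by metis
  define y where "y = (\<lambda>n. x (r (k n)))"
  have y: "y n \<in> compactified" for n using x by (simp add: y_def)
  have y1: "(\<lambda>n. fst (y n)) \<longlonglongrightarrow> c" and y2: "(\<lambda>n. snd (y n)) \<longlonglongrightarrow> v"
    using k(2) LIMSEQ_subseq_LIMSEQ[OF r(2) k(1)] by (auto simp: o_def y_def)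
  then have ylim: "y \<longlonglongrightarrow> (c, v)"
    using tendsto_Pair[OF y1 y2] by simp
  have v_lim: "(\<lambda>n. apply_bcontfun (snd (y n)) t) \<longlonglongrightarrow> v t" for t
    using tendsto_bcontfun_uniform_limit[OF y2] by (rule tendsto_uniform_limitI) simp
  have "profile v"
    unfolding profile_def
  proof (intro conjI allI)
    note hp = compactified_profile[OF y, unfolded profile_def]
    show "v (nearest t) = v t" for t
      using v_lim[of "nearest t"] v_lim[of t] hp by (simp add: LIMSEQ_unique)
    show "0 \<le> v t" for t
      using hp by (intro LIMSEQ_le_const[OF v_lim]) auto
    show "v t \<le> v \<delta>" for t
      using hp by (intro LIMSEQ_le[OF v_lim v_lim]) auto
    show "\<bar>v s - v t\<bar> \<le> \<bar>s - t\<bar>" for s t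
      using hp by (intro LIMSEQ_le_const2[OF tendsto_rabs[OF tendsto_diff[OF v_lim v_lim]]]) auto
    show "v R = 0"
      using v_lim[of R] hp by (simp add: LIMSEQ_unique)
  qed
  have "(c, v) \<in> compactified"
  proof (rule ccontr)
    assume no: "(c, v) \<notin> compactified"
    have c0: "0 \<le> c"
      using compactified_fst[OF y] by (intro LIMSEQ_le_const[OF y1]) auto
    have "\<forall>\<^sub>F n in sequentially. y n \<in> - {low_end, high_end}"
      using no by (intro topological_tendstoD[OF ylim] open_Compl finite_imp_closed) (auto simp: compactified_def)
    then have ev: "\<forall>\<^sub>F n in sequentially. 0 < fst (y n) \<and> (1 / fst (y n) - 1, snd (y n)) \<in> branch"
      by eventually_elim (use compactified_cases[OF y] in auto)
    show False
    proof (cases "c = 0")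
      case False
      have "(1 / c - 1, v) \<in> branch"
        using ev False by (intro branch_limit[OF _ _ y2, of "\<lambda>n. 1 / fst (y n) - 1"] tendsto_intros y1)
          (auto elim!: eventually_mono)
      then have "squeeze (1 / c - 1, v) \<in> compactified"
        by (simp add: compactified_def)
      then show False using no by (simp add: squeeze_def)
    next
      case True
      have "v \<delta> \<noteq> 0" "v \<delta> \<noteq> R - \<delta>"
        using no profile_low_end[OF \<open>profile v\<close>] profile_high_end[OF \<open>profile v\<close>] True
        by (auto simp: compactified_def low_end_def high_end_def)
      then have v\<delta>: "0 < v \<delta>" "v \<delta> < R - \<delta>"
        using profile_le[OF \<open>profile v\<close>] \<open>profile v\<close> by (auto simp: profile_def less_le)
      obtain L where L: "0 < L" "\<And>l u. (l, u) \<in> branch \<Longrightarrow> v \<delta> / 2 \<le> apply_bcontfun u \<delta> \<Longrightarrow>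
          apply_bcontfun u \<delta> \<le> (v \<delta> + (R - \<delta>)) / 2 \<Longrightarrow> l < L"
        using branch_bounded_parameter[of "v \<delta> / 2" "(v \<delta> + (R - \<delta>)) / 2"] v\<delta> by auto
      have "\<forall>\<^sub>F n in sequentially. fst (y n) < 1 / (1 + L)"
        using order_tendstoD(2)[OF y1] True L(1) by simp
      moreover have "\<forall>\<^sub>F n in sequentially. v \<delta> / 2 < apply_bcontfun (snd (y n)) \<delta>"
        by (rule order_tendstoD(1)[OF v_lim]) (use v\<delta> in simp)
      moreover have "\<forall>\<^sub>F n in sequentially. apply_bcontfun (snd (y n)) \<delta> < (v \<delta> + (R - \<delta>)) / 2"
        by (rule order_tendstoD(2)[OF v_lim]) (use v\<delta> in simp)
      ultimately have "\<forall>\<^sub>F n in sequentially. False"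
        using ev
      proof eventually_elim
        case (elim n)
        have "1 / fst (y n) - 1 < L"
          using elim by (intro L(2)[of _ "snd (y n)"]) auto
        then have "1 < fst (y n) * (1 + L)"
          using elim(4) by (simp add: field_simps)
        then show False
          using elim(1) L(1) by (simp add: field_simps)
      qed
      then show False by simp
    qed
  qed
  then show "\<exists>l\<in>compactified. \<exists>r. strict_mono r \<and> (x \<circ> r) \<longlonglongrightarrow> l"
    using ylim strict_mono_o[OF r(1) k(1)] by (auto simp: y_def o_def)
qed

section \<open>Shooting through delayed equations\<close>

text \<open>Picard iterates of the equation with delay \<open>\<epsilon>\<close>, start value
  \<open>d\<close> and parameter \<open>l\<close>. Because of the delay each iteration
  settles the values on a further interval of length \<open>\<epsilon>\<close>
  (\<open>tonelli_stable\<close>), so finitely many iterations solve the delayed equation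
  exactly, and the solution depends continuously on \<open>(d, l)\<close>.\<close>

primrec tonelli :: "real \<Rightarrow> real \<Rightarrow> real \<Rightarrow> nat \<Rightarrow> real \<Rightarrow> real" where
  "tonelli \<epsilon> d l 0 = (\<lambda>r. d)"
| "tonelli \<epsilon> d l (Suc k) = (\<lambda>r. d - fall l (\<lambda>t. F t (tonelli \<epsilon> d l k (t - \<epsilon>))) (nearest r))"

lemma cont_tonelli: "continuous_on A (tonelli \<epsilon> d l k)"
proof (induction k arbitrary: A)
  case (Suc k)
  have "continuous_on {\<delta>..R} (\<lambda>t. tonelli \<epsilon> d l k (t - \<epsilon>))"
    by (rule continuous_on_compose2[OF Suc[of UNIV]]) (auto intro!: continuous_intros)
  then have "continuous_on A (\<lambda>r. fall l (\<lambda>t. F t (tonelli \<epsilon> d l k (t - \<epsilon>))) (nearest r))"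
    by (intro continuous_on_compose2[OF cont_fall cont_nearest] cont_F) auto
  then show ?case
    by (auto intro: continuous_on_diff)
qed simp

lemma cont_tonelli_delayed: "continuous_on A (\<lambda>t. tonelli \<epsilon> d l k (t - \<epsilon>))"
  by (rule continuous_on_compose2[OF cont_tonelli[of UNIV]]) (auto intro!: continuous_intros)

lemma tonelli_nearest [simp]: "tonelli \<epsilon> d l k (nearest r) = tonelli \<epsilon> d l k r"
  by (cases k) auto

lemma tonelli_left: "r \<le> \<delta> \<Longrightarrow> tonelli \<epsilon> d l k r = d"
proof -
  assume "r \<le> \<delta>"
  then have "nearest r = \<delta>" using delta_less_R by (simp add: nearest_def)
  then show ?thesis by (cases k) auto
qed

lemma tonelli_lipschitz: "\<bar>tonelli \<epsilon> d l k s - tonelli \<epsilon> d l k t\<bar> \<le> \<bar>s - t\<bar>"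
proof (cases k)
  case (Suc n)
  have "\<bar>tonelli \<epsilon> d l k s - tonelli \<epsilon> d l k t\<bar> \<le> \<bar>nearest s - nearest t\<bar>"
    using fall_lipschitz[OF cont_F[OF cont_tonelli_delayed[of "{\<delta>..R}" \<epsilon> d l n]] nearest_in[of t] nearest_in[of s], of l] Suc
    by (simp add: abs_minus_commute)
  then show ?thesis using nearest_lipschitz[of s t] by linarith
qed simp

lemma tonelli_stable:
  assumes "0 < \<epsilon>"
  shows "r \<le> \<delta> + real k * \<epsilon> \<Longrightarrow> tonelli \<epsilon> d l (Suc k) r = tonelli \<epsilon> d l k r"
proof (induction k arbitrary: r)
  case 0
  then show ?case using tonelli_left[of r \<epsilon> d l "Suc 0"] by simp
next
  case (Suc k)
  have "fall l (\<lambda>t. F t (tonelli \<epsilon> d l (Suc k) (t - \<epsilon>))) (nearest r) = fall l (\<lambda>t. F t (tonelli \<epsilon> d l k (t - \<epsilon>))) (nearest r)"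
  proof (rule fall_cong[OF nearest_in])
    fix t assume t: "t \<in> {\<delta>..nearest r}"
    have "t - \<epsilon> \<le> \<delta> + real k * \<epsilon>"
    proof (cases "r \<le> \<delta>")
      case True
      then have "t = \<delta>" using t delta_less_R by (simp add: nearest_def)
      moreover have "0 \<le> real k * \<epsilon>" using assms by simp
      ultimately show ?thesis using assms by linarith
    next
      case False
      then have "nearest r \<le> r" by (auto simp: nearest_def)
      then show ?thesis using t Suc.prems by (simp add: algebra_simps)
    qed
    then show "F t (tonelli \<epsilon> d l (Suc k) (t - \<epsilon>)) = F t (tonelli \<epsilon> d l k (t - \<epsilon>))"
      using Suc.IH by simp
  qed
  then show ?case
    by simp
qed

text \<open>With delay \<open>(R - \<delta>) / (n + 1)\<close>, \<open>n + 1\<close> iterations cover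
  the interval.\<close>

definition scheme :: "nat \<Rightarrow> real \<Rightarrow> real \<Rightarrow> real \<Rightarrow> real" where
  "scheme n d l = tonelli ((R - \<delta>) / real (Suc n)) d l (Suc n)"

lemma scheme_equation:
  "scheme n d l r = d - fall l (\<lambda>t. F t (scheme n d l (t - (R - \<delta>) / real (Suc n)))) (nearest r)"
proof -
  define \<epsilon> where "\<epsilon> = (R - \<delta>) / real (Suc n)"
  have "tonelli \<epsilon> d l (Suc (Suc n)) (nearest r) = tonelli \<epsilon> d l (Suc n) (nearest r)"
    using delta_less_R nearest_bounds(2)[of r] by (intro tonelli_stable) (auto simp: \<epsilon>_def simp del: of_nat_Suc)
  then have "tonelli \<epsilon> d l (Suc n) r = tonelli \<epsilon> d l (Suc (Suc n)) r"
    by (simp only: tonelli_nearest)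
  also have "\<dots> = d - fall l (\<lambda>t. F t (tonelli \<epsilon> d l (Suc n) (t - \<epsilon>))) (nearest r)"
    by (simp only: tonelli.simps(2))
  finally show ?thesis
    unfolding scheme_def \<epsilon>_def .
qed

lemma cont_scheme: "continuous_on A (scheme n d l)"
  unfolding scheme_def by (rule cont_tonelli)

lemma ext_scheme [simp]: "ext (scheme n d l) t = scheme n d l t"
  by (simp add: cont_scheme) (simp add: scheme_def del: tonelli.simps)

lemma scheme_left [simp]: "scheme n d l \<delta> = d"
  by (simp add: scheme_def tonelli_left del: tonelli.simps)

lemma scheme_lipschitz: "\<bar>scheme n d l s - scheme n d l t\<bar> \<le> \<bar>s - t\<bar>"
  unfolding scheme_def by (rule tonelli_lipschitz)

lemma uniform_limit_tonelli:
  assumes d: "(d \<longlongrightarrow> d\<^sub>0) G" and l: "(l \<longlongrightarrow> l\<^sub>0) G"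
  shows "uniform_limit UNIV (\<lambda>i. tonelli \<epsilon> (d i) (l i) k) (tonelli \<epsilon> d\<^sub>0 l\<^sub>0 k) G"
proof (induction k)
  case 0
  then show ?case using uniform_limit_of_tendsto[OF d] by simp
next
  case (Suc k)
  have "uniform_limit {\<delta>..R} (\<lambda>i t. tonelli \<epsilon> (d i) (l i) k (t - \<epsilon>)) (\<lambda>t. tonelli \<epsilon> d\<^sub>0 l\<^sub>0 k (t - \<epsilon>)) G"
    by (rule uniform_limit_compose'[OF Suc]) auto
  then have "uniform_limit {\<delta>..R} (\<lambda>i. fall (l i) (\<lambda>t. F t (tonelli \<epsilon> (d i) (l i) k (t - \<epsilon>))))
      (fall l\<^sub>0 (\<lambda>t. F t (tonelli \<epsilon> d\<^sub>0 l\<^sub>0 k (t - \<epsilon>)))) G"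
    by (intro uniform_limit_fall[OF l] uniform_limit_F cont_F cont_tonelli_delayed always_eventually allI)
  then have "uniform_limit UNIV (\<lambda>i r. fall (l i) (\<lambda>t. F t (tonelli \<epsilon> (d i) (l i) k (t - \<epsilon>))) (nearest r))
      (\<lambda>r. fall l\<^sub>0 (\<lambda>t. F t (tonelli \<epsilon> d\<^sub>0 l\<^sub>0 k (t - \<epsilon>))) (nearest r)) G"
    by (rule uniform_limit_compose') auto
  then show ?case
    unfolding tonelli.simps by (intro uniform_limit_minus uniform_limit_of_tendsto[OF d])
qed

lemma tendsto_ext_scheme:
  assumes "(d \<longlongrightarrow> d\<^sub>0) G" "(l \<longlongrightarrow> l\<^sub>0) G"
  shows "((\<lambda>i. ext (scheme n (d i) (l i))) \<longlongrightarrow> ext (scheme n d\<^sub>0 l\<^sub>0)) G"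
  by (rule tendsto_ext) (auto simp: cont_tonelli scheme_def simp del: tonelli.simps
      intro!: uniform_limit_on_subset[OF uniform_limit_tonelli[OF assms]])

text \<open>As the delay vanishes, the delayed solutions accumulate at solutions of the initial value
  problem: with Lipschitz constant 1, shifting the argument by \<open>\<epsilon>\<close>
  changes the values by at most \<open>\<epsilon>\<close>.\<close>

lemma scheme_limit:
  assumes dl: "\<And>n. d n \<in> {a..b}" "\<And>n. l n \<in> {0..L}"
  obtains r d\<^sub>0 l\<^sub>0 v where "strict_mono r" "(\<lambda>n. d (r n)) \<longlonglongrightarrow> d\<^sub>0" "(\<lambda>n. l (r n)) \<longlonglongrightarrow> l\<^sub>0"
    "(\<lambda>n. ext (scheme (r n) (d (r n)) (l (r n)))) \<longlonglongrightarrow> v"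
    "\<And>t. apply_bcontfun v t = apply_bcontfun v \<delta> - fall l\<^sub>0 (\<lambda>s. F s (apply_bcontfun v s)) (nearest t)" "apply_bcontfun v \<delta> = d\<^sub>0"
proof -
  define u where "u = (\<lambda>n. ext (scheme n (d n) (l n)))"
  have u: "apply_bcontfun (u n) t = scheme n (d n) (l n) t" for n t
    by (simp add: u_def)
  have "seq_compact ({a..b} \<times> {0..L})"
    by (intro compact_imp_seq_compact compact_Times) auto
  moreover have "\<forall>n. (d n, l n) \<in> {a..b} \<times> {0..L}"
    using dl by auto
  ultimately obtain z k where k: "strict_mono k" "((\<lambda>n. (d n, l n)) \<circ> k) \<longlonglongrightarrow> z"
    by (rule seq_compactE)
  obtain r' v where r': "strict_mono r'" and v': "(\<lambda>n. u (k (r' n))) \<longlonglongrightarrow> v"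
  proof (rule lipschitz_subsequence[of "\<lambda>n. u (k n)" "max \<bar>a\<bar> \<bar>b\<bar> + (R - \<delta>)"])
    have "\<bar>apply_bcontfun (u n) t\<bar> \<le> max \<bar>a\<bar> \<bar>b\<bar> + (R - \<delta>)" for n t
    proof -
      have "\<bar>scheme n (d n) (l n) (nearest t) - d n\<bar> \<le> R - \<delta>"
        using scheme_lipschitz[of n "d n" "l n" "nearest t" \<delta>] nearest_bounds(2)[of t]
        by (simp del: nearest_bounds(2))
      moreover have "scheme n (d n) (l n) (nearest t) = scheme n (d n) (l n) t"
        by (simp add: scheme_def del: tonelli.simps)
      moreover have "\<bar>d n\<bar> \<le> max \<bar>a\<bar> \<bar>b\<bar>"
        using dl(1)[of n] by auto
      ultimately show ?thesis using u[of n t] by linarith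
    qed
    then show "\<bar>apply_bcontfun (u (k n)) t\<bar> \<le> max \<bar>a\<bar> \<bar>b\<bar> + (R - \<delta>)" for n t .
    show "apply_bcontfun (u (k n)) (nearest t) = apply_bcontfun (u (k n)) t" for n t
      by (simp add: u scheme_def del: tonelli.simps)
  qed (simp add: u scheme_lipschitz)
  define r where "r = k \<circ> r'"
  have r: "strict_mono r" and v: "(\<lambda>n. u (r n)) \<longlonglongrightarrow> v"
    using strict_mono_o[OF k(1) r'] v' by (auto simp: r_def)
  define d\<^sub>0 l\<^sub>0 where "d\<^sub>0 = fst z" and "l\<^sub>0 = snd z"
  have "(\<lambda>n. (d (r n), l (r n))) \<longlonglongrightarrow> z"
    using LIMSEQ_subseq_LIMSEQ[OF k(2) r'] by (simp add: r_def o_def)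
  from tendsto_fst[OF this] tendsto_snd[OF this]
  have d: "(\<lambda>n. d (r n)) \<longlonglongrightarrow> d\<^sub>0" and l: "(\<lambda>n. l (r n)) \<longlonglongrightarrow> l\<^sub>0"
    by (simp_all add: d\<^sub>0_def l\<^sub>0_def)
  define w where "w = (\<lambda>n t. scheme (r n) (d (r n)) (l (r n)) (t - (R - \<delta>) / real (Suc (r n))))"
  have small: "(\<lambda>n. (R - \<delta>) / real (Suc (r n))) \<longlonglongrightarrow> 0"
    using LIMSEQ_subseq_LIMSEQ[OF tendsto_divide_0[OF tendsto_const
        filterlim_compose[OF filterlim_real_sequentially filterlim_Suc, THEN filterlim_at_top_imp_at_infinity], of "R - \<delta>"] r]
    by (simp add: o_def)
  have w: "uniform_limit {\<delta>..R} w v sequentially"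
  proof (rule uniform_limitI)
    fix e :: real assume e: "0 < e"
    have "\<forall>\<^sub>F n in sequentially. (R - \<delta>) / real (Suc (r n)) < e / 2"
      by (rule order_tendstoD(2)[OF small]) (use e in simp)
    moreover have "\<forall>\<^sub>F n in sequentially. dist (u (r n)) v < e / 2"
      by (rule tendstoD[OF v]) (use e in simp)
    ultimately show "\<forall>\<^sub>F n in sequentially. \<forall>t\<in>{\<delta>..R}. dist (w n t) (v t) < e"
    proof eventually_elim
      case (elim n)
      show ?case
      proof
        fix t
        define \<epsilon> where "\<epsilon> = (R - \<delta>) / real (Suc (r n))"
        have "0 \<le> \<epsilon>" using delta_less_R by (simp add: \<epsilon>_def)
        then have "\<bar>w n t - apply_bcontfun (u (r n)) t\<bar> \<le> \<epsilon>"
          using scheme_lipschitz[of "r n" "d (r n)" "l (r n)" "t - \<epsilon>" t] by (simp add: w_def u \<epsilon>_def)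
        moreover have "\<bar>apply_bcontfun (u (r n)) t - v t\<bar> < e / 2"
          using dist_fun_lt_imp_dist_val_lt[OF elim(2), of t] by (simp add: dist_real_def)
        ultimately show "dist (w n t) (v t) < e"
          using elim(1) unfolding \<epsilon>_def dist_real_def by linarith
      qed
    qed
  qed
  have v\<delta>: "v \<delta> = d\<^sub>0"
  proof (rule LIMSEQ_unique)
    show "(\<lambda>n. apply_bcontfun (u (r n)) \<delta>) \<longlonglongrightarrow> v \<delta>"
      using tendsto_bcontfun_uniform_limit[OF v] by (rule tendsto_uniform_limitI) simp
    show "(\<lambda>n. apply_bcontfun (u (r n)) \<delta>) \<longlonglongrightarrow> d\<^sub>0"
      using d by (simp add: u)
  qed
  have "v t = v \<delta> - fall l\<^sub>0 (\<lambda>s. F s (v s)) (nearest t)" for t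
  proof (rule integral_equation_limit[OF _ _ w _ v, where I = UNIV])
    show "(\<lambda>n. l (r n)) \<longlonglongrightarrow> l\<^sub>0" by (rule l)
    have "continuous_on {\<delta>..R} (w n)" for n
      unfolding w_def
      by (rule continuous_on_compose2[OF cont_scheme[of UNIV]]) (auto intro!: continuous_intros)
    then show "\<forall>\<^sub>F n in sequentially. continuous_on {\<delta>..R} (w n)" by simp
    show "apply_bcontfun (u (r n)) t = apply_bcontfun (u (r n)) \<delta> - fall (l (r n)) (\<lambda>s. F s (w n s)) (nearest t)" for n t
      using scheme_equation[of "r n" "d (r n)" "l (r n)" t] by (simp add: u w_def)
  qed auto
  then show ?thesis
    using that[OF r d l v[unfolded u_def] _ v\<delta>] by blast
qed

text \<open>The solutions cannot be split into closed sets \<open>A\<close>, containing those of norm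
  \<open>a\<close>, and \<open>B\<close>, containing those of norm \<open>b\<close>. For
  each delay the end value \<open>g\<close> is positive for \<open>l = 0\<close> and
  negative for \<open>l = L\<close>, so the Poincare-Miranda alternative gives a trajectory
  with \<open>g = 0\<close> at which \<open>h\<close>, positive on \<open>A\<close> and
  negative on \<open>B\<close>, is either 0, or negative with start value \<open>a\<close>,
  or positive with start value \<open>b\<close>. In the limit of vanishing delay this is a
  solution in \<open>A\<close> of norm \<open>b\<close> or a solution in \<open>B\<close> of
  norm \<open>a\<close>.\<close>

lemma shooting_separation:
  assumes AB: "closed A" "closed B" "A \<inter> B = {}" "squeeze ` branch \<subseteq> A \<union> B" "A \<noteq> {}" "B \<noteq> {}"
    and ab: "0 < a" "a \<le> b" "b < R - \<delta>"
    and low: "\<And>x. x \<in> squeeze ` branch \<Longrightarrow> apply_bcontfun (snd x) \<delta> = a \<Longrightarrow> x \<in> A"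
    and high: "\<And>x. x \<in> squeeze ` branch \<Longrightarrow> apply_bcontfun (snd x) \<delta> = b \<Longrightarrow> x \<in> B"
  shows False
proof -
  obtain m where m: "0 < m" "\<And>t s. t \<in> {\<delta>..R} \<Longrightarrow> a / 2 \<le> s \<Longrightarrow> m \<le> F t s"
    using F_lower[of "a / 2"] ab by auto
  obtain L where L: "0 < L"
    "\<And>l g. L \<le> l \<Longrightarrow> continuous_on {\<delta>..R} g \<Longrightarrow> (\<And>t. t \<in> {\<delta>..R} \<Longrightarrow> 0 \<le> g t) \<Longrightarrow>
       (\<And>t. t \<in> {\<delta>..R} \<Longrightarrow> t \<le> \<delta> + a / 2 \<Longrightarrow> m \<le> g t) \<Longrightarrow> b < fall l g R"
    using fall_large[of m "a / 2" b] m ab by auto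
  define X where "X = (\<lambda>n z. squeeze (snd z, ext (scheme n (fst z) (snd z))))"
  define h where "h = (\<lambda>x. infdist x B - infdist x A)"
  define g where "g = (\<lambda>n z. apply_bcontfun (ext (scheme n (fst z) (snd z))) R)"
  have cont_h: "continuous_on UNIV h"
    unfolding h_def by (intro continuous_intros)
  have cont_w: "continuous_on ({a..b} \<times> {0..L}) (\<lambda>z. ext (scheme n (fst z) (snd z)))" for n
    unfolding continuous_on_def by (intro ballI tendsto_ext_scheme tendsto_intros)
  have "\<exists>x y. x \<in> {a..b} \<and> y \<in> {0..L} \<and> 
      (h (X n (x, y)) = 0 \<or> h (X n (x, y)) < 0 \<and> x = a \<or> h (X n (x, y)) > 0 \<and> x = b) \<and>
      (g n (x, y) = 0 \<or> g n (x, y) < 0 \<and> y = 0 \<or> g n (x, y) > 0 \<and> y = L)" for n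
  proof -
    have "continuous_on ({a..b} \<times> {0..L}) (X n)"
      unfolding X_def squeeze_def fst_conv snd_conv
      using cont_w by (intro continuous_intros) auto
    then have 1: "continuous_on ({a..b} \<times> {0..L}) (\<lambda>z. h (X n z))"
      by (rule continuous_on_compose2[OF cont_h]) auto
    have 2: "continuous_on ({a..b} \<times> {0..L}) (g n)"
      unfolding continuous_on_def g_def
    proof (intro ballI)
      fix z assume "z \<in> {a..b} \<times> {0..L}"
      then have "((\<lambda>z. ext (scheme n (fst z) (snd z))) \<longlongrightarrow> ext (scheme n (fst z) (snd z))) (at z within {a..b} \<times> {0..L})"
        using cont_w[of n] unfolding continuous_on_def by blast
      from tendsto_uniform_limitI[OF tendsto_bcontfun_uniform_limit[OF this]]
      show "((\<lambda>z. apply_bcontfun (ext (scheme n (fst z) (snd z))) R) \<longlongrightarrow>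
          apply_bcontfun (ext (scheme n (fst z) (snd z))) R) (at z within {a..b} \<times> {0..L})" by simp
    qed
    show ?thesis
      by (rule Poincare_Miranda_alternative[OF ab(2) less_imp_le[OF L(1)] 1 2]) blast
  qed
  then obtain d l where dl: "\<And>n. d n \<in> {a..b}" "\<And>n. l n \<in> {0..L}"
    and hX: "\<And>n. h (X n (d n, l n)) = 0 \<or> h (X n (d n, l n)) < 0 \<and> d n = a \<or> h (X n (d n, l n)) > 0 \<and> d n = b"
    and gX: "\<And>n. g n (d n, l n) = 0 \<or> g n (d n, l n) < 0 \<and> l n = 0 \<or> g n (d n, l n) > 0 \<and> l n = L"
    by metis
  \<comment> \<open>The trajectory with \<open>l = 0\<close> stays at \<open>d > 0\<close>, and that with \<open>l = L\<close> falls by more than \<open>b \<ge> d\<close>.\<close>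
  have g0: "g n (d n, l n) = 0" for n
  proof -
    have eq: "g n (d n, l n) = d n - fall (l n) (\<lambda>t. F t (scheme n (d n) (l n) (t - (R - \<delta>) / real (Suc n)))) R"
      using scheme_equation[of n "d n" "l n" R] delta_less_R by (simp add: g_def)
    have "0 < g n (d n, l n)" if "l n = 0"
      using eq that dl(1)[of n] ab by simp
    moreover have "g n (d n, l n) < 0" if l: "l n = L"
    proof -
      have "b < fall (l n) (\<lambda>t. F t (scheme n (d n) (l n) (t - (R - \<delta>) / real (Suc n)))) R"
      proof (rule L(2))
        fix t assume t: "t \<in> {\<delta>..R}" "t \<le> \<delta> + a / 2"
        define \<epsilon> where "\<epsilon> = (R - \<delta>) / real (Suc n)"
        have "0 < \<epsilon>" using delta_less_R by (simp add: \<epsilon>_def)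
        have "a / 2 \<le> scheme n (d n) (l n) (t - \<epsilon>)"
        proof (cases "t - \<epsilon> \<le> \<delta>")
          case True
          then have "scheme n (d n) (l n) (t - \<epsilon>) = d n"
            by (simp add: scheme_def tonelli_left del: tonelli.simps)
          then show ?thesis using dl(1)[of n] ab by simp
        next
          case False
          have "\<bar>scheme n (d n) (l n) (t - \<epsilon>) - d n\<bar> \<le> \<bar>t - \<epsilon> - \<delta>\<bar>"
            using scheme_lipschitz[of n "d n" "l n" "t - \<epsilon>" \<delta>] by simp
          moreover have "a \<le> d n" using dl(1)[of n] by simp
          ultimately show ?thesis
            using False t(2) \<open>0 < \<epsilon>\<close> unfolding abs_le_iff by (simp add: abs_if split: if_splits)
        qed
        then show "m \<le> F t (scheme n (d n) (l n) (t - (R - \<delta>) / real (Suc n)))"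
          using t by (intro m(2)) (auto simp: \<epsilon>_def)
      next
        show "continuous_on {\<delta>..R} (\<lambda>t. F t (scheme n (d n) (l n) (t - (R - \<delta>) / real (Suc n))))"
          by (intro cont_F continuous_on_compose2[OF cont_scheme[of UNIV]]) (auto intro!: continuous_intros)
      qed (use l F_nonneg in auto)
      then show ?thesis using eq dl(1)[of n] by simp
    qed
    ultimately show ?thesis using gX[of n] by fastforce
  qed
  obtain r d\<^sub>0 l\<^sub>0 v where r: "strict_mono r" and d_lim: "(\<lambda>n. d (r n)) \<longlonglongrightarrow> d\<^sub>0" and l_lim: "(\<lambda>n. l (r n)) \<longlonglongrightarrow> l\<^sub>0"
    and v: "(\<lambda>n. ext (scheme (r n) (d (r n)) (l (r n)))) \<longlonglongrightarrow> v"
    and eq: "\<And>t. apply_bcontfun v t = apply_bcontfun v \<delta> - fall l\<^sub>0 (\<lambda>s. F s (apply_bcontfun v s)) (nearest t)"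
    and v\<delta>: "apply_bcontfun v \<delta> = d\<^sub>0"
    by (rule scheme_limit[of d a b l L, OF dl]; rule that)
  have d0_in: "a \<le> d\<^sub>0" "d\<^sub>0 \<le> b"
    using dl(1) by (auto intro!: LIMSEQ_le_const[OF d_lim] LIMSEQ_le_const2[OF d_lim])
  have l0_in: "0 \<le> l\<^sub>0"
    using dl(2) by (auto intro!: LIMSEQ_le_const[OF l_lim])
  have "v R = 0"
  proof (rule LIMSEQ_unique)
    show "(\<lambda>n. g (r n) (d (r n), l (r n))) \<longlonglongrightarrow> v R"
      using tendsto_uniform_limitI[OF tendsto_bcontfun_uniform_limit[OF v], of R] by (simp add: g_def)
    show "(\<lambda>n. g (r n) (d (r n), l (r n))) \<longlonglongrightarrow> 0"
      by (simp add: g0)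
  qed
  moreover have "0 < v \<delta>"
    using v\<delta> d0_in(1) ab(1) by linarith
  ultimately have "(l\<^sub>0, v) \<in> branch"
    unfolding branch_def using eq l0_in by blast
  then have x: "squeeze (l\<^sub>0, v) \<in> squeeze ` branch" by simp
  have "(\<lambda>n. X (r n) (d (r n), l (r n))) \<longlonglongrightarrow> squeeze (l\<^sub>0, v)"
    unfolding X_def squeeze_def fst_conv snd_conv
    using l0_in by (intro tendsto_intros l_lim v) auto
  then have lim: "(\<lambda>n. h (X (r n) (d (r n), l (r n)))) \<longlonglongrightarrow> h (squeeze (l\<^sub>0, v))"
    by (rule continuous_on_tendsto_compose[OF cont_h]) auto
  consider "squeeze (l\<^sub>0, v) \<in> A" | "squeeze (l\<^sub>0, v) \<in> B"
    using x AB(4) by blast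
  then show False
  proof cases
    case 1
    then have "0 < infdist (squeeze (l\<^sub>0, v)) B"
      using AB in_closed_iff_infdist_zero[of B "squeeze (l\<^sub>0, v)"] infdist_nonneg[of "squeeze (l\<^sub>0, v)" B] by fastforce
    then have "0 < h (squeeze (l\<^sub>0, v))"
      using 1 by (simp add: h_def)
    from order_tendstoD(1)[OF lim this] have "\<forall>\<^sub>F n in sequentially. d (r n) = b"
      by eventually_elim (use hX in \<open>metis less_asym less_irrefl\<close>)
    then have "d\<^sub>0 = b"
      using LIMSEQ_unique[OF d_lim] tendsto_eventually by metis
    then show False
      using high[OF x] v\<delta> 1 AB(3) by (auto simp: squeeze_def)
  next
    case 2
    then have "0 < infdist (squeeze (l\<^sub>0, v)) A"
      using AB in_closed_iff_infdist_zero[of A "squeeze (l\<^sub>0, v)"] infdist_nonneg[of "squeeze (l\<^sub>0, v)" A] by fastforce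
    then have "h (squeeze (l\<^sub>0, v)) < 0"
      using 2 by (simp add: h_def)
    from order_tendstoD(2)[OF lim this] have "\<forall>\<^sub>F n in sequentially. d (r n) = a"
      by eventually_elim (use hX in \<open>metis less_asym less_irrefl\<close>)
    then have "d\<^sub>0 = a"
      using LIMSEQ_unique[OF d_lim] tendsto_eventually by metis
    then show False
      using low[OF x] v\<delta> 2 AB(3) by (auto simp: squeeze_def)
  qed
qed

text \<open>If \<open>A\<close> and \<open>B\<close> separate the two ends, then by compactness
  \<open>A\<close> contains all solutions of norm below the minimal norm in
  \<open>B\<close>, and \<open>B\<close> contains all those of norm above the maximal norm
  in \<open>A\<close>.\<close>

lemma ends_joined:
  obtains D where "D \<subseteq> compactified" "compact D" "connected D" "low_end \<in> D" "high_end \<in> D"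
proof -
  have ends: "low_end \<in> compactified" "high_end \<in> compactified"
    by (auto simp: compactified_def)
  show ?thesis
  proof (rule compact_connected_or_separated[OF compact_compactified ends])
    fix A B
    assume AB: "closed A" "closed B" "A \<inter> B = {}" "A \<union> B = compactified" "low_end \<in> A" "high_end \<in> B"
    have sub: "A \<subseteq> compactified" "B \<subseteq> compactified"
      using AB by auto
    have comp: "compact A" "compact B"
      using AB sub compact_compactified by (metis compact_Int_closed inf.absorb2)+
    define e where "e = (\<lambda>x::real \<times> (real \<Rightarrow>\<^sub>C real). apply_bcontfun (snd x) \<delta>)"
    have cont_e: "continuous_on S e" for S
      unfolding continuous_on_def e_def
      by (intro ballI tendsto_uniform_limitI[OF tendsto_bcontfun_uniform_limit[OF tendsto_snd[OF tendsto_ident_at]]]) auto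
    have e_range: "0 \<le> e x" "e x \<le> R - \<delta>" if "x \<in> compactified" for x
      using compactified_profile[OF that] profile_le by (auto simp: e_def profile_def)
    have e_low: "x = low_end" if "x \<in> compactified" "e x = 0" for x
      using compactified_cases[OF that(1)] that(2) branchD(4) delta_less_R
      by (auto simp: e_def high_end_def continuous_intros) fastforce
    have e_high: "x = high_end" if "x \<in> compactified" "e x = R - \<delta>" for x
      using compactified_cases[OF that(1)] that(2) branchD(7) delta_less_R
      by (auto simp: e_def low_end_def) fastforce
    obtain y where y: "y \<in> B" "\<And>x. x \<in> B \<Longrightarrow> e y \<le> e x"
      using continuous_attains_inf[OF comp(2) _ cont_e] AB by blast
    obtain z where z: "z \<in> A" "\<And>x. x \<in> A \<Longrightarrow> e x \<le> e z"
      using continuous_attains_sup[OF comp(1) _ cont_e] AB by blast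
    have y0: "0 < e y"
      using e_low[of y] e_range[of y] y(1) sub AB by (metis disjoint_iff less_eq_real_def subsetD)
    have zR: "e z < R - \<delta>"
      using e_high[of z] e_range[of z] z(1) sub AB by (metis disjoint_iff less_eq_real_def subsetD)
    have branch_sub: "squeeze ` branch \<subseteq> A \<union> B"
      using AB(4) by (auto simp: compactified_def)
    have False
    proof (rule shooting_separation[OF AB(1-3) branch_sub])
      show "0 < e y / 2" using y0 by simp
      show "(e z + (R - \<delta>)) / 2 < R - \<delta>" using zR by simp
      show "e y / 2 \<le> (e z + (R - \<delta>)) / 2"
      proof -
        have "y \<in> compactified" "z \<in> compactified"
          using y(1) z(1) sub by auto
        from e_range[OF this(1)] e_range[OF this(2)] show ?thesis by (simp add: divide_right_mono)
      qed
      show "x \<in> A" if "x \<in> squeeze ` branch" "apply_bcontfun (snd x) \<delta> = e y / 2" for x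
        using that branch_sub y(2)[of x] y0 by (auto simp: e_def)
      show "x \<in> B" if "x \<in> squeeze ` branch" "apply_bcontfun (snd x) \<delta> = (e z + (R - \<delta>)) / 2" for x
        using that branch_sub z(2)[of x] zR by (auto simp: e_def)
    qed (use AB in auto)
    then show ?thesis by blast
  qed (use that in blast)
qed

text \<open>On a continuum from \<open>low_end\<close> to \<open>high_end\<close> the norm takes all
  values between 0 and \<open>R - \<delta>\<close>, the two extreme ones only at the ends.\<close>

lemma spanning_connected_subset:
  obtains Z where "Z \<subseteq> branch" "connected Z"
    "\<And>c. 0 < c \<Longrightarrow> c < R - \<delta> \<Longrightarrow> \<exists>l v. (l, v) \<in> Z \<and> apply_bcontfun v \<delta> = c"
proof -
  obtain D where D: "D \<subseteq> compactified" "compact D" "connected D" "low_end \<in> D" "high_end \<in> D"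
    using ends_joined by blast
  have low0: "apply_bcontfun (snd low_end) \<delta> = 0" and highR: "apply_bcontfun (snd high_end) \<delta> = R - \<delta>"
    using delta_less_R by (simp_all add: low_end_def high_end_def continuous_intros)
  then have "low_end \<noteq> high_end"
    using delta_less_R by auto
  then obtain C where C: "C \<subseteq> D" "connected C" "low_end \<in> C" "high_end \<in> C" "connected (C - {low_end, high_end})"
    using continuum_with_connected_interior[OF D(2-5)] by metis
  define inv where "inv = (\<lambda>x::real \<times> (real \<Rightarrow>\<^sub>C real). (1 / fst x - 1, snd x))"
  have pos: "0 < fst x \<and> inv x \<in> branch" if "x \<in> C - {low_end, high_end}" for x
    using compactified_cases[of x] that C(1) D(1) by (auto simp: inv_def)
  show ?thesis
  proof (rule that)
    show "inv ` (C - {low_end, high_end}) \<subseteq> branch"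
      using pos by blast
    have "continuous_on (C - {low_end, high_end}) inv"
      unfolding inv_def using pos by (intro continuous_intros) fastforce
    then show "connected (inv ` (C - {low_end, high_end}))"
      by (rule connected_continuous_image[OF _ C(5)])
    fix c assume c: "0 < c" "c < R - \<delta>"
    have "continuous_on C (\<lambda>x. apply_bcontfun (snd x) \<delta>)"
      unfolding continuous_on_def
      by (intro ballI tendsto_uniform_limitI[OF tendsto_bcontfun_uniform_limit[OF tendsto_snd[OF tendsto_ident_at]]]) auto
    then have "connected ((\<lambda>x. apply_bcontfun (snd x) \<delta>) ` C)"
      using C(2) by (rule connected_continuous_image)
    then have "{0..R - \<delta>} \<subseteq> (\<lambda>x. apply_bcontfun (snd x) \<delta>) ` C"
      by (rule connected_contains_Icc) (use C(3,4) low0 highR in \<open>metis imageI\<close>)+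
    then have "c \<in> (\<lambda>x. apply_bcontfun (snd x) \<delta>) ` C"
      using c by auto
    then obtain x where x: "x \<in> C" "apply_bcontfun (snd x) \<delta> = c"
      by blast
    then have "x \<in> C - {low_end, high_end}"
      using low0 highR c by auto
    then show "\<exists>l v. (l, v) \<in> inv ` (C - {low_end, high_end}) \<and> apply_bcontfun v \<delta> = c"
      using x(2) by (intro exI[of _ "fst (inv x)"] exI[of _ "snd (inv x)"]) (auto simp: inv_def)
  qed
qed

section \<open>From uniform convergence to the topology of the solution space\<close>

lemma branch_parameter_pos: "(l, v) \<in> branch \<Longrightarrow> 0 < l"
  using branchD(1,4,6)[of l v] by (cases "l = 0") auto

text \<open>On the compact set of solutions with parameter at most \<open>K\<close> the norm attains its
  maximum, which is less than \<open>R - \<delta>\<close>.\<close>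

lemma branch_parameter_large:
  obtains s\<^sub>1 where "s\<^sub>1 < R - \<delta>" "\<And>l v. (l, v) \<in> branch \<Longrightarrow> s\<^sub>1 < apply_bcontfun v \<delta> \<Longrightarrow> K < l"
proof (cases "branch \<inter> {..K} \<times> UNIV = {}")
  case True
  then show ?thesis using delta_less_R by (intro that[of 0]) (auto simp: not_le)
next
  case False
  have "continuous_on (branch \<inter> {..K} \<times> UNIV) (\<lambda>x. apply_bcontfun (snd x) \<delta>)"
    unfolding continuous_on_def
    by (intro ballI tendsto_uniform_limitI[OF tendsto_bcontfun_uniform_limit[OF tendsto_snd[OF tendsto_ident_at]]]) auto
  then obtain x where x: "x \<in> branch \<inter> {..K} \<times> UNIV"
    "\<And>y. y \<in> branch \<inter> {..K} \<times> UNIV \<Longrightarrow> apply_bcontfun (snd y) \<delta> \<le> apply_bcontfun (snd x) \<delta>"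
    using continuous_attains_sup[OF compact_branch_bounded False] by blast
  show ?thesis
  proof (rule that)
    show "apply_bcontfun (snd x) \<delta> < R - \<delta>"
      using x(1) branchD(7)[of "fst x" "snd x"] by simp
    show "K < l" if "(l, v) \<in> branch" "apply_bcontfun (snd x) \<delta> < apply_bcontfun v \<delta>" for l v
      using x(2)[of "(l, v)"] that by (auto simp: not_le[symmetric])
  qed
qed

text \<open>Near \<open>R\<close> the slope is bounded below by a positive constant \<open>c\<close>;
  further to the left monotonicity suffices, at the price of a factor 2.\<close>

lemma branch_above_line:
  fixes v :: "real \<Rightarrow>\<^sub>C real"
  assumes v: "(l, v) \<in> branch"
  obtains c where "0 < c" "\<And>t. t \<in> {\<delta>..R} \<Longrightarrow> c * (R - t) \<le> v t"
proof -
  define a where "a = v \<delta>"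
  define g where "g = (\<lambda>s. F s (v s))"
  have cg: "continuous_on {\<delta>..R} g" unfolding g_def by (intro cont_F) auto
  have a: "0 < a" "a < R - \<delta>" using branchD(4,7)[OF v] by (auto simp: a_def)
  obtain m where m: "0 < m" "\<And>t s. t \<in> {\<delta>..R} \<Longrightarrow> a / 2 \<le> s \<Longrightarrow> m \<le> F t s"
    using F_lower[of "a / 2"] a by auto
  define \<sigma> where "\<sigma> = a / 2"
  define \<kappa> where "\<kappa> = m * (\<sigma> / 2) ^ N / R ^ (N - 1)"
  define c where "c = psi (l * \<kappa>)"
  have \<sigma>: "0 < \<sigma>" "\<sigma> \<le> (R - \<delta>) / 2" using a by (auto simp: \<sigma>_def)
  have "0 < \<kappa>" using m \<sigma> delta_less_R delta_nonneg by (auto simp: \<kappa>_def)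
  then have c: "0 < c"
    using psi_strict_mono[of 0 "l * \<kappa>"] branch_parameter_pos[OF v] by (simp add: c_def)
  have slope: "c \<le> slope l g s" if s: "s \<in> {\<delta> + \<sigma>..R}" for s
  proof -
    have "\<kappa> \<le> avg g s"
      unfolding \<kappa>_def
    proof (rule avg_lower[OF cg])
      fix t assume t: "t \<in> {\<delta>..\<delta> + \<sigma>}"
      show "m \<le> g t"
        unfolding g_def using branch_lipschitz[OF v, of t \<delta>] t s
        by (intro m(2)) (auto simp: a_def \<sigma>_def)
    qed (use m \<sigma> s in \<open>auto simp: g_def F_nonneg\<close>)
    then show ?thesis
      unfolding slope_def c_def using branch_parameter_pos[OF v] by (intro psi_mono mult_left_mono) auto
  qed
  have far: "c * (R - t) \<le> v t" if t: "t \<in> {\<delta> + \<sigma>..R}" for t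
  proof -
    have "c * (R - t) = integral {t..R} (\<lambda>s. c)"
      using t by simp
    also have "\<dots> \<le> integral {t..R} (slope l g)"
      using t \<sigma> slope cg by (intro integral_le slope_integrable) auto
    also have "\<dots> = fall l g R - fall l g t"
      using t \<sigma> cg by (intro fall_diff[symmetric]) auto
    also have "\<dots> = v t"
      using branchD(2)[OF v, of t] branchD(6)[OF v] t \<sigma> by (simp add: g_def)
    finally show ?thesis .
  qed
  show ?thesis
  proof (rule that[of "c / 2"])
    show "0 < c / 2" using c by simp
    fix t assume t: "t \<in> {\<delta>..R}"
    show "c / 2 * (R - t) \<le> v t"
    proof (cases "\<delta> + \<sigma> \<le> t")
      case True
      have "c / 2 * (R - t) \<le> c * (R - t)"
        using c t by (intro mult_right_mono) auto
      then show ?thesis using far[of t] True t by simp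
    next
      case False
      have "c / 2 * (R - t) \<le> c / 2 * (2 * (R - (\<delta> + \<sigma>)))"
        using c t \<sigma> by (intro mult_left_mono) auto
      also have "\<dots> = c * (R - (\<delta> + \<sigma>))"
        by (simp add: field_simps)
      also have "\<dots> \<le> v (\<delta> + \<sigma>)"
        using far[of "\<delta> + \<sigma>"] \<sigma> by simp
      also have "\<dots> \<le> v t"
        using False t \<sigma> by (intro branch_antimono[OF v]) auto
      finally show ?thesis .
    qed
  qed
qed

text \<open>Markov's inequality for the nonnegative function \<open>1 + u'\<close>, whose integral is
  \<open>R - \<delta> - u(\<delta>)\<close>.\<close>

lemma measure_derivative_far_from_minus_1:
  fixes v :: "real \<Rightarrow>\<^sub>C real"
  assumes v: "(l, v) \<in> branch" and u: "\<And>t. t \<in> {\<delta>..R} \<Longrightarrow> u t = v t" and n: "0 < n"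
  shows "measure lebesgue {r \<in> {\<delta>..R}. 1 / n < \<bar>deriv_on \<delta> R u r - (- 1)\<bar>} \<le> n * (R - \<delta> - v \<delta>)"
proof -
  define g where "g = (\<lambda>s. F s (v s))"
  have cg: "continuous_on {\<delta>..R} g" unfolding g_def by (intro cont_F) auto
  define S where "S = {r \<in> {\<delta>..R}. 1 / n < 1 - slope l g r}"
  have "{r \<in> {\<delta>..R}. 1 / n < \<bar>deriv_on \<delta> R u r - (- 1)\<bar>} = S"
    using branch_C1(2)[OF v u] abs_slope_less_1[of l g] unfolding S_def g_def
    by (auto simp: abs_if not_less) (smt (verit, best))+
  moreover have "measure lebesgue S \<le> n * (R - \<delta> - v \<delta>)"
  proof -
    have "closed {r \<in> {\<delta>..R}. 1 - slope l g r \<le> 1 / n}"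
      by (intro continuous_on_closed_Collect_le continuous_intros cont_slope cg)
    then have "compact {r \<in> {\<delta>..R}. 1 - slope l g r \<le> 1 / n}"
      by (auto simp: compact_eq_bounded_closed intro: bounded_subset[of "{\<delta>..R}"])
    then have "{\<delta>..R} - {r \<in> {\<delta>..R}. 1 - slope l g r \<le> 1 / n} \<in> lmeasurable"
      by (intro fmeasurable.Diff lmeasurable_compact compact_Icc)
    also have "{\<delta>..R} - {r \<in> {\<delta>..R}. 1 - slope l g r \<le> 1 / n} = S"
      by (auto simp: S_def)
    finally have S: "S \<in> lmeasurable" .
    have S_Int: "S \<inter> {\<delta>..R} = S"
      unfolding S_def by blast
    have "measure lebesgue S = integral {\<delta>..R} (indicator S)"
      using Equivalence_Lebesgue_Henstock_Integration.integral_indicator[of S "{\<delta>..R}"] S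
      unfolding S_Int by simp
    also have "\<dots> \<le> integral {\<delta>..R} (\<lambda>r. n * (1 - slope l g r))"
    proof (rule integral_le)
      show "(indicator S :: real \<Rightarrow> real) integrable_on {\<delta>..R}"
        using S unfolding integrable_on_indicator S_Int .
      show "(\<lambda>r. n * (1 - slope l g r)) integrable_on {\<delta>..R}"
        by (intro integrable_continuous_real continuous_intros cont_slope cg)
      show "indicator S r \<le> n * (1 - slope l g r)" if "r \<in> {\<delta>..R}" for r
        using abs_slope_less_1[of l g r] n by (auto simp: S_def indicator_def field_simps)
    qed
    also have "\<dots> = n * (integral {\<delta>..R} (\<lambda>r. 1) - integral {\<delta>..R} (slope l g))"
      using cg by (subst integral_mult_right, subst integral_diff) (auto intro!: slope_integrable)
    also have "\<dots> = n * (R - \<delta> - v \<delta>)"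
      using branchD(6)[OF v] delta_less_R by (simp add: g_def fall_def)
    finally show ?thesis .
  qed
  ultimately show ?thesis by simp
qed


definition restrict_pair :: "real \<times> (real \<Rightarrow>\<^sub>C real) \<Rightarrow> real \<times> (real \<Rightarrow> real)" where
  "restrict_pair x = (fst x, restrict (apply_bcontfun (snd x)) {\<delta>..R})"

definition extend_pair :: "real \<times> (real \<Rightarrow> real) \<Rightarrow> real \<times> (real \<Rightarrow>\<^sub>C real)" where
  "extend_pair x = (fst x, ext (snd x))"

sublocale E: Metric_space "E_space \<delta> R" "E_dist \<delta> R"
  by (rule Metric_space_E[OF delta_less_R])

lemma E_topology_eq: "E_topology \<delta> R = E.mtopology"
  by (simp add: E_topology_def)

lemma E_space_cont: "u \<in> E_space \<delta> R \<Longrightarrow> continuous_on {\<delta>..R} u"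
  by (auto simp: E_space_def C1_space_def C1_on_def differentiable_imp_continuous_on)

lemma E_space_diff:
  assumes "u \<in> E_space \<delta> R" "w \<in> E_space \<delta> R"
  shows "C1_on \<delta> R (\<lambda>t. u t - w t)"
    and "E_dist \<delta> R u w = norm_C \<delta> R (\<lambda>t. u t - w t) + norm_C \<delta> R (deriv_on \<delta> R (\<lambda>t. u t - w t))"
    and "0 \<le> norm_C \<delta> R (\<lambda>t. u t - w t)" "0 \<le> norm_C \<delta> R (deriv_on \<delta> R (\<lambda>t. u t - w t))"
proof -
  show 1: "C1_on \<delta> R (\<lambda>t. u t - w t)"
    using assms by (intro C1_on_diff delta_less_R) (auto simp: E_space_def C1_space_def)
  show "E_dist \<delta> R u w = norm_C \<delta> R (\<lambda>t. u t - w t) + norm_C \<delta> R (deriv_on \<delta> R (\<lambda>t. u t - w t))"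
    using assms by (simp add: E_dist_def norm_C1_def)
  show "0 \<le> norm_C \<delta> R (\<lambda>t. u t - w t)" "0 \<le> norm_C \<delta> R (deriv_on \<delta> R (\<lambda>t. u t - w t))"
    using 1 by (auto intro!: norm_C_nonneg delta_less_R simp: C1_on_def differentiable_imp_continuous_on)
qed

lemma dist_ext_le_E_dist:
  assumes "u \<in> E_space \<delta> R" "w \<in> E_space \<delta> R"
  shows "dist (ext u) (ext w) \<le> E_dist \<delta> R u w"
proof (rule dist_bound)
  fix t
  have "\<bar>u (nearest t) - w (nearest t)\<bar> \<le> norm_C \<delta> R (\<lambda>t. u t - w t)"
    using abs_le_norm_C[of \<delta> R "\<lambda>t. u t - w t" "nearest t"] E_space_cont assms
    by (auto intro: continuous_on_diff)
  then show "dist (ext u t) (ext w t) \<le> E_dist \<delta> R u w"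
    using E_space_diff[OF assms] E_space_cont assms by (simp add: dist_real_def)
qed

lemma continuous_map_extend_pair:
  "continuous_map (prod_topology euclideanreal (E_topology \<delta> R)) euclidean extend_pair"
proof -
  have "continuous_map E.mtopology euclidean ext"
    unfolding E.continuous_map_from_metric
  proof (intro conjI ballI allI impI)
    fix a U assume a: "a \<in> E_space \<delta> R" and "openin euclidean U \<and> ext a \<in> U"
    then obtain e where "0 < e" "ball (ext a) e \<subseteq> U"
      by (metis open_openin openE)
    then show "\<exists>r>0. \<forall>x. x \<in> E_space \<delta> R \<and> E_dist \<delta> R a x < r \<longrightarrow> ext x \<in> U"
      using dist_ext_le_E_dist[OF a] by (intro exI[of _ e]) (force simp: subset_iff)
  qed auto
  then have "continuous_map (prod_topology euclideanreal E.mtopology) euclidean (ext \<circ> snd)"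
    by (rule continuous_map_compose[OF continuous_map_snd])
  then have "continuous_map (prod_topology euclideanreal E.mtopology) (prod_topology euclidean euclidean)
      (\<lambda>x. (fst x, (ext \<circ> snd) x))"
    by (intro continuous_map_pairedI continuous_map_fst)
  moreover have "extend_pair = (\<lambda>x. (fst x, (ext \<circ> snd) x))"
    by (auto simp: extend_pair_def)
  ultimately show ?thesis
    by (simp add: E_topology_eq euclidean_product_topology)
qed

lemma restrict_extend_pair:
  assumes "snd x \<in> extensional {\<delta>..R}" "continuous_on {\<delta>..R} (snd x)"
  shows "restrict_pair (extend_pair x) = x"
  using assms by (auto simp: restrict_pair_def extend_pair_def prod_eq_iff fun_eq_iff extensional_def)

lemma extend_restrict_pair: "x \<in> branch \<Longrightarrow> extend_pair (restrict_pair x) = x"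
proof -
  assume x: "x \<in> branch"
  have "ext (restrict (apply_bcontfun (snd x)) {\<delta>..R}) = snd x"
  proof (rule bcontfun_eqI)
    fix t
    have "continuous_on {\<delta>..R} (restrict (apply_bcontfun (snd x)) {\<delta>..R})"
      by (rule continuous_on_eq[of _ "apply_bcontfun (snd x)"]) auto
    then show "ext (restrict (apply_bcontfun (snd x)) {\<delta>..R}) t = snd x t"
      using branchD(5)[of "fst x" "snd x" t] x by simp
  qed
  then show ?thesis by (simp add: extend_pair_def restrict_pair_def)
qed

lemma restrict_pair_in_E: "x \<in> branch \<Longrightarrow> snd (restrict_pair x) \<in> E_space \<delta> R"
  using branch_imp_solution[of "fst x" "snd x"] by (auto simp: solution_def E_space_def restrict_pair_def)

lemma nontrivial_solutions_eq:
  "{(\<mu>, u). 0 \<le> \<mu> \<and> solution N \<delta> R \<alpha> f \<mu> u \<and> (\<exists>t\<in>{\<delta>..R}. u t \<noteq> 0)} = restrict_pair ` branch"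
proof (intro set_eqI iffI)
  fix x assume x: "x \<in> {(\<mu>, u). 0 \<le> \<mu> \<and> solution N \<delta> R \<alpha> f \<mu> u \<and> (\<exists>t\<in>{\<delta>..R}. u t \<noteq> 0)}"
  then have "extend_pair x \<in> branch"
    using solution_imp_branch[of "fst x" "snd x"] by (simp add: extend_pair_def case_prod_unfold)
  moreover have "restrict_pair (extend_pair x) = x"
    using x by (intro restrict_extend_pair)
      (auto simp: solution_def C1_space_def C1_on_def differentiable_imp_continuous_on)
  ultimately show "x \<in> restrict_pair ` branch" by (metis imageI)
next
  fix x assume "x \<in> restrict_pair ` branch"
  then obtain l v where lv: "(l, v) \<in> branch" "x = restrict_pair (l, v)"
    by auto
  then show "x \<in> {(\<mu>, u). 0 \<le> \<mu> \<and> solution N \<delta> R \<alpha> f \<mu> u \<and> (\<exists>t\<in>{\<delta>..R}. u t \<noteq> 0)}"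
    using branch_imp_solution[OF lv(1)] branchD(1,4)[OF lv(1)] delta_less_R
    by (auto simp: restrict_pair_def intro!: bexI[of _ \<delta>])
qed

text \<open>The set of nontrivial solutions is already closed: it is the preimage of the closed set
  \<open>branch\<close> under the continuous inclusion of \<open>\<real> \<times>
  E\<^sub>\<delta>\<close> into \<open>\<real> \<times> C[\<delta>, R]\<close>.\<close>

lemma Sigma_set_eq: "Sigma_set N \<delta> R \<alpha> f = restrict_pair ` branch"
proof -
  let ?T = "prod_topology euclideanreal (E_topology \<delta> R)"
  have sub: "restrict_pair ` branch \<subseteq> topspace ?T"
    using restrict_pair_in_E by (simp add: E_topology_eq image_subset_iff mem_Times_iff)
  have "restrict_pair ` branch = {x \<in> topspace ?T. extend_pair x \<in> branch}"
  proof (intro set_eqI iffI)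
    fix x assume "x \<in> restrict_pair ` branch"
    then show "x \<in> {x \<in> topspace ?T. extend_pair x \<in> branch}"
      using sub extend_restrict_pair by auto
  next
    fix x assume x: "x \<in> {x \<in> topspace ?T. extend_pair x \<in> branch}"
    then have "snd x \<in> E_space \<delta> R" by (auto simp: E_topology_eq)
    then have "restrict_pair (extend_pair x) = x"
      using E_space_cont by (intro restrict_extend_pair) (auto simp: E_space_def C1_space_def)
    then show "x \<in> restrict_pair ` branch"
      using x by (metis (mono_tags, lifting) imageI mem_Collect_eq)
  qed
  moreover have "closedin ?T {x \<in> topspace ?T. extend_pair x \<in> branch}"
    using closed_branch by (intro closedin_continuous_map_preimage[OF continuous_map_extend_pair]) simp
  ultimately have "closedin ?T (restrict_pair ` branch)" by simp
  then show ?thesis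
    unfolding Sigma_set_def nontrivial_solutions_eq by (rule closure_of_closedin)
qed

text \<open>On the solution set uniform convergence implies convergence in \<open>C\<^sup>1\<close>,
  because by the integral equation the derivative depends continuously on \<open>(l,
  u)\<close> in the uniform norm.\<close>

lemma continuous_map_restrict_pair:
  "continuous_map (top_of_set branch) (prod_topology euclideanreal (E_topology \<delta> R)) restrict_pair"
proof -
  have "continuous_map (top_of_set branch) E.mtopology (\<lambda>x. snd (restrict_pair x))"
    unfolding E.continuous_map_to_metric
  proof (intro ballI allI impI)
    fix x e assume "x \<in> topspace (top_of_set branch)" and e: "0 < (e::real)"
    then have x: "x \<in> branch" by simp
    define G where "G = at x within branch"
    have l: "(fst \<longlongrightarrow> fst x) G" and s: "(snd \<longlongrightarrow> snd x) G"
      unfolding G_def by (intro tendsto_fst tendsto_snd tendsto_ident_at)+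
    have ul: "uniform_limit {\<delta>..R} (\<lambda>y. apply_bcontfun (snd y)) (apply_bcontfun (snd x)) G"
      using tendsto_bcontfun_uniform_limit[OF s] by (rule uniform_limit_on_subset) auto
    have us: "uniform_limit {\<delta>..R} (\<lambda>y. slope (fst y) (\<lambda>s. F s (apply_bcontfun (snd y) s)))
        (slope (fst x) (\<lambda>s. F s (apply_bcontfun (snd x) s))) G"
      by (rule uniform_limit_fall_F(2)[OF l ul]) auto
    have near: "E_dist \<delta> R (snd (restrict_pair x)) (snd (restrict_pair y)) < e"
      if y: "y \<in> branch" and d: "dist (snd y) (snd x) < e / 3"
        and sl: "\<forall>r\<in>{\<delta>..R}. dist (slope (fst y) (\<lambda>s. F s (apply_bcontfun (snd y) s)) r)
          (slope (fst x) (\<lambda>s. F s (apply_bcontfun (snd x) s)) r) < e / 3" for y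
    proof -
      define u where "u = snd (restrict_pair x)"
      define w where "w = snd (restrict_pair y)"
      have uw: "u t = snd x t" "w t = snd y t" if "t \<in> {\<delta>..R}" for t
        using that by (simp_all add: u_def w_def restrict_pair_def)
      have E: "u \<in> E_space \<delta> R" "w \<in> E_space \<delta> R"
        using restrict_pair_in_E x y by (simp_all add: u_def w_def)
      have "norm_C \<delta> R (\<lambda>t. u t - w t) \<le> e / 3"
        unfolding norm_C_def
      proof (rule cSUP_least)
        fix t assume "t \<in> {\<delta>..R}"
        then show "\<bar>u t - w t\<bar> \<le> e / 3"
          using dist_fun_lt_imp_dist_val_lt[OF d, of t] uw by (simp add: dist_real_def abs_minus_commute)
      qed (use delta_less_R in auto)
      moreover have "norm_C \<delta> R (deriv_on \<delta> R (\<lambda>t. u t - w t)) \<le> e / 3"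
        unfolding norm_C_def
      proof (rule cSUP_least)
        fix t assume t: "t \<in> {\<delta>..R}"
        have "deriv_on \<delta> R (\<lambda>t. u t - w t) t = deriv_on \<delta> R u t - deriv_on \<delta> R w t"
          using E t by (intro deriv_on_diff delta_less_R) (auto simp: E_space_def C1_space_def)
        moreover have "deriv_on \<delta> R u t = - slope (fst x) (\<lambda>s. F s (apply_bcontfun (snd x) s)) t"
          using branch_C1(2)[of "fst x" "snd x" u t] x uw t by simp
        moreover have "deriv_on \<delta> R w t = - slope (fst y) (\<lambda>s. F s (apply_bcontfun (snd y) s)) t"
          using branch_C1(2)[of "fst y" "snd y" w t] y uw t by simp
        ultimately show "\<bar>deriv_on \<delta> R (\<lambda>t. u t - w t) t\<bar> \<le> e / 3"
          using sl t by (auto simp: dist_real_def intro!: less_imp_le)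
      qed (use delta_less_R in auto)
      ultimately show ?thesis
        using E_space_diff(2)[OF E] e unfolding u_def w_def by linarith
    qed
    have "\<forall>\<^sub>F y in G. y \<in> branch"
      unfolding G_def by (simp add: eventually_at_filter)
    moreover have "\<forall>\<^sub>F y in G. dist (snd y) (snd x) < e / 3"
      by (rule tendstoD[OF s]) (use e in simp)
    moreover have "\<forall>\<^sub>F y in G. \<forall>r\<in>{\<delta>..R}. dist (slope (fst y) (\<lambda>s. F s (apply_bcontfun (snd y) s)) r)
          (slope (fst x) (\<lambda>s. F s (apply_bcontfun (snd x) s)) r) < e / 3"
      by (rule uniform_limitD[OF us]) (use e in simp)
    ultimately have "\<forall>\<^sub>F y in G. E_dist \<delta> R (snd (restrict_pair x)) (snd (restrict_pair y)) < e"
      by eventually_elim (rule near)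
    then obtain U where U: "open U" "x \<in> U"
      "\<And>y. y \<in> U \<Longrightarrow> y \<noteq> x \<Longrightarrow> y \<in> branch \<Longrightarrow> E_dist \<delta> R (snd (restrict_pair x)) (snd (restrict_pair y)) < e"
      unfolding G_def eventually_at_topological by blast
    have "snd (restrict_pair y) \<in> E.mball (snd (restrict_pair x)) e" if "y \<in> branch \<inter> U" for y
      using U(3)[of y] that restrict_pair_in_E x e by (cases "y = x") (auto simp: E.in_mball)
    then show "\<exists>U. openin (top_of_set branch) U \<and> x \<in> U \<and> (\<forall>y\<in>U. snd (restrict_pair y) \<in> E.mball (snd (restrict_pair x)) e)"
      using U x by (intro exI[of _ "branch \<inter> U"]) (auto simp: openin_open_Int)
  qed
  moreover have "continuous_map (top_of_set branch) euclideanreal (\<lambda>x. fst (restrict_pair x))"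
    by (auto simp: restrict_pair_def intro: continuous_on_fst)
  ultimately have "continuous_map (top_of_set branch) (prod_topology euclideanreal E.mtopology)
      (\<lambda>x. (fst (restrict_pair x), snd (restrict_pair x)))"
    by (intro continuous_map_pairedI)
  then show ?thesis by (simp add: E_topology_eq)
qed

lemma homeomorphic_map_restrict_pair:
  "homeomorphic_map (top_of_set branch)
     (subtopology (prod_topology euclideanreal (E_topology \<delta> R)) (Sigma_set N \<delta> R \<alpha> f)) restrict_pair"
  unfolding homeomorphic_map_maps homeomorphic_maps_def
proof (intro exI[of _ extend_pair] conjI ballI)
  show "continuous_map (top_of_set branch)
     (subtopology (prod_topology euclideanreal (E_topology \<delta> R)) (Sigma_set N \<delta> R \<alpha> f)) restrict_pair"
    using continuous_map_restrict_pair by (auto simp: continuous_map_in_subtopology Sigma_set_eq)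
  show "continuous_map (subtopology (prod_topology euclideanreal (E_topology \<delta> R)) (Sigma_set N \<delta> R \<alpha> f))
     (top_of_set branch) extend_pair"
    using continuous_map_from_subtopology[OF continuous_map_extend_pair] extend_restrict_pair
    by (auto simp: continuous_map_in_subtopology Sigma_set_eq)
qed (auto simp: Sigma_set_eq extend_restrict_pair)

text \<open>If \<open>c (R - t) \<le> u(t)\<close> and \<open>w\<close> is closer than \<open>c\<close>
  to \<open>u\<close> in \<open>C\<^sup>1\<close>, then \<open>|u(t) - w(t)| \<le> c (R -
  t)\<close> because both functions vanish at \<open>R\<close>; hence \<open>w\<close> is
  nonnegative.\<close>

lemma branch_in_interior_P:
  assumes x: "x \<in> branch"
  shows "snd (restrict_pair x) \<in> E_topology \<delta> R interior_of P_cone \<delta> R"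
proof -
  define u where "u = snd (restrict_pair x)"
  have u: "u t = snd x t" if "t \<in> {\<delta>..R}" for t
    using that by (simp add: u_def restrict_pair_def)
  have uE: "u \<in> E_space \<delta> R" using restrict_pair_in_E[OF x] by (simp add: u_def)
  obtain c where c: "0 < c" "\<And>t. t \<in> {\<delta>..R} \<Longrightarrow> c * (R - t) \<le> snd x t"
    using branch_above_line[of "fst x" "snd x"] x by auto
  have "E.mball u c \<subseteq> P_cone \<delta> R"
  proof
    fix w assume "w \<in> E.mball u c"
    then have wE: "w \<in> E_space \<delta> R" and d: "E_dist \<delta> R u w < c"
      by (auto simp: E.in_mball)
    note D = E_space_diff[OF uE wE]
    have "0 \<le> w t" if t: "t \<in> {\<delta>..R}" for t
    proof -
      have "norm ((u R - w R) - (u t - w t)) \<le> c * norm (R - t)"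
      proof (rule field_differentiable_bound[of "{\<delta>..R}"])
        fix s assume s: "s \<in> {\<delta>..R}"
        show "((\<lambda>t. u t - w t) has_field_derivative deriv_on \<delta> R (\<lambda>t. u t - w t) s) (at s within {\<delta>..R})"
          using has_deriv_on[OF D(1) s] by (simp add: has_real_derivative_iff_has_vector_derivative)
        have "\<bar>deriv_on \<delta> R (\<lambda>t. u t - w t) s\<bar> \<le> norm_C \<delta> R (deriv_on \<delta> R (\<lambda>t. u t - w t))"
          using D(1) s by (intro abs_le_norm_C) (auto simp: C1_on_def)
        then show "norm (deriv_on \<delta> R (\<lambda>t. u t - w t) s) \<le> c"
          using D(2,3) d by simp
      qed (use t delta_less_R in auto)
      moreover have "u R = 0" "w R = 0"
        using uE wE by (auto simp: E_space_def)
      ultimately have "\<bar>u t - w t\<bar> \<le> c * (R - t)"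
        using t by (simp add: abs_minus_commute)
      then show ?thesis using c(2)[OF t] u[OF t] by linarith
    qed
    then show "w \<in> P_cone \<delta> R"
      using wE by (simp add: P_cone_def)
  qed
  then show ?thesis
    using uE c(1) unfolding interior_of_def E_topology_eq u_def[symmetric]
    by (intro CollectI exI[of _ "E.mball u c"]) auto
qed

lemma norm_C_restrict_pair: "x \<in> branch \<Longrightarrow> norm_C \<delta> R (snd (restrict_pair x)) = apply_bcontfun (snd x) \<delta>"
  using norm_C_branch[of "fst x" "snd x" "snd (restrict_pair x)"] by (simp add: restrict_pair_def)

lemma eventually_branch_at_infinityI:
  assumes "\<And>x. x \<in> \<zeta> \<Longrightarrow> \<Lambda> \<le> fst x \<Longrightarrow> \<rho> \<le> norm_C \<delta> R (snd x) \<Longrightarrow> P x"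
  shows "eventually P (branch_at_infinity \<delta> R \<zeta> \<rho>)"
  unfolding branch_at_infinity_def eventually_inf_principal
  using assms by (auto simp: eventually_filtercomap_at_top_linorder intro!: exI[of _ \<Lambda>])

end

section \<open>The unbounded component\<close>

theorem theorem1p3:
  fixes N :: nat and \<delta> R \<alpha> :: real and f :: "real \<Rightarrow> real \<Rightarrow> real"
  assumes "2 \<le> N" and "0 < R" and "0 \<le> \<delta>" and "\<delta> < R" and "R < \<alpha>"
    and "continuous_on ({\<delta>..R} \<times> {0..<\<alpha>}) (\<lambda>(r, s). f r s)"
    and "\<And>r s. r \<in> {\<delta>..R} \<Longrightarrow> s \<in> {0..<\<alpha>} \<Longrightarrow> 0 \<le> f r s"
    and "\<And>r s. r \<in> {\<delta>..R} \<Longrightarrow> s \<in> {0<..<\<alpha>} \<Longrightarrow> 0 < f r s"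
    and "uniform_limit {\<delta>..R} (\<lambda>s r. f r s / s) (\<lambda>r. 0) (at_right 0)"
  shows "\<exists>\<zeta> \<in> connected_components_of
                (subtopology (prod_topology euclideanreal (E_topology \<delta> R)) (Sigma_set N \<delta> R \<alpha> f)).
    \<zeta> \<subseteq> {0<..} \<times> (E_topology \<delta> R interior_of P_cone \<delta> R) \<and>
    (reaches_infinity_at \<delta> R \<zeta> 0 \<and> reaches_infinity_at \<delta> R \<zeta> (R - \<delta>)) \<and>
    (\<exists>\<Lambda> \<rho>\<^sub>0. 0 < \<Lambda> \<and> \<rho>\<^sub>0 \<in> {0<..<R - \<delta>} \<and>
      \<zeta> \<inter> {(\<mu>, v) \<in> Sigma_set N \<delta> R \<alpha> f. \<Lambda> \<le> \<mu> \<and> norm_C \<delta> R v = \<rho>\<^sub>0} = {} \<and>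
      (\<forall>n::nat. 1 \<le> n \<longrightarrow>
        ((\<lambda>(\<mu>, u). measure lebesgue {r \<in> {\<delta>..R}. \<bar>deriv_on \<delta> R u r - (- 1)\<bar> > 1 / real n})
          \<longlongrightarrow> 0) (branch_at_infinity \<delta> R \<zeta> \<rho>\<^sub>0)) \<and>
      ((\<lambda>(\<mu>, u). norm_C \<delta> R u) \<longlongrightarrow> R - \<delta>) (branch_at_infinity \<delta> R \<zeta> \<rho>\<^sub>0)) \<and>
    (\<exists>\<mu>\<^sub>0. fst ` \<zeta> = {\<mu>\<^sub>0..} \<and> {\<mu>\<^sub>0..} \<subseteq> {0<..})"
proof -
  interpret minkowski_bvp N \<delta> R \<alpha> f
    by unfold_locales (fact assms)+
  obtain Z where Z: "Z \<subseteq> branch" "connected Z"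
    "\<And>c. 0 < c \<Longrightarrow> c < R - \<delta> \<Longrightarrow> \<exists>l v. (l, v) \<in> Z \<and> apply_bcontfun v \<delta> = c"
    by (rule spanning_connected_subset; rule that)
  obtain z where z: "z \<in> Z"
    using Z(3)[of "(R - \<delta>) / 2"] delta_less_R by auto
  define C where "C = connected_component_set branch z"
  define \<zeta> where "\<zeta> = restrict_pair ` C"
  have C_sub: "C \<subseteq> branch" unfolding C_def by (rule connected_component_subset)
  have ZC: "Z \<subseteq> C" unfolding C_def using z Z(1,2) by (intro connected_component_maximal)
  have C_conn: "connected C" unfolding C_def by simp
  have C_closed: "closed C" unfolding C_def by (intro closed_connected_component closed_branch)
  have C_comp: "C \<in> connected_components_of (top_of_set branch)"
  proof -
    have "connected_component_of (top_of_set branch) z = connected_component branch z"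
      by (auto simp: fun_eq_iff connected_component_of_def connectedin_subtopology connected_component_def)
    then show ?thesis
      unfolding connected_components_of_def C_def using z Z(1) by (intro image_eqI[of _ _ z]) auto
  qed
  have mem: "\<exists>v. x = restrict_pair (fst x, v) \<and> (fst x, v) \<in> C \<and> (fst x, v) \<in> branch \<and> norm_C \<delta> R (snd x) = apply_bcontfun v \<delta>
      \<and> (\<forall>t\<in>{\<delta>..R}. snd x t = apply_bcontfun v t)"
    if "x \<in> \<zeta>" for x
  proof -
    obtain y where y: "y \<in> C" "x = restrict_pair y" using \<open>x \<in> \<zeta>\<close> by (auto simp: \<zeta>_def)
    then show ?thesis
      using C_sub norm_C_restrict_pair[of y] by (intro exI[of _ "snd y"]) (auto simp: restrict_pair_def)
  qed
  have level: "\<exists>x\<in>\<zeta>. norm_C \<delta> R (snd x) = c" if c: "0 < c" "c < R - \<delta>" for c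
  proof -
    obtain l v where lv: "(l, v) \<in> Z" "apply_bcontfun v \<delta> = c"
      using Z(3)[OF c] by auto
    then show ?thesis
      using ZC Z(1) norm_C_restrict_pair[of "(l, v)"] unfolding \<zeta>_def by (intro bexI[of _ "restrict_pair (l, v)"]) auto
  qed
  have large: "\<exists>\<epsilon>>0. \<forall>x\<in>\<zeta>. norm_C \<delta> R (snd x) < \<epsilon> \<or> R - \<delta> - \<epsilon> < norm_C \<delta> R (snd x) \<longrightarrow> K < fst x" for K
  proof -
    obtain s\<^sub>0 where s0: "0 < s\<^sub>0" "\<And>l v. (l, v) \<in> branch \<Longrightarrow> apply_bcontfun v \<delta> < s\<^sub>0 \<Longrightarrow> K < l"
      using branch_small_norm by blast
    obtain s\<^sub>1 where s1: "s\<^sub>1 < R - \<delta>" "\<And>l v. (l, v) \<in> branch \<Longrightarrow> s\<^sub>1 < apply_bcontfun v \<delta> \<Longrightarrow> K < l"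
      using branch_parameter_large by blast
    show ?thesis
    proof (intro exI[of _ "min s\<^sub>0 (R - \<delta> - s\<^sub>1)"] conjI ballI impI)
      fix x assume "x \<in> \<zeta>" and x: "norm_C \<delta> R (snd x) < min s\<^sub>0 (R - \<delta> - s\<^sub>1) \<or>
        R - \<delta> - min s\<^sub>0 (R - \<delta> - s\<^sub>1) < norm_C \<delta> R (snd x)"
      then obtain v where v: "(fst x, v) \<in> branch" "norm_C \<delta> R (snd x) = apply_bcontfun v \<delta>"
        using mem by blast
      then show "K < fst x"
        using s0(2)[OF v(1)] s1(2)[OF v(1)] x by auto
    qed (use s0 s1 in auto)
  qed
  have reaches: "reaches_infinity_at \<delta> R \<zeta> c\<^sub>0"
    if c: "c\<^sub>0 = 0 \<or> c\<^sub>0 = R - \<delta>" for c\<^sub>0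
  proof -
    \<comment> \<open>One formula for both ends: \<open>c k\<close> lies in \<open>(0, R - \<delta>)\<close> and tends to \<open>c\<^sub>0\<close>.\<close>
    define c where "c = (\<lambda>k. \<bar>c\<^sub>0 - (R - \<delta>) / real (k + 2)\<bar>)"
    have frac: "0 < (R - \<delta>) / real (k + 2)" "(R - \<delta>) / real (k + 2) < R - \<delta>" for k
      using delta_less_R divide_strict_left_mono[of 1 "real (k + 2)" "R - \<delta>"] by simp_all
    have ck: "0 < c k" "c k < R - \<delta>" for k
      using frac[of k] c by (auto simp: c_def)
    have "(\<lambda>k. (R - \<delta>) / real (k + 2)) \<longlonglongrightarrow> 0"
      by (intro LIMSEQ_ignore_initial_segment lim_const_over_n)
    then have "c \<longlonglongrightarrow> \<bar>c\<^sub>0 - 0\<bar>"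
      unfolding c_def by (intro tendsto_intros)
    then have c_lim: "c \<longlonglongrightarrow> c\<^sub>0"
      using c delta_less_R by auto
    obtain x where x: "\<And>k. x k \<in> \<zeta>" "\<And>k. norm_C \<delta> R (snd (x k)) = c k"
      using level[OF ck] by metis
    have "filterlim (\<lambda>k. fst (x k)) at_top sequentially"
      unfolding filterlim_at_top
    proof
      fix K
      obtain \<epsilon> where \<epsilon>: "0 < \<epsilon>" "\<And>x. x \<in> \<zeta> \<Longrightarrow> norm_C \<delta> R (snd x) < \<epsilon> \<or> R - \<delta> - \<epsilon> < norm_C \<delta> R (snd x) \<Longrightarrow> K < fst x"
        using large by blast
      have "\<forall>\<^sub>F k in sequentially. dist (c k) c\<^sub>0 < \<epsilon>"
        using tendstoD[OF c_lim \<epsilon>(1)] .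
      then show "\<forall>\<^sub>F k in sequentially. K \<le> fst (x k)"
      proof eventually_elim
        case (elim k)
        then have "norm_C \<delta> R (snd (x k)) < \<epsilon> \<or> R - \<delta> - \<epsilon> < norm_C \<delta> R (snd (x k))"
          using c x(2)[of k] by (auto simp: dist_real_def)
        then show ?case using \<epsilon>(2)[OF x(1)] by (simp add: less_imp_le)
      qed
    qed
    then show ?thesis
      unfolding reaches_infinity_at_def using x c_lim
      by (intro exI[of _ "\<lambda>k. fst (x k)"] exI[of _ "\<lambda>k. snd (x k)"]) auto
  qed
  \<comment> \<open>Any level strictly between 0 and \<open>R - \<delta>\<close> serves as \<open>\<rho>\<^sub>0\<close>.\<close>
  define \<rho>\<^sub>0 where "\<rho>\<^sub>0 = (R - \<delta>) / 2"
  have \<rho>0: "0 < \<rho>\<^sub>0" "\<rho>\<^sub>0 < R - \<delta>" using delta_less_R by (auto simp: \<rho>\<^sub>0_def)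
  obtain \<Lambda> where \<Lambda>: "0 < \<Lambda>" "\<And>l v. (l, v) \<in> branch \<Longrightarrow> \<rho>\<^sub>0 \<le> apply_bcontfun v \<delta> \<Longrightarrow> apply_bcontfun v \<delta> \<le> \<rho>\<^sub>0 \<Longrightarrow> l < \<Lambda>"
    using branch_bounded_parameter[of \<rho>\<^sub>0 \<rho>\<^sub>0] \<rho>0 by auto
  have empty: "\<zeta> \<inter> {(\<mu>, v) \<in> Sigma_set N \<delta> R \<alpha> f. \<Lambda> \<le> \<mu> \<and> norm_C \<delta> R v = \<rho>\<^sub>0} = {}"
  proof -
    have False if x: "x \<in> \<zeta>" "\<Lambda> \<le> fst x" "norm_C \<delta> R (snd x) = \<rho>\<^sub>0" for x
    proof -
      obtain v where "(fst x, v) \<in> branch" "norm_C \<delta> R (snd x) = apply_bcontfun v \<delta>"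
        using mem[OF x(1)] by blast
      then show False using \<Lambda>(2)[of "fst x" v] x by simp
    qed
    then show ?thesis by fastforce
  qed
  let ?B = "branch_at_infinity \<delta> R \<zeta> \<rho>\<^sub>0"
  have norm_lim: "((\<lambda>x. norm_C \<delta> R (snd x)) \<longlongrightarrow> R - \<delta>) ?B"
  proof (rule tendstoI)
    fix e :: real assume e: "0 < e"
    define b where "b = max \<rho>\<^sub>0 (R - \<delta> - e / 2)"
    obtain L where L: "0 < L" "\<And>l v. (l, v) \<in> branch \<Longrightarrow> \<rho>\<^sub>0 \<le> apply_bcontfun v \<delta> \<Longrightarrow> apply_bcontfun v \<delta> \<le> b \<Longrightarrow> l < L"
      using branch_bounded_parameter[of \<rho>\<^sub>0 b] \<rho>0 e by (auto simp: b_def)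
    show "\<forall>\<^sub>F x in ?B. dist (norm_C \<delta> R (snd x)) (R - \<delta>) < e"
    proof (rule eventually_branch_at_infinityI[of _ L])
      fix x assume x: "x \<in> \<zeta>" "L \<le> fst x" "\<rho>\<^sub>0 \<le> norm_C \<delta> R (snd x)"
      obtain v where v: "(fst x, v) \<in> branch" "norm_C \<delta> R (snd x) = apply_bcontfun v \<delta>"
        using mem[OF x(1)] by blast
      have "b < apply_bcontfun v \<delta>"
        by (rule ccontr) (use L(2)[OF v(1)] x v(2) in simp)
      then show "dist (norm_C \<delta> R (snd x)) (R - \<delta>) < e"
        using branchD(7)[OF v(1)] v(2) e by (simp add: dist_real_def b_def)
    qed
  qed
  have meas_lim: "((\<lambda>x. measure lebesgue {r \<in> {\<delta>..R}. \<bar>deriv_on \<delta> R (snd x) r - (- 1)\<bar> > 1 / real n}) \<longlongrightarrow> 0) ?B"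
    if n: "1 \<le> n" for n :: nat
  proof (rule Lim_null_comparison)
    show "\<forall>\<^sub>F x in ?B. norm (measure lebesgue {r \<in> {\<delta>..R}. \<bar>deriv_on \<delta> R (snd x) r - (- 1)\<bar> > 1 / real n})
        \<le> real n * (R - \<delta> - norm_C \<delta> R (snd x))"
    proof (rule eventually_branch_at_infinityI[of _ 0])
      fix x assume "x \<in> \<zeta>"
      then obtain v where v: "(fst x, v) \<in> branch" "norm_C \<delta> R (snd x) = apply_bcontfun v \<delta>"
        "\<And>t. t \<in> {\<delta>..R} \<Longrightarrow> snd x t = apply_bcontfun v t"
        using mem by blast
      show "norm (measure lebesgue {r \<in> {\<delta>..R}. \<bar>deriv_on \<delta> R (snd x) r - (- 1)\<bar> > 1 / real n})
          \<le> real n * (R - \<delta> - norm_C \<delta> R (snd x))"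
        unfolding real_norm_def abs_of_nonneg[OF measure_nonneg] v(2)
        by (rule measure_derivative_far_from_minus_1[OF v(1,3)]) (use n in auto)
    qed
    have "((\<lambda>x. real n * (R - \<delta> - norm_C \<delta> R (snd x))) \<longlongrightarrow> real n * (R - \<delta> - (R - \<delta>))) ?B"
      by (intro tendsto_intros norm_lim)
    then show "((\<lambda>x. real n * (R - \<delta> - norm_C \<delta> R (snd x))) \<longlongrightarrow> 0) ?B" by simp
  qed
  have proj: "\<exists>\<mu>\<^sub>0. fst ` \<zeta> = {\<mu>\<^sub>0..} \<and> {\<mu>\<^sub>0..} \<subseteq> {0<..}"
  proof -
    have fst_eq: "fst ` \<zeta> = fst ` C"
      by (simp add: \<zeta>_def image_image restrict_pair_def)
    have zC: "z \<in> C" using z ZC by auto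
    \<comment> \<open>The least parameter is attained since \<open>C\<close> is closed and solutions with bounded parameter form a compact set.\<close>
    let ?K = "C \<inter> (branch \<inter> {..fst z} \<times> UNIV)"
    have K: "compact ?K"
      by (rule closed_Int_compact[OF C_closed compact_branch_bounded])
    have inK: "x \<in> ?K" if "x \<in> C" "fst x \<le> fst z" for x
      using that C_sub by (auto simp: mem_Times_iff)
    have "?K \<noteq> {}"
      using inK[OF zC] by blast
    then obtain y where y: "y \<in> ?K" "\<forall>x\<in>?K. fst y \<le> fst x"
      using continuous_attains_inf[OF K _ continuous_on_fst[OF continuous_on_id]] by blast
    have min: "fst y \<le> fst x" if "x \<in> C" for x
    proof (cases "fst x \<le> fst z")
      case True
      then show ?thesis using y(2) inK[OF that] by blast
    next
      case False
      have "fst y \<le> fst z" using y(2) inK[OF zC] by blast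
      then show ?thesis using False by linarith
    qed
    have "connected (fst ` C)"
      using C_conn by (intro connected_continuous_image continuous_on_fst continuous_on_id)
    then have ivl: "{fst y..fst x} \<subseteq> fst ` C" if "x \<in> C" for x
      using y(1) that by (intro connected_contains_Icc) auto
    have "{fst y..} \<subseteq> fst ` C"
    proof
      fix \<mu> assume \<mu>: "\<mu> \<in> {fst y..}"
      obtain \<epsilon> where \<epsilon>: "0 < \<epsilon>" "\<And>x. x \<in> \<zeta> \<Longrightarrow> norm_C \<delta> R (snd x) < \<epsilon> \<or> R - \<delta> - \<epsilon> < norm_C \<delta> R (snd x) \<Longrightarrow> \<mu> < fst x"
        using large by blast
      have "0 < min (\<epsilon> / 2) \<rho>\<^sub>0" "min (\<epsilon> / 2) \<rho>\<^sub>0 < R - \<delta>"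
        using \<epsilon>(1) \<rho>0 by auto
      from level[OF this] obtain x where "x \<in> \<zeta>" "norm_C \<delta> R (snd x) = min (\<epsilon> / 2) \<rho>\<^sub>0"
        by blast
      then have "\<mu> < fst x" and "fst x \<in> fst ` C"
        using \<epsilon>(1) fst_eq by (auto intro!: \<epsilon>(2))
      then show "\<mu> \<in> fst ` C"
        using ivl \<mu> by fastforce
    qed
    then have "fst ` \<zeta> = {fst y..}"
      using min fst_eq by auto
    moreover have "0 < fst y"
      using branch_parameter_pos[of "fst y" "snd y"] y(1) C_sub by auto
    ultimately show ?thesis by auto
  qed
  \<comment> \<open>The homeomorphism \<open>restrict_pair\<close> carries components to components.\<close>
  have is_component: "\<zeta> \<in> connected_components_of
      (subtopology (prod_topology euclideanreal (E_topology \<delta> R)) (Sigma_set N \<delta> R \<alpha> f))"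
    unfolding homeomorphic_map_connected_components_of[OF homeomorphic_map_restrict_pair] \<zeta>_def
    using C_comp by (rule imageI)
  have positive: "\<zeta> \<subseteq> {0<..} \<times> (E_topology \<delta> R interior_of P_cone \<delta> R)"
  proof
    fix x assume "x \<in> \<zeta>"
    then obtain y where y: "y \<in> branch" "x = restrict_pair y"
      using C_sub by (auto simp: \<zeta>_def)
    then show "x \<in> {0<..} \<times> (E_topology \<delta> R interior_of P_cone \<delta> R)"
      using branch_in_interior_P[OF y(1)] branch_parameter_pos[of "fst y" "snd y"]
      by (simp add: mem_Times_iff) (simp add: restrict_pair_def)
  qed
  have joins: "reaches_infinity_at \<delta> R \<zeta> 0 \<and> reaches_infinity_at \<delta> R \<zeta> (R - \<delta>)"
    using reaches[of 0] reaches[of "R - \<delta>"] by blast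
  have asymptotics: "\<exists>\<Lambda> \<rho>\<^sub>0. 0 < \<Lambda> \<and> \<rho>\<^sub>0 \<in> {0<..<R - \<delta>} \<and>
      \<zeta> \<inter> {(\<mu>, v) \<in> Sigma_set N \<delta> R \<alpha> f. \<Lambda> \<le> \<mu> \<and> norm_C \<delta> R v = \<rho>\<^sub>0} = {} \<and>
      (\<forall>n::nat. 1 \<le> n \<longrightarrow>
        ((\<lambda>(\<mu>, u). measure lebesgue {r \<in> {\<delta>..R}. \<bar>deriv_on \<delta> R u r - (- 1)\<bar> > 1 / real n})
          \<longlongrightarrow> 0) (branch_at_infinity \<delta> R \<zeta> \<rho>\<^sub>0)) \<and>
      ((\<lambda>(\<mu>, u). norm_C \<delta> R u) \<longlongrightarrow> R - \<delta>) (branch_at_infinity \<delta> R \<zeta> \<rho>\<^sub>0)"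
  proof (rule exI[of _ \<Lambda>], rule exI[of _ \<rho>\<^sub>0], intro conjI allI impI)
    show "\<rho>\<^sub>0 \<in> {0<..<R - \<delta>}" using \<rho>0 by simp
    show "((\<lambda>(\<mu>, u). measure lebesgue {r \<in> {\<delta>..R}. \<bar>deriv_on \<delta> R u r - (- 1)\<bar> > 1 / real n}) \<longlongrightarrow> 0) ?B"
      if "1 \<le> n" for n :: nat
      using meas_lim[OF that] by (simp only: case_prod_unfold)
    show "((\<lambda>(\<mu>, u). norm_C \<delta> R u) \<longlongrightarrow> R - \<delta>) ?B"
      using norm_lim by (simp only: case_prod_unfold)
  qed (fact \<Lambda>(1) empty)+
  show ?thesis
    by (rule bexI[OF _ is_component]) (intro conjI positive asymptotics proj joins[THEN conjunct1] joins[THEN conjunct2])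
qed

end
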